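(* Let $n>k>1$, let $\lambda\vdash k$ and $\mu\vdash n-k$, and let $V_{(\lambda,\mu)}$ be the corresponding irreducible $\mathfrak{S}_{n-1}$-global $\mathfrak{S}_n$-partial representation. Let $\mathfrak{S}_{n-1}':=\{\sigma\in\mathfrak{S}_n\mid\sigma(n)=n\}$. Then the restriction of $V_{(\lambda,\mu)}$ to $\mathfrak{S}_{n-1}'$ decomposes, as an $\mathfrak{S}_{n-1}'$-partial representation, as $$\mathsf{Res}_{\mathfrak{S}_{n-1}'}^{\mathfrak{S}_n}V_{(\lambda,\mu)}\cong\bigoplus_{\lambda^1\to\lambda}V_{(\lambda^1,\mu)}\oplus\bigoplus_{\mu^1\to\mu}V_{(\lambda,\mu^1)},$$ where the $V_{(\lambda^1,\mu)}$ and $V_{(\lambda,\mu^1)}$ are the corresponding irreducible $\mathfrak{S}_{n-2}'$-global $\mathfrak{S}_{n-1}'$-partial representations, with $\mathfrak{S}_{n-2}':=\{\sigma\in\mathfrak{S}_n\mid\sigma(1)=1,\ \sigma(n)=n\}$.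
   Context: All vector spaces are finite-dimensional over $\mathbb{C}$. For a subgroup $H$ of a finite group $G$, a $G$-partial representation $(V,\pi)$ is a map $\pi\colon G\to\operatorname{End}(V)$ such that for all $g,h\in G$: $\pi(1_G)=\mathrm{Id}_V$; $\pi(g^{-1})\pi(gh)=\pi(g^{-1})\pi(g)\pi(h)$; $\pi(gh)\pi(h^{-1})=\pi(g)\pi(h)\pi(h^{-1})$. It is $H$-global if the restriction of $\pi$ to $H$ is a (usual) representation of $H$. For a subgroup $G'$ of $G$, $\mathsf{Res}_{G'}^GV$ is the $G'$-partial representation $(V,\pi|_{G'})$. Isomorphisms are linear isomorphisms commuting with the maps $\pi(g)$. For $m\geq1$, $\mathfrak{S}_{m-1}\subseteq\mathfrak{S}_m$ denotes the subgroup of permutations fixing $1$. Definition of $V_{(\alpha,\beta)}$ for $\alpha\vdash l$, $\beta\vdash m-l$, $1\leq l\leq m$: let $\{V_\nu\}_{\nu\vdash p}$ be the standard irreducible representations of $\mathfrak{S}_p$. Let $[l]=\{1,\dots,l\}$, $K=\{\sigma\in\mathfrak{S}_m\mid\sigma([l])=[l]\}\equiv\mathfrak{S}_l\times\mathfrak{S}_{m-l}$ and $W=V_\alpha\otimes V_\beta$, a representation of $K$. Then $V_{(\alpha,\beta)}$ is the subspace $\bigoplus_{\sigma K:\,1\in\sigma([l])}\sigma\otimes W$ of $\mathbb{C}[\mathfrak{S}_m]\otimes_{\mathbb{C}[K]}W$, with $\pi(g)(\sigma\otimes w)=g\sigma\otimes w$ if $1\in g\sigma([l])$ and $0$ otherwise;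 it is an irreducible $\mathfrak{S}_{m-1}$-global $\mathfrak{S}_m$-partial representation. $\mathfrak{S}_{n-1}'$ is identified with the symmetric group on $\{1,\dots,n-1\}$, and the representations on the right-hand side are those obtained with $m=n-1$. $\lambda^1\to\lambda$ means that the partition $\lambda^1$ is obtained from $\lambda$ by removing a corner, and likewise for $\mu^1\to\mu$. *)

theory Defs
  imports
    Complex_Main
    "HOL-Algebra.Sym_Groups"
    "HOL-Library.Function_Algebras"
    "HOL-Library.Product_Plus"
    "HOL-Library.FuncSet"
begin

section \<open>Complex vector spaces\<close>

class complex_vector = ab_group_add +
  fixes scaleC :: "complex \<Rightarrow> 'a \<Rightarrow> 'a"
  assumes scaleC_add_right: "scaleC a (x + y) = scaleC a x + scaleC a y"
    and scaleC_add_left: "scaleC (a + b) x = scaleC a x + scaleC b x"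
    and scaleC_scaleC: "scaleC a (scaleC b x) = scaleC (a * b) x"
    and scaleC_one: "scaleC 1 x = x"

interpretation cvec: vector_space "scaleC :: complex \<Rightarrow> 'a \<Rightarrow> 'a::complex_vector"
  by unfold_locales (simp_all add: scaleC_add_right scaleC_add_left scaleC_scaleC scaleC_one)

instantiation complex :: complex_vector
begin
definition scaleC_complex_def: "scaleC (a::complex) (x::complex) = a * x"
instance
  by standard (simp_all add: scaleC_complex_def algebra_simps)
end

instantiation "fun" :: (type, complex_vector) complex_vector
begin
definition scaleC_fun_def: "scaleC a f = (\<lambda>x. scaleC a (f x))"
instance
  by standard
    (simp_all add: scaleC_fun_def fun_eq_iff scaleC_add_right scaleC_add_left scaleC_scaleC
      scaleC_one)
end

instantiation prod :: (complex_vector, complex_vector) complex_vector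
begin
definition scaleC_prod_def: "scaleC a p = (scaleC a (fst p), scaleC a (snd p))"
instance
  by standard
    (simp_all add: scaleC_prod_def prod_eq_iff scaleC_add_right scaleC_add_left scaleC_scaleC
      scaleC_one)
end

definition fin_dim_space :: "'v::complex_vector set \<Rightarrow> bool" where
  "fin_dim_space V \<longleftrightarrow> (\<exists>B. finite B \<and> V = cvec.span B)"

definition linear_between ::
    "'v::complex_vector set \<Rightarrow> 'w::complex_vector set \<Rightarrow> ('v \<Rightarrow> 'w) \<Rightarrow> bool" where
  "linear_between V W f \<longleftrightarrow>
     f ` V \<subseteq> W \<and>
     (\<forall>x\<in>V. \<forall>y\<in>V. f (x + y) = f x + f y) \<and>
     (\<forall>c. \<forall>x\<in>V. f (scaleC c x) = scaleC c (f x))"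

section \<open>Partial representations\<close>

text \<open>A pair \<open>(V, \<pi>)\<close>: the space is a linear subspace \<open>V\<close> of an ambient type, and only the
  values of \<open>\<pi> g\<close> on \<open>V\<close>, for \<open>g\<close> in the group, matter.\<close>

type_synonym ('g, 'v) prep = "'v set \<times> ('g \<Rightarrow> 'v \<Rightarrow> 'v)"

definition partial_rep :: "('g, 'm) monoid_scheme \<Rightarrow> ('g, 'v::complex_vector) prep \<Rightarrow> bool" where
  "partial_rep G R \<longleftrightarrow> (case R of (V, \<pi>) \<Rightarrow>
     group G \<and> fin_dim_space V \<and>
     (\<forall>g\<in>carrier G. linear_between V V (\<pi> g)) \<and>
     (\<forall>v\<in>V. \<pi> \<one>\<^bsub>G\<^esub> v = v) \<and>
     (\<forall>g\<in>carrier G. \<forall>h\<in>carrier G. \<forall>v\<in>V.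
        \<pi> (inv\<^bsub>G\<^esub> g) (\<pi> (g \<otimes>\<^bsub>G\<^esub> h) v) = \<pi> (inv\<^bsub>G\<^esub> g) (\<pi> g (\<pi> h v))) \<and>
     (\<forall>g\<in>carrier G. \<forall>h\<in>carrier G. \<forall>v\<in>V.
        \<pi> (g \<otimes>\<^bsub>G\<^esub> h) (\<pi> (inv\<^bsub>G\<^esub> h) v) = \<pi> g (\<pi> h (\<pi> (inv\<^bsub>G\<^esub> h) v))))"

definition prep_iso ::
    "('g, 'm) monoid_scheme \<Rightarrow> ('g, 'v::complex_vector) prep \<Rightarrow> ('g, 'w::complex_vector) prep \<Rightarrow> bool"
  where
  "prep_iso G R S \<longleftrightarrow>
     partial_rep G R \<and> partial_rep G S \<and>
     (\<exists>f. linear_between (fst R) (fst S) f \<and> bij_betw f (fst R) (fst S) \<and>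
        (\<forall>g\<in>carrier G. \<forall>v\<in>fst R. f (snd R g v) = snd S g (f v)))"

definition prep_res :: "'g set \<Rightarrow> ('g, 'v) prep \<Rightarrow> ('g, 'v) prep" where
  "prep_res H R = (fst R, restrict (snd R) H)"

definition prep_sum ::
    "('g, 'v::complex_vector) prep \<Rightarrow> ('g, 'w::complex_vector) prep \<Rightarrow> ('g, 'v \<times> 'w) prep" where
  "prep_sum R S = (fst R \<times> fst S, \<lambda>g (v, w). (snd R g v, snd S g w))"

definition prep_dsum ::
    "'i set \<Rightarrow> ('i \<Rightarrow> ('g, 'v::complex_vector) prep) \<Rightarrow> ('g, 'i \<Rightarrow> 'v) prep" where
  "prep_dsum I R =
     ({x. (\<forall>i\<in>I. x i \<in> fst (R i)) \<and> (\<forall>i. i \<notin> I \<longrightarrow> x i = 0)},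
      \<lambda>g x i. if i \<in> I then snd (R i) g (x i) else 0)"

section \<open>Partitions\<close>

definition partition_of :: "nat \<Rightarrow> nat list \<Rightarrow> bool" where
  "partition_of p nu \<longleftrightarrow> sorted_wrt (\<ge>) nu \<and> (\<forall>a\<in>set nu. 0 < a) \<and> sum_list nu = p"

definition cells :: "nat list \<Rightarrow> (nat \<times> nat) set" where
  "cells nu = {(i, j). i < length nu \<and> j < nu ! i}"

definition corner :: "nat list \<Rightarrow> nat \<times> nat \<Rightarrow> bool" where
  "corner nu c \<longleftrightarrow> c \<in> cells nu \<and> (Suc (fst c), snd c) \<notin> cells nu \<and> (fst c, Suc (snd c)) \<notin> cells nu"

text \<open>The partitions \<open>nu1\<close> with \<open>nu1 \<rightarrow> nu\<close>.\<close>

definition corner_removals :: "nat list \<Rightarrow> nat list set" where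
  "corner_removals nu =
     {nu1. partition_of (sum_list nu1) nu1 \<and> (\<exists>c. corner nu c \<and> cells nu1 = cells nu - {c})}"

section \<open>Specht modules\<close>

definition tableau :: "nat list \<Rightarrow> (nat \<times> nat \<Rightarrow> nat) \<Rightarrow> bool" where
  "tableau nu t \<longleftrightarrow> bij_betw t (cells nu) {1..sum_list nu}"

text \<open>A row-equivalence class of tableaux is encoded by the family of its row contents.\<close>

type_synonym tabloid = "nat \<Rightarrow> nat set"

definition tabloid_of :: "nat list \<Rightarrow> (nat \<times> nat \<Rightarrow> nat) \<Rightarrow> tabloid" where
  "tabloid_of nu t = (\<lambda>i. t ` {c \<in> cells nu. fst c = i})"

definition tabloid_act :: "(nat \<Rightarrow> nat) \<Rightarrow> tabloid \<Rightarrow> tabloid" where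
  "tabloid_act g T = (\<lambda>i. g ` T i)"

definition col_stab :: "nat list \<Rightarrow> (nat \<times> nat \<Rightarrow> nat) \<Rightarrow> (nat \<Rightarrow> nat) set" where
  "col_stab nu t =
     {s. s permutes {1..sum_list nu} \<and>
         (\<forall>j. s ` t ` {c \<in> cells nu. snd c = j} = t ` {c \<in> cells nu. snd c = j})}"

definition polytabloid :: "nat list \<Rightarrow> (nat \<times> nat \<Rightarrow> nat) \<Rightarrow> tabloid \<Rightarrow> complex" where
  "polytabloid nu t =
     (\<Sum>s\<in>col_stab nu t. (\<lambda>T. if T = tabloid_act s (tabloid_of nu t) then of_int (sign s) else 0))"

text \<open>The standard irreducible representation \<open>V\<^sub>\<nu>\<close> is the Specht module, inside the permutation
  module of complex functions on tabloids.\<close>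

definition specht_space :: "nat list \<Rightarrow> (tabloid \<Rightarrow> complex) set" where
  "specht_space nu = cvec.span (polytabloid nu ` {t. tableau nu t})"

definition specht_act :: "(nat \<Rightarrow> nat) \<Rightarrow> (tabloid \<Rightarrow> complex) \<Rightarrow> tabloid \<Rightarrow> complex" where
  "specht_act g f = (\<lambda>T. f (tabloid_act (inv' g) T))"

section \<open>The representations \<open>V\<^sub>(\<^sub>\<alpha>\<^sub>,\<^sub>\<beta>\<^sub>)\<close>\<close>

text \<open>The subgroup \<open>K\<close>, and the two components of \<open>\<kappa> \<in> K\<close> under
  \<open>K \<equiv> S\<^sub>l \<times> S\<^sub>m\<^sub>-\<^sub>l\<close>; the second one is shifted from \<open>{l+1..m}\<close> to \<open>{1..m-l}\<close>.\<close>

definition young_K :: "nat \<Rightarrow> nat \<Rightarrow> (nat \<Rightarrow> nat) set" where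
  "young_K m l = {k \<in> carrier (sym_group m). k ` {1..l} = {1..l}}"

definition comp1 :: "nat \<Rightarrow> (nat \<Rightarrow> nat) \<Rightarrow> nat \<Rightarrow> nat" where
  "comp1 l k = (\<lambda>i. if i \<in> {1..l} then k i else i)"

definition comp2 :: "nat \<Rightarrow> (nat \<Rightarrow> nat) \<Rightarrow> nat \<Rightarrow> nat" where
  "comp2 l k = (\<lambda>j. if 1 \<le> j then k (j + l) - l else j)"

text \<open>Functions on \<open>X\<close> tensor functions on \<open>Y\<close> are functions on \<open>X \<times> Y\<close>, so \<open>W = V\<^sub>\<alpha> \<otimes> V\<^sub>\<beta>\<close>
  is the span of the products \<open>f \<otimes> h\<close>, and \<open>\<kappa>\<close> acts linearly by
  \<open>f \<otimes> h \<mapsto> \<kappa>\<^sub>1 f \<otimes> \<kappa>\<^sub>2 h\<close> (lemma \<open>W_act_tensor\<close>).\<close>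

definition tensor :: "('x \<Rightarrow> complex) \<Rightarrow> ('y \<Rightarrow> complex) \<Rightarrow> 'x \<times> 'y \<Rightarrow> complex" where
  "tensor f h = (\<lambda>(x, y). f x * h y)"

definition W_space :: "nat list \<Rightarrow> nat list \<Rightarrow> (tabloid \<times> tabloid \<Rightarrow> complex) set" where
  "W_space al be = cvec.span {tensor f h | f h. f \<in> specht_space al \<and> h \<in> specht_space be}"

definition W_act ::
    "nat \<Rightarrow> (nat \<Rightarrow> nat) \<Rightarrow> (tabloid \<times> tabloid \<Rightarrow> complex) \<Rightarrow> tabloid \<times> tabloid \<Rightarrow> complex" where
  "W_act l k F =
     (\<lambda>(S, T). F (tabloid_act (inv' (comp1 l k)) S, tabloid_act (inv' (comp2 l k)) T))"

lemma W_act_tensor: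
  "W_act l k (tensor f h) = tensor (specht_act (comp1 l k) f) (specht_act (comp2 l k) h)"
  by (simp add: W_act_def tensor_def specht_act_def)

text \<open>\<open>\<complex>[S\<^sub>m] \<otimes>\<^bsub>\<complex>[K]\<^esub> W\<close> is realised by functions \<open>F : S\<^sub>m \<rightarrow> W\<close> with
  \<open>F (\<tau> \<kappa>) = \<kappa>\<^sup>-\<^sup>1 F \<tau>\<close>: the element \<open>\<sigma> \<otimes> w\<close> is the function supported on the coset
  \<open>\<sigma> K\<close> with value \<open>w\<close> at \<open>\<sigma>\<close>, so that \<open>\<sigma> \<kappa> \<otimes> w = \<sigma> \<otimes> \<kappa> w\<close>
  (lemma \<open>ind_tensor_balanced\<close>).\<close>

definition ind_tensor ::
    "nat \<Rightarrow> nat \<Rightarrow> (nat \<Rightarrow> nat) \<Rightarrow> (tabloid \<times> tabloid \<Rightarrow> complex) \<Rightarrow>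
     (nat \<Rightarrow> nat) \<Rightarrow> tabloid \<times> tabloid \<Rightarrow> complex" where
  "ind_tensor m l s w = (\<lambda>t. if t \<in> carrier (sym_group m) \<and> inv' t \<circ> s \<in> young_K m l
                              then W_act l (inv' t \<circ> s) w else 0)"

definition V_pair ::
    "nat list \<Rightarrow> nat list \<Rightarrow> (nat \<Rightarrow> nat, (nat \<Rightarrow> nat) \<Rightarrow> tabloid \<times> tabloid \<Rightarrow> complex) prep" where
  "V_pair al be =
     (let l = sum_list al; m = sum_list al + sum_list be in
      (cvec.span {ind_tensor m l s w | s w.
         s \<in> carrier (sym_group m) \<and> 1 \<in> s ` {1..l} \<and> w \<in> W_space al be},
       \<lambda>g F t. if 1 \<in> t ` {1..l} then F (inv' g \<circ> t) else 0))"

text \<open>As functions on \<open>nat\<close>, the permutations in \<open>S\<^sub>n\<close> fixing \<open>n\<close> are exactly the elements of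
  \<open>sym_group (n - 1)\<close>, which is the identification of \<open>S'\<^sub>n\<^sub>-\<^sub>1\<close> with \<open>S\<^sub>n\<^sub>-\<^sub>1\<close>.\<close>

definition fix_last :: "nat \<Rightarrow> (nat \<Rightarrow> nat) set" where
  "fix_last n = {g \<in> carrier (sym_group n). g n = n}"

lemma fix_last_eq:
  assumes "1 \<le> n"
  shows "fix_last n = carrier (sym_group (n - 1))"
proof -
  have e: "{1..n} = insert n {1..n - 1}" using assms by auto
  show ?thesis
  proof (intro equalityI subsetI)
    fix g assume "g \<in> fix_last n"
    then have g: "g permutes insert n {1..n - 1}" and gn: "g n = n"
      unfolding e [symmetric] by (simp_all add: fix_last_def sym_group_carrier)
    have "g permutes {1..n - 1}"
      by (rule permutes_superset [OF g]) (use gn in blast)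
    then show "g \<in> carrier (sym_group (n - 1))" by (simp add: sym_group_carrier)
  next
    fix g assume "g \<in> carrier (sym_group (n - 1))"
    then have g: "g permutes {1..n - 1}" by (simp add: sym_group_carrier)
    have "g permutes {1..n}" by (rule permutes_subset [OF g]) auto
    moreover have "g n = n" by (rule permutes_not_in [OF g]) (use assms in auto)
    ultimately show "g \<in> fix_last n" by (simp add: fix_last_def sym_group_carrier)
  qed
qed

lemma young_K_permutes: "k \<in> young_K m l \<Longrightarrow> k permutes {1..m}"
  by (simp add: young_K_def sym_group_carrier)

lemma young_K_comp:
  assumes "k1 \<in> young_K m l" "k2 \<in> young_K m l"
  shows "k1 \<circ> k2 \<in> young_K m l"
proof -
  have "k1 ` k2 ` {1..l} = {1..l}" using assms by (simp add: young_K_def)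
  then show ?thesis
    using assms by (simp add: young_K_def sym_group_carrier permutes_compose image_comp)
qed

lemma young_K_inv:
  assumes "k \<in> young_K m l"
  shows "inv' k \<in> young_K m l"
proof -
  have p: "k permutes {1..m}" and e: "k ` {1..l} = {1..l}"
    using assms by (simp_all add: young_K_def sym_group_carrier)
  have "inv' k ` k ` {1..l} = {1..l}"
    using permutes_inj [OF p] by (simp add: image_comp)
  then show ?thesis
    using p e by (simp add: young_K_def sym_group_carrier permutes_inv)
qed

lemma young_K_low:
  assumes "k \<in> young_K m l" shows "k i \<in> {1..l} \<longleftrightarrow> i \<in> {1..l}"
proof -
  have "k ` {1..l} = {1..l}" using assms by (simp add: young_K_def)
  then show ?thesis
    using inj_image_mem_iff [OF permutes_inj [OF young_K_permutes [OF assms]], of i "{1..l}"]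
    by metis
qed

lemma young_K_high:
  assumes "k \<in> young_K m l" "1 \<le> j" shows "l < k (j + l)"
proof -
  have "k (j + l) \<notin> {1..l}"
    using young_K_low [OF assms(1), of "j + l"] assms(2) by simp
  moreover have "k (j + l) \<noteq> 0"
  proof
    assume "k (j + l) = 0"
    moreover have "k 0 = 0"
      using permutes_not_in [OF young_K_permutes [OF assms(1)], of 0] by simp
    ultimately show False
      using permutes_inj [OF young_K_permutes [OF assms(1)]] assms(2)
      by (metis add_is_0 injD not_one_le_zero)
  qed
  ultimately show ?thesis by auto
qed

lemma comp1_comp:
  assumes "k1 \<in> young_K m l" "k2 \<in> young_K m l"
  shows "comp1 l (k1 \<circ> k2) = comp1 l k1 \<circ> comp1 l k2"
  using young_K_low [OF assms(2)] by (auto simp: comp1_def fun_eq_iff)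

lemma comp2_comp:
  assumes "k1 \<in> young_K m l" "k2 \<in> young_K m l"
  shows "comp2 l (k1 \<circ> k2) = comp2 l k1 \<circ> comp2 l k2"
proof
  fix j
  show "comp2 l (k1 \<circ> k2) j = (comp2 l k1 \<circ> comp2 l k2) j"
  proof (cases "1 \<le> j")
    case True
    then have "1 \<le> k2 (j + l) - l" "k2 (j + l) - l + l = k2 (j + l)"
      using young_K_high [OF assms(2)] by (simp_all add: Suc_le_eq less_imp_le)
    then show ?thesis using True by (simp add: comp2_def)
  qed (simp add: comp2_def)
qed

lemma comp1_id: "comp1 l id = id"
  by (auto simp: comp1_def)

lemma comp2_id: "comp2 l id = id"
  by (auto simp: comp2_def)

lemma comp_bij:
  assumes "k \<in> young_K m l"
  shows "bij (comp1 l k)" "bij (comp2 l k)"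
proof -
  note i = young_K_inv [OF assms]
  have e: "k \<circ> inv' k = id" "inv' k \<circ> k = id"
    using permutes_inv_o [OF young_K_permutes [OF assms]] by simp_all
  show "bij (comp1 l k)"
    using comp1_comp [OF assms i] comp1_comp [OF i assms] e comp1_id
    by (intro o_bij [of "comp1 l (inv' k)"]) simp_all
  show "bij (comp2 l k)"
    using comp2_comp [OF assms i] comp2_comp [OF i assms] e comp2_id
    by (intro o_bij [of "comp2 l (inv' k)"]) simp_all
qed

lemma tabloid_act_comp: "tabloid_act (g \<circ> h) T = tabloid_act g (tabloid_act h T)"
  by (simp add: tabloid_act_def image_comp)

lemma W_act_comp:
  assumes "k1 \<in> young_K m l" "k2 \<in> young_K m l"
  shows "W_act l (k1 \<circ> k2) w = W_act l k1 (W_act l k2 w)"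
proof -
  have "inv' (comp1 l (k1 \<circ> k2)) = inv' (comp1 l k2) \<circ> inv' (comp1 l k1)"
    unfolding comp1_comp [OF assms]
    by (rule o_inv_distrib [OF comp_bij(1) [OF assms(1)] comp_bij(1) [OF assms(2)]])
  moreover have "inv' (comp2 l (k1 \<circ> k2)) = inv' (comp2 l k2) \<circ> inv' (comp2 l k1)"
    unfolding comp2_comp [OF assms]
    by (rule o_inv_distrib [OF comp_bij(2) [OF assms(1)] comp_bij(2) [OF assms(2)]])
  ultimately show ?thesis
    by (simp add: W_act_def tabloid_act_comp)
qed

lemma ind_tensor_balanced:
  assumes "s \<in> carrier (sym_group m)" "k \<in> young_K m l"
  shows "ind_tensor m l (s \<circ> k) w = ind_tensor m l s (W_act l k w)"
proof
  fix t
  have "inv' t \<circ> (s \<circ> k) \<in> young_K m l \<longleftrightarrow> inv' t \<circ> s \<in> young_K m l"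
  proof
    assume "inv' t \<circ> (s \<circ> k) \<in> young_K m l"
    from young_K_comp [OF this young_K_inv [OF assms(2)]]
    show "inv' t \<circ> s \<in> young_K m l"
      using permutes_inv_o [OF young_K_permutes [OF assms(2)]] by (simp add: comp_assoc)
  next
    assume "inv' t \<circ> s \<in> young_K m l"
    from young_K_comp [OF this assms(2)] show "inv' t \<circ> (s \<circ> k) \<in> young_K m l"
      by (simp add: comp_assoc)
  qed
  then show "ind_tensor m l (s \<circ> k) w t = ind_tensor m l s (W_act l k w) t"
    using W_act_comp [OF _ assms(2), of "inv' t \<circ> s" w] by (simp add: ind_tensor_def comp_assoc)
qed

text \<open>The action of \<open>V_pair\<close> is \<open>\<pi>(g)(\<sigma> \<otimes> w) = g \<sigma> \<otimes> w\<close> if \<open>1 \<in> g \<sigma> [l]\<close>, and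
  \<open>0\<close> otherwise.\<close>

lemma V_pair_act:
  assumes "l = sum_list al" "m = sum_list al + sum_list be"
    and g: "g \<in> carrier (sym_group m)" and s: "s \<in> carrier (sym_group m)"
  shows "snd (V_pair al be) g (ind_tensor m l s w) =
    (if 1 \<in> (g \<circ> s) ` {1..l} then ind_tensor m l (g \<circ> s) w else 0)"
proof
  fix t
  have gp: "g permutes {1..m}" and sp: "s permutes {1..m}"
    using g s by (simp_all add: sym_group_carrier)
  have t_iff: "inv' g \<circ> t permutes {1..m} \<longleftrightarrow> t permutes {1..m}"
    using permutes_compose [OF _ permutes_inv [OF gp], of t]
      permutes_compose [OF _ gp, of "inv' g \<circ> t"] permutes_inv_o(1) [OF gp]
    by (auto simp: comp_assoc [symmetric])
  have cos: "inv' (inv' g \<circ> t) \<circ> s = inv' t \<circ> (g \<circ> s)" if "t permutes {1..m}"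
    using o_inv_distrib [OF permutes_bij [OF permutes_inv [OF gp]] permutes_bij [OF that]]
    by (simp add: comp_assoc permutes_inv_inv [OF gp])
  have img: "t ` {1..l} = (g \<circ> s) ` {1..l}"
    if t: "t permutes {1..m}" and "inv' t \<circ> (g \<circ> s) \<in> young_K m l"
  proof -
    have "(inv' t \<circ> (g \<circ> s)) ` {1..l} = {1..l}" using that by (simp add: young_K_def)
    then have "t ` (inv' t \<circ> (g \<circ> s)) ` {1..l} = t ` {1..l}" by simp
    moreover have "t \<circ> (inv' t \<circ> (g \<circ> s)) = g \<circ> s"
      using permutes_inv_o(1) [OF t] by (metis comp_assoc id_comp)
    ultimately show ?thesis by (metis image_comp)
  qed
  have lhs: "snd (V_pair al be) g (ind_tensor m l s w) t =
      (if 1 \<in> t ` {1..l} then ind_tensor m l s w (inv' g \<circ> t) else 0)"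
    by (simp add: V_pair_def Let_def assms(1,2))
  show "snd (V_pair al be) g (ind_tensor m l s w) t =
    (if 1 \<in> (g \<circ> s) ` {1..l} then ind_tensor m l (g \<circ> s) w else 0) t"
  proof (cases "t permutes {1..m} \<and> inv' t \<circ> (g \<circ> s) \<in> young_K m l")
    case True
    then have c: "inv' (inv' g \<circ> t) \<circ> s = inv' t \<circ> (g \<circ> s)"
      and i: "t ` {1..l} = (g \<circ> s) ` {1..l}"
      using cos img by blast+
    have "ind_tensor m l s w (inv' g \<circ> t) = ind_tensor m l (g \<circ> s) w t"
      unfolding ind_tensor_def sym_group_carrier t_iff c using True by simp
    then show ?thesis unfolding lhs i by simp
  next
    case False
    then have "ind_tensor m l (g \<circ> s) w t = 0"
      unfolding ind_tensor_def sym_group_carrier by auto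
    moreover have "ind_tensor m l s w (inv' g \<circ> t) = 0"
      using False cos unfolding ind_tensor_def sym_group_carrier t_iff by auto
    ultimately show ?thesis unfolding lhs by simp
  qed
qed

end

theory Submission
  imports Defs
begin

text \<open>By Schur--Weyl duality the Specht module of \<open>\<nu> \<turnstile> n\<close> is the space of highest weight
  vectors of weight \<open>\<nu>\<close> among the functions on tabloids. In this form branching is transparent:
  split a highest weight vector \<open>f\<close> according to the row of \<open>n\<close>, and delete \<open>n\<close>. The part for the
  lowest row \<open>j\<close> that occurs is again a highest weight vector, of weight \<open>\<nu> - e\<^sub>j\<close>; it vanishes unless
  this weight is dominant, that is, unless row \<open>j\<close> ends in a corner. This filters the Specht module
  with the right quotients, and Maschke's theorem splits the filtration.

  The cosets \<open>\<sigma> K\<close> with \<open>1 \<in> \<sigma> [k]\<close> fall into two orbits under the permutations fixing \<open>n\<close>,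
  according to whether \<open>n \<in> \<sigma> [k]\<close>. On the first orbit the coset stabilizer is
  \<open>S\<^sub>k\<^sub>-\<^sub>1 \<times> S\<^sub>n\<^sub>-\<^sub>k\<close> and \<open>V\<^sub>\<lambda>\<close> branches; on the second one it is \<open>S\<^sub>k \<times> S\<^sub>n\<^sub>-\<^sub>k\<^sub>-\<^sub>1\<close> and
  \<open>V\<^sub>\<mu>\<close> branches.\<close>

section \<open>Highest weight vectors on tabloids\<close>

text \<open>Polytabloids span the Specht module but satisfy many relations, so a map is hard to
  control through them. The raising operators describe the same space by linear equations, against
  which the deletion of n can be tested. No basis of standard tableaux and no dimension count
  enters: polytabloids satisfy the equations by a sign-reversing involution, and the converse
  inclusion is an induction on n that already contains the lifting half of branching. Dominance of
  weights is the sl_2 fact that negative highest weights do not occur in finite dimension, proved by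
  a norm computation. Deletion from row j is well behaved only on vectors with n in no row below j.
  Equivariant projections onto these subspaces extend the graded pieces to maps on the whole module;
  the resulting family is triangular along the filtration, hence jointly bijective. For the induced
  modules the orbit argument is Mackey's double coset formula. It is compatible with the truncation
  in the partial action because 1 and n are different points: removing n from \<sigma>[k] does not
  change whether this set contains 1.\<close>

lemma finite_subset_weights_vanish:
  fixes g :: "'a set \<Rightarrow> complex"
  assumes Z: "finite Z"
    and inner: "\<And>C. C \<subseteq> Z \<Longrightarrow> (\<Sum>x\<in>C. g (C - {x})) = 0"
    and card: "\<And>A. A \<subseteq> Z \<Longrightarrow> g A \<noteq> 0 \<Longrightarrow> card A < card (Z - A)"
    and A: "A \<subseteq> Z"
  shows "g A = 0"
proof -
  \<comment> \<open>\<open>F\<close> is adjoint to the operator \<open>E\<close> with \<open>E g = 0\<close>, and \<open>[E, F]\<close> acts on the coefficient at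
    \<open>C\<close> by \<open>|C| - |Z - C|\<close>, so \<open>\<parallel>F g\<parallel>\<^sup>2 = \<langle>E F g, g\<rangle> \<le> 0\<close>.\<close>
  define F where "F B = (\<Sum>y\<in>Z - B. g (insert y B))" for B
  have F: "(\<Sum>y\<in>C. F (C - {y})) = (of_nat (card C) - of_nat (card (Z - C))) * g C"
    if C: "C \<subseteq> Z" for C
  proof -
    have fC: "finite C" using C Z by (rule finite_subset)
    have "F (C - {y}) = g C + (\<Sum>z\<in>Z - C. g (insert z C - {y}))" if y: "y \<in> C" for y
    proof -
      have "Z - (C - {y}) = insert y (Z - C)" using y C by auto
      then have "F (C - {y}) = g (insert y (C - {y})) + (\<Sum>z\<in>Z - C. g (insert z (C - {y})))"
        unfolding F_def using Z y by simp
      moreover have "insert z (C - {y}) = insert z C - {y}" if "z \<in> Z - C" for z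
        using that y by auto
      ultimately show ?thesis using y by (simp add: insert_absorb)
    qed
    then have "(\<Sum>y\<in>C. F (C - {y})) =
        of_nat (card C) * g C + (\<Sum>z\<in>Z - C. \<Sum>y\<in>C. g (insert z C - {y}))"
      by (simp add: sum.distrib sum.swap [of _ "Z - C" C])
    also have "(\<Sum>z\<in>Z - C. \<Sum>y\<in>C. g (insert z C - {y})) = (\<Sum>z\<in>Z - C. - g C)"
    proof (rule sum.cong [OF refl])
      fix z assume z: "z \<in> Z - C"
      have "(\<Sum>y\<in>insert z C. g (insert z C - {y})) = 0"
        by (rule inner) (use z C in auto)
      then have "g C + (\<Sum>y\<in>C. g (insert z C - {y})) = 0"
        using z fC by simp
      then show "(\<Sum>y\<in>C. g (insert z C - {y})) = - g C"
        by (simp add: eq_neg_iff_add_eq_0 add.commute)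
    qed
    finally show ?thesis by (simp add: algebra_simps)
  qed
  have "(\<Sum>B\<in>Pow Z. F B * cnj (F B)) = (\<Sum>B\<in>Pow Z. \<Sum>y\<in>Z - B. g (insert y B) * cnj (F B))"
    by (subst (1) F_def) (simp add: sum_distrib_right)
  also have "\<dots> = (\<Sum>p\<in>Sigma (Pow Z) (\<lambda>B. Z - B). g (insert (snd p) (fst p)) * cnj (F (fst p)))"
    using Z by (subst sum.Sigma) (auto simp: case_prod_beta)
  \<comment> \<open>The exchange of (B, y), y outside B, with (insert y B, y) is the adjointness of
    \<open>F\<close> and the operator in \<open>inner\<close>.\<close>
  also have "\<dots> = (\<Sum>p\<in>Sigma (Pow Z) (\<lambda>C. C). g (fst p) * cnj (F (fst p - {snd p})))"
    by (rule sum.reindex_bij_witness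
        [of _ "\<lambda>p. (fst p - {snd p}, snd p)" "\<lambda>p. (insert (snd p) (fst p), snd p)"])
      (auto simp: insert_absorb)
  also have "\<dots> = (\<Sum>C\<in>Pow Z. \<Sum>y\<in>C. g C * cnj (F (C - {y})))"
    using Z by (subst sum.Sigma) (auto simp: case_prod_beta intro: finite_subset)
  also have "\<dots> = (\<Sum>C\<in>Pow Z. g C * cnj (\<Sum>y\<in>C. F (C - {y})))"
    by (simp add: sum_distrib_left)
  also have "\<dots> = (\<Sum>C\<in>Pow Z. of_real ((real (card C) - real (card (Z - C))) * (cmod (g C))\<^sup>2))"
    by (rule sum.cong [OF refl]) (simp add: F mult_ac flip: complex_norm_square)
  also have "(\<Sum>B\<in>Pow Z. F B * cnj (F B)) = (\<Sum>B\<in>Pow Z. of_real ((cmod (F B))\<^sup>2))"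
    by (rule sum.cong [OF refl]) (simp only: complex_norm_square)
  finally have "(\<Sum>B\<in>Pow Z. of_real ((cmod (F B))\<^sup>2)) =
      (of_real (\<Sum>C\<in>Pow Z. (real (card C) - real (card (Z - C))) * (cmod (g C))\<^sup>2) :: complex)"
    by (simp only: of_real_sum)
  then have eq: "(\<Sum>B\<in>Pow Z. (cmod (F B))\<^sup>2) =
      (\<Sum>C\<in>Pow Z. (real (card C) - real (card (Z - C))) * (cmod (g C))\<^sup>2)"
    unfolding of_real_sum [symmetric] of_real_eq_iff .
  have le0: "(real (card C) - real (card (Z - C))) * (cmod (g C))\<^sup>2 \<le> 0" if "C \<subseteq> Z" for C
    using card [OF that] by (cases "g C = 0") (auto intro!: mult_nonpos_nonneg)
  \<comment> \<open>A sum of squares equals a sum without positive terms, so every term vanishes.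
    Where g A is nonzero, \<open>card\<close> makes the integer factor nonzero, a
    contradiction.\<close>
  have "0 \<le> (\<Sum>B\<in>Pow Z. (cmod (F B))\<^sup>2)" by (simp add: sum_nonneg)
  then have "(\<Sum>C\<in>Pow Z. - ((real (card C) - real (card (Z - C))) * (cmod (g C))\<^sup>2)) = 0"
    using eq le0 sum_nonpos [of "Pow Z" "\<lambda>C. (real (card C) - real (card (Z - C))) * (cmod (g C))\<^sup>2"]
    by (simp add: sum_negf)
  then have "\<forall>C\<in>Pow Z. - ((real (card C) - real (card (Z - C))) * (cmod (g C))\<^sup>2) = 0"
    by (subst (asm) sum_nonneg_eq_0_iff) (use Z le0 in auto)
  then have "(real (card A) - real (card (Z - A))) * (cmod (g A))\<^sup>2 = 0" using A by force
  then show ?thesis using card [OF A] by fastforce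
qed

text \<open>A word \<open>w\<close> records the row of each entry, so that moving the entry x to row
  i becomes the update \<open>w(x := i)\<close>.\<close>

definition rows :: "nat \<Rightarrow> (nat \<Rightarrow> nat) \<Rightarrow> tabloid" where
  "rows n w = (\<lambda>i. {x \<in> {1..n}. w x = i})"

lemma rows_eq_iff: "rows n w = rows n w' \<longleftrightarrow> (\<forall>x\<in>{1..n}. w x = w' x)"
proof
  assume "rows n w = rows n w'"
  then have "{x \<in> {1..n}. w x = i} = {x \<in> {1..n}. w' x = i}" for i
    unfolding rows_def by (rule fun_cong)
  then show "\<forall>x\<in>{1..n}. w x = w' x" by blast
qed (auto simp: rows_def)

lemma finite_rows [simp]: "finite (rows n w i)"
  by (simp add: rows_def)

text \<open>Highest weight vectors of weight \<open>a\<close>: a tabloid is a basis tensor of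
  \<open>(\<complex>\<^sup>N)\<^sup>\<otimes>\<^sup>n\<close>, and the vanishing sums are the raising operators.\<close>

definition hw :: "nat \<Rightarrow> (nat \<Rightarrow> nat) \<Rightarrow> (tabloid \<Rightarrow> complex) set" where
  "hw n a = {f. (\<forall>T. f T \<noteq> 0 \<longrightarrow> (\<exists>w. T = rows n w) \<and> (\<forall>i. card (T i) = a i)) \<and>
     (\<forall>i w. (\<Sum>x\<in>rows n w i. f (rows n (w(x := Suc i)))) = 0)}"

lemma hw_supp:
  assumes "f \<in> hw n a" "f T \<noteq> 0"
  obtains w where "T = rows n w" "\<And>i. card (T i) = a i"
  using assms unfolding hw_def by blast

lemma hw_raise:
  assumes "f \<in> hw n a"
  shows "(\<Sum>x\<in>rows n w i. f (rows n (w(x := Suc i)))) = 0"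
  using assms unfolding hw_def by blast

lemma hw_eqI:
  assumes "f \<in> hw n a" and "\<And>w. f (rows n w) = 0"
  shows "f = 0"
  using assms by (metis ext hw_supp zero_fun_def)

text \<open>With all rows except j and \<open>Suc j\<close> frozen, f becomes a function of the set
  A of entries in row j, a subset of \<open>Z\<close>. The raising operator between the two rows
  kills it, and its sl_2-weight \<open>a j - a (Suc j)\<close> is negative.\<close>

lemma hw_nondominant:
  assumes f: "f \<in> hw n a" and lt: "a j < a (Suc j)"
  shows "f = 0"
proof (rule hw_eqI [OF f])
  fix w0
  define Z where "Z = {x \<in> {1..n}. w0 x = j \<or> w0 x = Suc j}"
  define u where "u A = (\<lambda>x. if x \<in> A then j else if x \<in> Z then Suc j else w0 x)" for A
  have Z: "finite Z" by (simp add: Z_def)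
  have u1: "rows n (u A) j = A" if "A \<subseteq> Z" for A
    using that by (auto simp: rows_def u_def Z_def)
  have u2: "rows n (u A) (Suc j) = Z - A" if "A \<subseteq> Z" for A
    using that by (auto simp: rows_def u_def Z_def)
  have *: "f (rows n (u A)) = 0" if A: "A \<subseteq> Z" for A
  proof (rule finite_subset_weights_vanish [of Z "\<lambda>A. f (rows n (u A))", OF Z _ _ A])
    fix C assume C: "C \<subseteq> Z"
    have "(u C)(x := Suc j) = u (C - {x})" if "x \<in> C" for x
      using that subsetD [OF C that] by (auto simp: u_def fun_eq_iff)
    then show "(\<Sum>x\<in>C. f (rows n (u (C - {x})))) = 0"
      using hw_raise [OF f, of "u C" j] u1 [OF C] by simp
  next
    fix A assume A: "A \<subseteq> Z" "f (rows n (u A)) \<noteq> 0"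
    from hw_supp [OF f A(2)] have "card (rows n (u A) i) = a i" for i by metis
    from this [of j] this [of "Suc j"] show "card A < card (Z - A)"
      using u1 [OF A(1)] u2 [OF A(1)] lt by simp
  qed
  have "u {x \<in> {1..n}. w0 x = j} x = w0 x" if "x \<in> {1..n}" for x
    using that by (auto simp: u_def Z_def)
  then have "rows n (u {x \<in> {1..n}. w0 x = j}) = rows n w0" by (simp add: rows_eq_iff)
  moreover have "{x \<in> {1..n}. w0 x = j} \<subseteq> Z" by (auto simp: Z_def)
  ultimately show "f (rows n w0) = 0" using * by metis
qed

lemma subspace_hw: "cvec.subspace (hw n a)"
proof (rule cvec.subspaceI)
  show "0 \<in> hw n a" by (simp add: hw_def)
next
  fix f g assume f: "f \<in> hw n a" and g: "g \<in> hw n a"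
  show "f + g \<in> hw n a"
    unfolding hw_def
  proof (intro CollectI conjI allI impI)
    fix T assume "(f + g) T \<noteq> 0"
    then have "f T \<noteq> 0 \<or> g T \<noteq> 0" by auto
    then show "\<exists>w. T = rows n w" "card (T i) = a i" for i using f g by (metis hw_supp)+
  qed (simp add: sum.distrib hw_raise [OF f] hw_raise [OF g])
next
  fix c f assume f: "f \<in> hw n a"
  show "scaleC c f \<in> hw n a"
    unfolding hw_def
  proof (intro CollectI conjI allI impI)
    fix T assume "scaleC c f T \<noteq> 0"
    then have "f T \<noteq> 0" by (auto simp: scaleC_fun_def scaleC_complex_def)
    then show "\<exists>w. T = rows n w" "card (T i) = a i" for i using f by (metis hw_supp)+
  qed (simp add: scaleC_fun_def scaleC_complex_def flip: sum_distrib_left, simp add: hw_raise [OF f])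
qed

text \<open>The guard is needed because \<open>insert n\<close> forgets whether n was already
  present: without it, T and T with n added to row r would receive the same coefficient.\<close>

definition del :: "nat \<Rightarrow> nat \<Rightarrow> (tabloid \<Rightarrow> complex) \<Rightarrow> tabloid \<Rightarrow> complex" where
  "del n r f = (\<lambda>T. if n \<in> T r then 0 else f (T(r := insert n (T r))))"

lemma del_add: "del n r (f + g) = del n r f + del n r g"
  by (auto simp: del_def fun_eq_iff)

lemma del_scaleC: "del n r (scaleC c f) = scaleC c (del n r f)"
  by (auto simp: del_def fun_eq_iff scaleC_fun_def scaleC_complex_def)

lemma del_zero [simp]: "del n r 0 = 0"
  by (auto simp: del_def fun_eq_iff)

lemma del_diff: "del n r (f - g) = del n r f - del n r g"
  by (auto simp: del_def fun_eq_iff)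

lemma rows_insert:
  assumes "1 \<le> n"
  shows "rows n (w(n := r)) = (rows (n - 1) w)(r := insert n (rows (n - 1) w r))"
proof -
  have "x \<in> {1..n} \<longleftrightarrow> x \<in> {1..n - 1} \<or> x = n" for x using assms by auto
  then show ?thesis using assms by (fastforce simp: rows_def fun_eq_iff)
qed

lemma del_rows:
  assumes "1 \<le> n"
  shows "del n r f (rows (n - 1) w) = f (rows n (w(n := r)))"
  unfolding rows_insert [OF assms] using assms by (auto simp: del_def rows_def)

lemma hw_del_eq_0:
  assumes f: "f \<in> hw n a" and n: "1 \<le> n" and d: "\<And>r. del n r f = 0"
  shows "f = 0"
proof (rule hw_eqI [OF f])
  fix w
  have "f (rows n w) = del n (w n) f (rows (n - 1) w)"
    unfolding del_rows [OF n] by simp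
  then show "f (rows n w) = 0" by (simp add: d)
qed

text \<open>The raising equation of f at a word with n in row j is that of \<open>del n j f\<close>,
  except for i = j, where n itself may be moved. That extra term is a coefficient of
  \<open>del n (Suc j) f\<close>, which vanishes by \<open>top\<close>.\<close>

lemma del_hw:
  assumes f: "f \<in> hw n a" and n: "1 \<le> n" and top: "\<And>r. r > j \<Longrightarrow> del n r f = 0"
  shows "del n j f \<in> hw (n - 1) (a(j := a j - 1))"
  unfolding hw_def
proof (intro CollectI conjI allI impI)
  fix T assume "del n j f T \<noteq> 0"
  then have nT: "n \<notin> T j" and fT: "f (T(j := insert n (T j))) \<noteq> 0"
    by (auto simp: del_def split: if_splits)
  from hw_supp [OF f fT] obtain w where w: "T(j := insert n (T j)) = rows n w"
    and c: "\<And>i. card ((T(j := insert n (T j))) i) = a i" by metis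
  have wn: "w n = j" using fun_cong [OF w, of j] n by (auto simp: rows_def)
  have mem: "x \<in> {1..n - 1} \<longleftrightarrow> x \<in> {1..n} \<and> x \<noteq> n" for x using n by auto
  have T: "T = rows (n - 1) w"
  proof
    fix i
    show "T i = rows (n - 1) w i"
    proof (cases "i = j")
      case True
      have "insert n (T j) = {x \<in> {1..n}. w x = j}" using fun_cong [OF w, of j] by (simp add: rows_def)
      then show ?thesis using True nT unfolding rows_def mem by blast
    next
      case False
      have "T i = {x \<in> {1..n}. w x = i}" using fun_cong [OF w, of i] False by (simp add: rows_def)
      then show ?thesis using wn False unfolding rows_def mem by auto
    qed
  qed
  show "\<exists>w. T = rows (n - 1) w" using T by blast
  have fin: "finite (T j)" unfolding T by simp
  fix i show "card (T i) = (a(j := a j - 1)) i"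
    using c [of i] nT fin by (auto split: if_splits)
next
  fix i w
  let ?w = "w(n := j)"
  have z: "(\<Sum>x\<in>rows n ?w i. f (rows n (?w(x := Suc i)))) = 0" by (rule hw_raise [OF f])
  have s: "(\<Sum>x\<in>rows (n - 1) w i. f (rows n (?w(x := Suc i)))) =
      (\<Sum>x\<in>rows (n - 1) w i. del n j f (rows (n - 1) (w(x := Suc i))))"
  proof (rule sum.cong [OF refl])
    fix x assume "x \<in> rows (n - 1) w i"
    then have "x \<noteq> n" using n by (auto simp: rows_def)
    then have "?w(x := Suc i) = (w(x := Suc i))(n := j)" by auto
    then show "f (rows n (?w(x := Suc i))) = del n j f (rows (n - 1) (w(x := Suc i)))"
      by (simp only: del_rows [OF n])
  qed
  show "(\<Sum>x\<in>rows (n - 1) w i. del n j f (rows (n - 1) (w(x := Suc i)))) = 0"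
  proof (cases "i = j")
    case False
    then have "rows n ?w i = rows (n - 1) w i" unfolding rows_insert [OF n] by simp
    then show ?thesis using z s by simp
  next
    case True
    have "n \<notin> rows (n - 1) w i" using n by (auto simp: rows_def)
    then have "f (rows n (?w(n := Suc i))) + (\<Sum>x\<in>rows (n - 1) w i. f (rows n (?w(x := Suc i)))) = 0"
      using z True fun_cong [OF rows_insert [OF n, of w j], of j] by simp
    moreover have "f (rows n (?w(n := Suc i))) = 0"
      using del_rows [OF n, of "Suc i" f w] top [of "Suc i"] True by simp
    ultimately show ?thesis using s by simp
  qed
qed

lemma del_empty_row:
  assumes f: "f \<in> hw n a" and r: "a r = 0"
  shows "del n r f = 0"
proof
  fix T show "del n r f T = 0 T"
  proof (rule ccontr)
    assume "del n r f T \<noteq> 0 T"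
    then have fT: "f (T(r := insert n (T r))) \<noteq> 0"
      by (auto simp: del_def split: if_splits)
    from hw_supp [OF f fT] obtain w where w: "T(r := insert n (T r)) = rows n w"
      and c: "\<And>i. card ((T(r := insert n (T r))) i) = a i" by metis
    have "finite (insert n (T r))" using fun_cong [OF w, of r] by (metis finite_rows fun_upd_same)
    then show False using c [of r] r by auto
  qed
qed

text \<open>The weight left after deletion is not dominant at j. The case \<open>a j = 0\<close> is
  separate because truncated subtraction would leave the weight unchanged.\<close>

lemma del_noncorner:
  assumes f: "f \<in> hw n a" and n: "1 \<le> n" and top: "\<And>r. r > j \<Longrightarrow> del n r f = 0"
    and j: "a j \<le> a (Suc j)"
  shows "del n j f = 0"
proof (cases "a j = 0")
  case True
  then show ?thesis by (rule del_empty_row [OF f])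
next
  case False
  show ?thesis
    by (rule hw_nondominant [OF del_hw [OF f n top], where j = j]) (use False j in auto)
qed

lemma del_specht_act:
  assumes g: "g permutes {1..n - 1}" and n: "1 \<le> n"
  shows "del n r (specht_act g f) = specht_act g (del n r f)"
proof
  fix T
  have gn: "inv' g n = n" using permutes_not_in [OF permutes_inv [OF g], of n] n by simp
  have "n \<in> inv' g ` T r \<longleftrightarrow> n \<in> T r"
    using gn inj_image_mem_iff [OF permutes_inj [OF permutes_inv [OF g]], of n] by metis
  moreover have "tabloid_act (inv' g) (T(r := insert n (T r))) =
      (tabloid_act (inv' g) T)(r := insert n (tabloid_act (inv' g) T r))"
    using gn by (auto simp: tabloid_act_def fun_eq_iff)
  ultimately show "del n r (specht_act g f) T = specht_act g (del n r f) T"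
    by (simp add: del_def specht_act_def) (simp add: tabloid_act_def)
qed

lemma tabloid_act_rows:
  assumes "g permutes {1..n}"
  shows "tabloid_act g (rows n w) = rows n (w \<circ> inv' g)"
proof
  fix i
  have "g ` {x \<in> {1..n}. w x = i} = {y \<in> {1..n}. w (inv' g y) = i}"
  proof (intro equalityI subsetI)
    fix y assume "y \<in> {y \<in> {1..n}. w (inv' g y) = i}"
    then have "inv' g y \<in> {x \<in> {1..n}. w x = i}"
      using permutes_in_image [OF permutes_inv [OF assms], of y] by blast
    then show "y \<in> g ` {x \<in> {1..n}. w x = i}"
      using permutes_inverses(1) [OF assms, of y] by (metis imageI)
  next
    fix y assume "y \<in> g ` {x \<in> {1..n}. w x = i}"
    then obtain x where "x \<in> {1..n}" "w x = i" "y = g x" by blast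
    then show "y \<in> {y \<in> {1..n}. w (inv' g y) = i}"
      using permutes_in_image [OF assms, of x] permutes_inverses(2) [OF assms, of x] by simp
  qed
  then show "tabloid_act g (rows n w) i = rows n (w \<circ> inv' g) i"
    by (simp add: tabloid_act_def rows_def)
qed

section \<open>Specht modules as spaces of highest weight vectors\<close>

text \<open>Padding by zeros turns a partition into a weight on all rows, the form in which
  \<open>hw\<close> takes it.\<close>

definition row_len :: "nat list \<Rightarrow> nat \<Rightarrow> nat" where
  "row_len nu i = (if i < length nu then nu ! i else 0)"

lemma cells_row_len: "c \<in> cells nu \<longleftrightarrow> snd c < row_len nu (fst c)"
  by (auto simp: cells_def row_len_def split: prod.splits)

lemma partition_row_len_antimono:
  assumes "partition_of p nu" "i \<le> i'"
  shows "row_len nu i' \<le> row_len nu i"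
proof (cases "i' < length nu \<and> i \<noteq> i'")
  case True
  then show ?thesis
    using assms unfolding partition_of_def row_len_def by (auto simp: sorted_wrt_iff_nth_less)
qed (use assms in \<open>auto simp: row_len_def\<close>)

lemma cells_mono:
  assumes "partition_of p nu" "(i', j') \<in> cells nu" "i \<le> i'" "j \<le> j'"
  shows "(i, j) \<in> cells nu"
  using assms(2-) partition_row_len_antimono [OF assms(1,3)] by (simp add: cells_row_len)

lemma finite_cells: "finite (cells nu)"
proof -
  have "cells nu = Sigma {..<length nu} (\<lambda>i. {..<nu ! i})" by (auto simp: cells_def)
  then show ?thesis by simp
qed

lemma finite_col_stab: "finite (col_stab nu t)"
  by (rule finite_subset [OF _ finite_permutations [of "{1..sum_list nu}"]])
    (auto simp: col_stab_def)

lemma sum_fun_apply: "(\<Sum>x\<in>A. f x) y = (\<Sum>x\<in>A. f x y)"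
  for f :: "'a \<Rightarrow> 'b \<Rightarrow> complex"
  by (induction A rule: infinite_finite_induct) auto

lemma polytabloid_apply:
  "polytabloid nu t T =
    (\<Sum>s\<in>col_stab nu t. if T = tabloid_act s (tabloid_of nu t) then of_int (sign s) else 0)"
  by (simp add: polytabloid_def sum_fun_apply)

definition row_word :: "nat list \<Rightarrow> (nat \<times> nat \<Rightarrow> nat) \<Rightarrow> nat \<Rightarrow> nat" where
  "row_word nu t x = fst (inv_into (cells nu) t x)"

lemma row_word_tableau:
  assumes "tableau nu t" "c \<in> cells nu"
  shows "row_word nu t (t c) = fst c"
  using assms unfolding row_word_def tableau_def by (metis bij_betw_inv_into_left)

lemma tableau_cell:
  assumes "tableau nu t" "x \<in> {1..sum_list nu}"
  obtains c where "c \<in> cells nu" "t c = x"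
  using assms unfolding tableau_def bij_betw_def by (metis imageE)

lemma tableau_range:
  assumes "tableau nu t" "c \<in> cells nu"
  shows "t c \<in> {1..sum_list nu}"
  using assms unfolding tableau_def bij_betw_def by blast

lemma tableau_inj:
  assumes "tableau nu t" "c \<in> cells nu" "c' \<in> cells nu" "t c = t c'"
  shows "c = c'"
  using assms unfolding tableau_def bij_betw_def by (metis inj_onD)

lemma tabloid_of_rows:
  assumes "tableau nu t"
  shows "tabloid_of nu t = rows (sum_list nu) (row_word nu t)"
proof
  fix i
  have "t ` {c \<in> cells nu. fst c = i} = {x \<in> {1..sum_list nu}. row_word nu t x = i}"
  proof (intro equalityI subsetI)
    fix x assume "x \<in> {x \<in> {1..sum_list nu}. row_word nu t x = i}"
    then have x: "x \<in> {1..sum_list nu}" "row_word nu t x = i" by blast+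
    obtain c where c: "c \<in> cells nu" "t c = x" using tableau_cell [OF assms x(1)] .
    then have "fst c = i" using row_word_tableau [OF assms c(1)] x(2) by simp
    then show "x \<in> t ` {c \<in> cells nu. fst c = i}" using c by blast
  next
    fix x assume "x \<in> t ` {c \<in> cells nu. fst c = i}"
    then show "x \<in> {x \<in> {1..sum_list nu}. row_word nu t x = i}"
      using row_word_tableau [OF assms] tableau_range [OF assms] by blast
  qed
  then show "tabloid_of nu t i = rows (sum_list nu) (row_word nu t) i"
    by (simp add: tabloid_of_def rows_def)
qed

lemma col_stab_permutes: "s \<in> col_stab nu t \<Longrightarrow> s permutes {1..sum_list nu}"
  by (simp add: col_stab_def)

lemma col_stab_tabloid:
  assumes "tableau nu t" "s \<in> col_stab nu t"
  shows "tabloid_act s (tabloid_of nu t) = rows (sum_list nu) (row_word nu t \<circ> inv' s)"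
  unfolding tabloid_of_rows [OF assms(1)] by (rule tabloid_act_rows [OF col_stab_permutes [OF assms(2)]])

lemma col_stab_cell:
  assumes t: "tableau nu t" and s: "s \<in> col_stab nu t" and c: "c \<in> cells nu"
  obtains c' where "c' \<in> cells nu" "snd c' = snd c" "s (t c) = t c'"
proof -
  have "s ` t ` {d \<in> cells nu. snd d = snd c} = t ` {d \<in> cells nu. snd d = snd c}"
    using s by (simp add: col_stab_def)
  moreover have "s (t c) \<in> s ` t ` {d \<in> cells nu. snd d = snd c}" using c by blast
  ultimately have "s (t c) \<in> t ` {d \<in> cells nu. snd d = snd c}" by metis
  then show ?thesis using that by auto
qed

text \<open>Keeps the involution of \<open>polytabloid_hw\<close> inside the column stabilizer: both
  transposed entries lie in one column set, and each such set is preserved.\<close>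

lemma col_stab_transpose:
  assumes t: "tableau nu t" and s: "s \<in> col_stab nu t"
    and c: "c \<in> cells nu" and c': "c' \<in> cells nu" and e: "snd c = snd c'"
  shows "transpose (s (t c)) (s (t c')) \<circ> s \<in> col_stab nu t"
  unfolding col_stab_def
proof (intro CollectI conjI allI)
  have sp: "s permutes {1..sum_list nu}" by (rule col_stab_permutes [OF s])
  have m: "s (t c) \<in> {1..sum_list nu}" "s (t c') \<in> {1..sum_list nu}"
    using tableau_range [OF t c] tableau_range [OF t c'] permutes_in_image [OF sp] by blast+
  show "(transpose (s (t c)) (s (t c')) \<circ> s) permutes {1..sum_list nu}"
    by (rule permutes_compose [OF sp permutes_swap_id [OF m]])
  fix j
  let ?C = "t ` {d \<in> cells nu. snd d = j}"
  have sC: "s ` ?C = ?C" using s by (simp add: col_stab_def)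
  have "s (t c) \<in> s ` ?C \<longleftrightarrow> s (t c') \<in> s ` ?C"
  proof -
    have "t d \<in> ?C \<longleftrightarrow> snd d = j" if "d \<in> cells nu" for d
      using tableau_inj [OF t that] that by blast
    then show ?thesis
      using c c' e by (simp add: inj_image_mem_iff [OF permutes_inj [OF sp]])
  qed
  then have "transpose (s (t c)) (s (t c')) ` ?C = ?C"
    unfolding sC by (rule transpose_image_eq [OF _])
  then show "(transpose (s (t c)) (s (t c')) \<circ> s) ` ?C = ?C"
    unfolding image_comp [symmetric] sC .
qed

lemma sign_transpose_comp:
  assumes "s permutes {1..n::nat}" "x \<noteq> y"
  shows "sign (transpose x y \<circ> s) = - sign s"
proof -
  have "permutation s" using assms(1) by (metis finite_atLeastAtMost permutation_permutes)
  then show ?thesis using assms(2)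
    by (simp add: sign_compose permutation_swap_id sign_swap_id)
qed

text \<open>The terms of the raised polytabloid cancel in pairs: a term places two entries of one column
  in the same row, and transposing them changes the sign only.\<close>

lemma polytabloid_hw:
  assumes p: "partition_of n nu" and t: "tableau nu t"
  shows "polytabloid nu t \<in> hw n (row_len nu)"
  unfolding hw_def
proof (intro CollectI conjI allI impI)
  have n: "sum_list nu = n" using p by (simp add: partition_of_def)
  {
    fix T assume "polytabloid nu t T \<noteq> 0"
    then obtain s where s: "s \<in> col_stab nu t" and T: "T = tabloid_act s (tabloid_of nu t)"
      unfolding polytabloid_apply
      by (auto elim!: sum.not_neutral_contains_not_neutral split: if_splits)
    then show "\<exists>w. T = rows n w" using col_stab_tabloid [OF t s] n by blast
    fix i
    have "card (T i) = card (t ` {c \<in> cells nu. fst c = i})"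
      unfolding T tabloid_act_def tabloid_of_def
      by (rule card_image [OF permutes_inj_on [OF col_stab_permutes [OF s]]])
    also have "\<dots> = card {c \<in> cells nu. fst c = i}"
      by (rule card_image) (use tableau_inj [OF t] in \<open>auto simp: inj_on_def\<close>)
    also have "{c \<in> cells nu. fst c = i} = Pair i ` {..<row_len nu i}"
      by (auto simp: cells_row_len)
    also have "card \<dots> = row_len nu i" by (simp add: card_image inj_on_def)
    finally show "card (T i) = row_len nu i" .
  }
  fix i w
  let ?r = "row_word nu t"
  define P where "P = {(x, s). x \<in> rows n w i \<and> s \<in> col_stab nu t \<and>
    rows n (w(x := Suc i)) = tabloid_act s (tabloid_of nu t)}"
  \<comment> \<open>In the tableau \<open>s \<circ> t\<close> the entry x occupies the cell
    \<open>d q\<close>, in row \<open>Suc i\<close>, and \<open>up q\<close> is the entry directly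
    above it. In \<open>w\<close> both lie in row i, so either may be the one that is moved down;
    \<open>h\<close> exchanges their roles.\<close>
  define d where "d q = inv_into (cells nu) t (inv' (snd q) (fst q))" for q :: "nat \<times> (nat \<Rightarrow> nat)"
  define up where "up q = snd q (t (i, snd (d q)))" for q
  define h where "h q = (up q, transpose (up q) (fst q) \<circ> snd q)" for q
  have P: "P \<subseteq> rows n w i \<times> col_stab nu t" by (auto simp: P_def)
  then have finP: "finite P" by (rule finite_subset) (simp add: finite_col_stab)
  have key: "h q \<in> P \<and> h (h q) = q \<and> sign (snd (h q)) = - sign (snd q)" if q: "q \<in> P" for q
  proof -
    obtain x s where xs: "q = (x, s)" by (cases q)
    have sq: "snd q = s" by (simp add: xs)
    have x: "x \<in> {1..n}" "w x = i" and s: "s \<in> col_stab nu t"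
      and r: "rows n (w(x := Suc i)) = tabloid_act s (tabloid_of nu t)"
      using q unfolding P_def xs by (simp_all add: rows_def)
    have e: "(w(x := Suc i)) z = ?r (inv' s z)" if "z \<in> {1..n}" for z
      using r that unfolding col_stab_tabloid [OF t s] n rows_eq_iff comp_def by blast
    have sp: "s permutes {1..n}" using col_stab_permutes [OF s] n by simp
    have "inv' s x \<in> {1..sum_list nu}" using x(1) permutes_in_image [OF permutes_inv [OF sp]] n by blast
    from tableau_cell [OF t this] obtain c where c: "c \<in> cells nu" "t c = inv' s x" .
    have dc: "d q = c" unfolding d_def xs using c t
      by (simp add: tableau_def bij_betw_def inv_into_f_eq)
    have sx: "s (t c) = x" using c(2) permutes_inverses(1) [OF sp] by simp
    have fc: "fst c = Suc i" using e [OF x(1)] row_word_tableau [OF t c(1)] c(2) by simp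
    define u where "u = (i, snd c)"
    have "(Suc i, snd c) \<in> cells nu" using c(1) by (simp flip: fc)
    then have u: "u \<in> cells nu" unfolding u_def by (rule cells_mono [OF p]) simp_all
    define y where "y = s (t u)"
    have upq: "up q = y" by (simp add: up_def u_def y_def dc) (simp add: xs)
    have hq: "h q = (y, transpose y x \<circ> s)" by (simp add: h_def upq) (simp add: xs)
    have yn: "y \<in> {1..n}"
      using tableau_range [OF t u] permutes_in_image [OF sp] n unfolding y_def by blast
    have iy: "inv' s y = t u" using permutes_inverses(2) [OF sp] by (simp add: y_def)
    have xy: "x \<noteq> y"
    proof
      assume "x = y"
      then have "t c = t u" using c(2) iy by simp
      then have "c = u" by (rule tableau_inj [OF t c(1) u])
      then show False using fc by (cases c) (simp add: u_def)
    qed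
    have wy: "w y = i" using e [OF yn] xy iy row_word_tableau [OF t u] by (simp add: u_def split: if_splits)
    define s' where "s' = transpose y x \<circ> s"
    have s': "s' \<in> col_stab nu t"
      unfolding s'_def using col_stab_transpose [OF t s u c(1)] sx by (simp add: u_def y_def)
    have inv_s': "inv' s' = inv' s \<circ> transpose y x"
      unfolding s'_def by (subst o_inv_distrib) (simp_all add: permutes_bij [OF sp])
    have e': "(w(y := Suc i)) z = ?r (inv' s' z)" if z: "z \<in> {1..n}" for z
    proof -
      consider "z = x" | "z = y" | "z \<noteq> x" "z \<noteq> y" by blast
      then show ?thesis
      proof cases
        case 1 then show ?thesis
          using xy iy row_word_tableau [OF t u] x(2) by (simp add: inv_s' u_def)
      next
        case 2 then show ?thesis
          using c row_word_tableau [OF t c(1)] fc by (simp add: inv_s')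
      next
        case 3 then show ?thesis using e [OF z] by (simp add: inv_s')
      qed
    qed
    have "rows n (w(y := Suc i)) = tabloid_act s' (tabloid_of nu t)"
      unfolding col_stab_tabloid [OF t s'] n rows_eq_iff using e' by auto
    moreover have "y \<in> rows n w i" using yn wy by (simp add: rows_def)
    ultimately have "h q \<in> P" using s' by (simp add: P_def hq s'_def)
    moreover have "h (h q) = q"
    proof -
      have "inv' s' y = t c" using c(2) by (simp add: inv_s')
      then have "d (h q) = c" unfolding d_def hq s'_def [symmetric] using c(1) t
        by (simp add: tableau_def bij_betw_def inv_into_f_eq)
      moreover have "s' (t u) = x" by (simp add: s'_def flip: y_def)
      ultimately have "up (h q) = x" by (simp add: up_def hq flip: u_def s'_def)
      moreover have "transpose x y \<circ> s' = s"
        unfolding s'_def by (simp add: transpose_commute [of x y] flip: comp_assoc)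
      moreover have "fst (h q) = y" "snd (h q) = s'" by (simp_all add: hq s'_def)
      ultimately have "h (h q) = (x, s)" unfolding h_def [of "h q"] by simp
      then show ?thesis unfolding xs .
    qed
    moreover have "sign (snd (h q)) = - sign (snd q)"
      unfolding hq sq snd_conv using sign_transpose_comp [OF sp, of y x] xy by simp
    ultimately show ?thesis by blast
  qed
  have "(\<Sum>x\<in>rows n w i. polytabloid nu t (rows n (w(x := Suc i)))) =
      (\<Sum>(x, s)\<in>rows n w i \<times> col_stab nu t. if (x, s) \<in> P then of_int (sign s) else 0)"
    unfolding polytabloid_apply sum.cartesian_product
    by (rule sum.cong [OF refl]) (auto simp: P_def)
  also have "\<dots> = (\<Sum>q\<in>P. of_int (sign (snd q)))"
    by (rule sum.mono_neutral_cong_right) (use P finite_col_stab in \<open>auto split: if_splits\<close>)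
  finally have 1: "(\<Sum>x\<in>rows n w i. polytabloid nu t (rows n (w(x := Suc i)))) =
      (\<Sum>q\<in>P. of_int (sign (snd q)))" .
  have "(\<Sum>q\<in>P. of_int (sign (snd q))) = (\<Sum>q\<in>P. - of_int (sign (snd q)) :: complex)"
    by (rule sum.reindex_bij_witness [of _ h h]) (simp_all add: key)
  then have "(\<Sum>q\<in>P. of_int (sign (snd q)) :: complex) = 0"
    by (simp add: sum_negf)
  then show "(\<Sum>x\<in>rows n w i. polytabloid nu t (rows n (w(x := Suc i)))) = 0" using 1 by simp
qed

section \<open>Deletion of n from polytabloids\<close>

lemma col_stab_superset:
  assumes "cells nu = insert (j, c) (cells nu1)" "(j, c) \<notin> cells nu1"
  shows "(s((j, c) := n)) ` {x \<in> cells nu. snd x = d} =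
      (if d = c then insert n (s ` {x \<in> cells nu1. snd x = d}) else s ` {x \<in> cells nu1. snd x = d})"
    and "(s((j, c) := n)) ` {x \<in> cells nu. fst x = i} =
      (if i = j then insert n (s ` {x \<in> cells nu1. fst x = i}) else s ` {x \<in> cells nu1. fst x = i})"
proof -
  have "{x \<in> cells nu. snd x = d} =
      (if d = c then insert (j, c) {x \<in> cells nu1. snd x = d} else {x \<in> cells nu1. snd x = d})"
    using assms by auto
  note e = this
  have "(s((j, c) := n)) ` {x \<in> cells nu1. snd x = d} = s ` {x \<in> cells nu1. snd x = d}"
    using assms(2) by (intro image_cong) auto
  note e' = this
  show "(s((j, c) := n)) ` {x \<in> cells nu. snd x = d} =
      (if d = c then insert n (s ` {x \<in> cells nu1. snd x = d}) else s ` {x \<in> cells nu1. snd x = d})"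
    unfolding e if_distrib [of "image (s((j, c) := n))"] image_insert e' fun_upd_same ..
  have "{x \<in> cells nu. fst x = i} =
      (if i = j then insert (j, c) {x \<in> cells nu1. fst x = i} else {x \<in> cells nu1. fst x = i})"
    using assms by auto
  note e = this
  have "(s((j, c) := n)) ` {x \<in> cells nu1. fst x = i} = s ` {x \<in> cells nu1. fst x = i}"
    using assms(2) by (intro image_cong) auto
  note e' = this
  show "(s((j, c) := n)) ` {x \<in> cells nu. fst x = i} =
      (if i = j then insert n (s ` {x \<in> cells nu1. fst x = i}) else s ` {x \<in> cells nu1. fst x = i})"
    unfolding e if_distrib [of "image (s((j, c) := n))"] image_insert e' fun_upd_same ..
qed

text \<open>Here n stands at the bottom of column c, so a column permutation can only move it up. It
  never reaches a row below j, and it stays in row j exactly if it is fixed. The column permutations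
  fixing n form the column stabilizer of s, with the same signs.\<close>

lemma del_polytabloid:
  assumes p: "partition_of n nu" and p1: "partition_of (n - 1) nu1" and n: "1 \<le> n"
    and c: "(j, c) \<in> cells nu" "(Suc j, c) \<notin> cells nu" and c1: "cells nu1 = cells nu - {(j, c)}"
    and s: "tableau nu1 s"
  shows "tableau nu (s((j, c) := n))"
    and "del n j (polytabloid nu (s((j, c) := n))) = polytabloid nu1 s"
    and "r > j \<Longrightarrow> del n r (polytabloid nu (s((j, c) := n))) = 0"
proof -
  let ?t = "s((j, c) := n)"
  have sn: "sum_list nu = n" "sum_list nu1 = n - 1" using p p1 by (simp_all add: partition_of_def)
  have ce: "cells nu = insert (j, c) (cells nu1)" and cn: "(j, c) \<notin> cells nu1" using c c1 by auto
  note img = col_stab_superset [OF ce cn, of s n]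
  have "bij_betw ?t (cells nu1) {1..n - 1} \<longleftrightarrow> bij_betw s (cells nu1) {1..n - 1}"
    by (rule bij_betw_cong) (use cn in auto)
  then have "bij_betw ?t (cells nu1) {1..n - 1}" using s by (simp add: tableau_def sn)
  then have "bij_betw ?t (cells nu1 \<union> {(j, c)}) ({1..n - 1} \<union> {?t (j, c)})"
    using n by (intro notIn_Un_bij_betw cn) auto
  moreover have "{1..n - 1} \<union> {?t (j, c)} = {1..n}" using n by auto
  ultimately show t: "tableau nu ?t" by (simp add: tableau_def sn ce)
  have range1: "n \<notin> s ` X" if "X \<subseteq> cells nu1" for X
    using tableau_range [OF s] that sn n by force
  have tab: "tabloid_of nu ?t = (tabloid_of nu1 s)(j := insert n (tabloid_of nu1 s j))"
    unfolding tabloid_of_def img by (simp add: fun_eq_iff)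
  have top: "r \<le> j \<and> (r = j \<longrightarrow> g n = n)"
    if g: "g \<in> col_stab nu ?t" and e: "T(r := insert n (T r)) = tabloid_act g (tabloid_of nu ?t)" for r g T
  proof -
    have "n \<in> tabloid_act g (tabloid_of nu ?t) r" unfolding e [symmetric] by simp
    then have "n \<in> g ` ?t ` {x \<in> cells nu. fst x = r}"
      by (simp only: tabloid_act_def tabloid_of_def)
    then obtain y where y: "n = g y" "y \<in> ?t ` {x \<in> cells nu. fst x = r}" by (rule imageE)
    from y(2) obtain x where x': "y = ?t x" "x \<in> {x \<in> cells nu. fst x = r}" by (rule imageE)
    then have x: "x \<in> cells nu" "fst x = r" "g (?t x) = n" using y(1) by simp_all
    obtain x' where x': "x' \<in> cells nu" "snd x' = snd x" "n = ?t x'"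
      by (rule col_stab_cell [OF t g x(1)]) (simp only: x(3))
    have "x' = (j, c)" by (rule tableau_inj [OF t x'(1) c(1)]) (use x'(3) in simp)
    then have xr: "x = (r, c)" using x(2) x'(2) by (cases x) simp
    have "\<not> Suc j \<le> r" using cells_mono [OF p, of r c "Suc j" c] x(1) xr c(2) by auto
    moreover have "g n = n" if "r = j" using x(3) xr that by simp
    ultimately show ?thesis by auto
  qed
  show "del n r (polytabloid nu ?t) = 0" if "r > j"
  proof
    fix T
    have "polytabloid nu ?t (T(r := insert n (T r))) = 0"
      unfolding polytabloid_apply using top that by (intro sum.neutral) (auto simp: not_le [symmetric])
    then show "del n r (polytabloid nu ?t) T = 0 T" by (simp add: del_def)
  qed
  have stab: "g \<in> col_stab nu1 s \<longleftrightarrow> g \<in> col_stab nu ?t \<and> g n = n" for g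
  proof (intro iffI conjI)
    assume g: "g \<in> col_stab nu1 s"
    then have gp: "g permutes {1..n - 1}" by (simp add: col_stab_def sn)
    show gn: "g n = n" by (rule permutes_not_in [OF gp]) (use n in auto)
    show "g \<in> col_stab nu ?t"
      unfolding col_stab_def sn img
      using permutes_subset [OF gp, of "{1..n}"] g gn by (auto simp: col_stab_def)
  next
    assume g: "g \<in> col_stab nu ?t \<and> g n = n"
    then have gp: "g permutes {1..n}" and gn: "g n = n" by (simp_all add: col_stab_def sn)
    show "g \<in> col_stab nu1 s"
      unfolding col_stab_def sn
    proof (intro CollectI conjI allI)
      have "{1..n} - {1..n - 1} = {n}" using n by auto
      then show "g permutes {1..n - 1}" using gn by (intro permutes_superset [OF gp]) auto
      fix d
      let ?X = "s ` {x \<in> cells nu1. snd x = d}"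
      have nX: "n \<notin> ?X" by (rule range1) auto
      then have "n \<notin> g ` ?X" using gn inj_image_mem_iff [OF permutes_inj [OF gp], of n ?X] by metis
      moreover have "g ` (if d = c then insert n ?X else ?X) = (if d = c then insert n ?X else ?X)"
        using g unfolding col_stab_def img by blast
      ultimately show "g ` ?X = ?X" using nX gn by (cases "d = c") (simp_all add: insert_ident)
    qed
  qed
  show "del n j (polytabloid nu ?t) = polytabloid nu1 s"
  proof
    fix T
    have nT1: "n \<notin> tabloid_act g (tabloid_of nu1 s) j" if "g \<in> col_stab nu1 s" for g
    proof -
      have gp: "g permutes {1..n - 1}" and gn: "g n = n"
        using that stab col_stab_permutes [OF that] sn by auto
      have "n \<notin> s ` {x \<in> cells nu1. fst x = j}" by (rule range1) auto
      then show ?thesis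
        using gn inj_image_mem_iff [OF permutes_inj [OF gp], of n]
        unfolding tabloid_act_def tabloid_of_def by metis
    qed
    show "del n j (polytabloid nu ?t) T = polytabloid nu1 s T"
    proof (cases "n \<in> T j")
      case True
      then have "polytabloid nu1 s T = 0"
        unfolding polytabloid_apply using nT1 by (intro sum.neutral) auto
      then show ?thesis using True by (simp add: del_def)
    next
      case False
      have eq: "T(j := insert n (T j)) = tabloid_act g (tabloid_of nu ?t) \<longleftrightarrow>
          T = tabloid_act g (tabloid_of nu1 s)" if g: "g \<in> col_stab nu1 s" for g
      proof -
        have "g n = n" using g stab by blast
        then have "tabloid_act g (tabloid_of nu ?t) = (tabloid_act g (tabloid_of nu1 s))
            (j := insert n (tabloid_act g (tabloid_of nu1 s) j))"
          unfolding tab by (simp add: tabloid_act_def fun_eq_iff)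
        moreover have "T(j := insert n (T j)) = U(j := insert n (U j)) \<longleftrightarrow> T = U"
          if "n \<notin> U j" for U
        proof
          assume e: "T(j := insert n (T j)) = U(j := insert n (U j))"
          have "T i = U i" for i
            using fun_cong [OF e, of i] insert_ident [OF False that] by (cases "i = j") auto
          then show "T = U" by blast
        qed simp
        ultimately show ?thesis using nT1 [OF g] by simp
      qed
      have "polytabloid nu ?t (T(j := insert n (T j))) = polytabloid nu1 s T"
        unfolding polytabloid_apply
        by (rule sum.mono_neutral_cong_right)
          (use finite_col_stab stab eq top in \<open>auto split: if_splits\<close>)
      then show ?thesis using False by (simp add: del_def)
    qed
  qed
qed

section \<open>Partitions and their removable corners\<close>

lemma card_cells: "card (cells nu) = sum_list nu"
proof -
  have "cells nu = Sigma {..<length nu} (\<lambda>i. {..<nu ! i})" by (auto simp: cells_def)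
  then show ?thesis by (simp add: sum_list_sum_nth atLeast0LessThan)
qed

lemma partition_row_len_pos:
  assumes "partition_of p nu"
  shows "0 < row_len nu i \<longleftrightarrow> i < length nu"
  using assms by (auto simp: partition_of_def row_len_def)

lemma partition_eqI:
  assumes "partition_of p nu" "partition_of q ka" "row_len nu = row_len ka"
  shows "nu = ka"
proof (rule nth_equalityI)
  have "i < length nu \<longleftrightarrow> i < length ka" for i
    using partition_row_len_pos assms by metis
  then show l: "length nu = length ka" by (meson linorder_neqE_nat less_irrefl)
  show "nu ! i = ka ! i" if "i < length nu" for i
    using fun_cong [OF assms(3), of i] that l by (simp add: row_len_def)
qed

lemma antimono_partition:
  fixes a :: "nat \<Rightarrow> nat"
  assumes a: "\<And>i i'. i \<le> i' \<Longrightarrow> a i' \<le> a i" and z: "a N = 0"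
  obtains nu where "partition_of (sum_list nu) nu" "row_len nu = a"
proof -
  define k where "k = (LEAST i. a i = 0)"
  have k0: "a k = 0" unfolding k_def using z by (rule LeastI)
  have k: "0 < a i \<longleftrightarrow> i < k" for i
    using not_less_Least [of i "\<lambda>i. a i = 0"] a [of k i] k0 unfolding k_def [symmetric]
    by (cases "i < k") auto
  define nu where "nu = map a [0..<k]"
  have "partition_of (sum_list nu) nu"
    using a k by (auto simp: partition_of_def nu_def sorted_wrt_iff_nth_less)
  moreover have "row_len nu = a" using k by (auto simp: row_len_def nu_def fun_eq_iff)
  ultimately show ?thesis using that by blast
qed

text \<open>A row has at most one corner, so this number determines \<open>nu1\<close>
  (\<open>removed_row_inj\<close>); it also places the summand of \<open>nu1\<close> in the
  filtration.\<close>

definition removed_row :: "nat list \<Rightarrow> nat list \<Rightarrow> nat" where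
  "removed_row nu nu1 = fst (the_elem (cells nu - cells nu1))"

lemma corner_removalsE:
  assumes p: "partition_of n nu" and nu1: "nu1 \<in> corner_removals nu"
  obtains j c where "removed_row nu nu1 = j" "(j, c) \<in> cells nu" "(Suc j, c) \<notin> cells nu"
    "cells nu1 = cells nu - {(j, c)}" "partition_of (n - 1) nu1" "1 \<le> n"
    "row_len nu1 = (row_len nu)(j := row_len nu j - 1)"
    "row_len nu (Suc j) < row_len nu j"
proof -
  obtain j c where co: "corner nu (j, c)" and ce: "cells nu1 = cells nu - {(j, c)}"
    and p1: "partition_of (sum_list nu1) nu1"
    using nu1 by (auto simp: corner_removals_def)
  have c: "(j, c) \<in> cells nu" "(Suc j, c) \<notin> cells nu" "(j, Suc c) \<notin> cells nu"
    using co by (simp_all add: corner_def)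
  have sn: "sum_list nu = n" using p by (simp add: partition_of_def)
  have "card (cells nu1) = card (cells nu) - 1" unfolding ce using c(1) by (simp add: finite_cells)
  then have s1: "sum_list nu1 = n - 1" by (simp add: card_cells sn)
  have "card (cells nu) \<noteq> 0" using c(1) card_0_eq [OF finite_cells, of nu] by blast
  then have n: "1 \<le> n" by (simp add: card_cells sn)
  have cj: "c = row_len nu j - 1" "row_len nu j \<noteq> 0" using c(1,3) by (auto simp: cells_row_len)
  have "row_len nu1 i = ((row_len nu)(j := row_len nu j - 1)) i" for i
  proof -
    have "{..<row_len nu1 i} = {d. (i, d) \<in> cells nu1}" by (auto simp: cells_row_len)
    also have "\<dots> = {..<((row_len nu)(j := row_len nu j - 1)) i}"
      unfolding ce using cj by (auto simp: cells_row_len)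
    finally show ?thesis by (simp only: lessThan_eq_iff)
  qed
  moreover have "removed_row nu nu1 = j"
  proof -
    have "cells nu - cells nu1 = {(j, c)}" using ce c(1) by auto
    then show ?thesis by (simp add: removed_row_def)
  qed
  moreover have "row_len nu (Suc j) < row_len nu j" using c by (auto simp: cells_row_len)
  ultimately show ?thesis using that c ce p1 n unfolding s1 by blast
qed

lemma removed_row_inj:
  assumes p: "partition_of n nu" and "nu1 \<in> corner_removals nu" "nu2 \<in> corner_removals nu"
    and "removed_row nu nu1 = removed_row nu nu2"
  shows "nu1 = nu2"
proof -
  let ?a = "(row_len nu)(removed_row nu nu1 := row_len nu (removed_row nu nu1) - 1)"
  have 1: "row_len nu1 = ?a" "partition_of (n - 1) nu1"
    using corner_removalsE [OF p assms(2)] by blast+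
  have 2: "row_len nu2 = ?a" "partition_of (n - 1) nu2"
    using corner_removalsE [OF p assms(3)] unfolding assms(4) by blast+
  show ?thesis by (rule partition_eqI [OF 1(2) 2(2)]) (simp add: 1(1) 2(1))
qed

lemma removed_row_less:
  assumes p: "partition_of n nu" and "nu1 \<in> corner_removals nu"
  shows "removed_row nu nu1 < length nu"
proof -
  have "row_len nu (Suc (removed_row nu nu1)) < row_len nu (removed_row nu nu1)"
    by (rule corner_removalsE [OF assms]) simp
  then show ?thesis by (simp add: row_len_def split: if_splits)
qed

lemma finite_corner_removals:
  assumes p: "partition_of n nu"
  shows "finite (corner_removals nu)"
proof (rule inj_on_finite)
  show "inj_on (removed_row nu) (corner_removals nu)"
    using removed_row_inj [OF p] by (auto intro: inj_onI)
  show "removed_row nu ` corner_removals nu \<subseteq> {..<length nu}"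
    using removed_row_less [OF p] by auto
qed simp

text \<open>Thus every row j either satisfies the hypothesis of \<open>del_noncorner\<close> or ends
  in a removable corner; the inductions over rows below rest on this dichotomy.\<close>

lemma corner_removals_exists:
  assumes p: "partition_of n nu" and lt: "row_len nu (Suc j) < row_len nu j"
  obtains nu1 where "nu1 \<in> corner_removals nu" "removed_row nu nu1 = j"
proof -
  let ?a = "(row_len nu)(j := row_len nu j - 1)"
  have "?a i' \<le> ?a i" if "i \<le> i'" for i i'
  proof -
    have "row_len nu i' \<le> row_len nu i" by (rule partition_row_len_antimono [OF p that])
    moreover have "row_len nu i' < row_len nu j" if "i = j" "i' \<noteq> j"
      using partition_row_len_antimono [OF p, of "Suc j" i'] \<open>i \<le> i'\<close> lt that by simp
    ultimately show ?thesis by (cases "i = j"; cases "i' = j") auto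
  qed
  moreover have "?a (length nu) = 0" by (simp add: row_len_def)
  ultimately obtain nu1 where nu1: "partition_of (sum_list nu1) nu1" "row_len nu1 = ?a"
    using antimono_partition by metis
  let ?c = "row_len nu j - 1"
  have co: "corner nu (j, ?c)" using lt by (auto simp: corner_def cells_row_len)
  have ce: "cells nu1 = cells nu - {(j, ?c)}"
    using lt by (auto simp: cells_row_len nu1(2) split: if_splits)
  then have "cells nu - cells nu1 = {(j, ?c)}" using co by (auto simp: corner_def)
  then have "removed_row nu nu1 = j" by (simp add: removed_row_def)
  moreover have "nu1 \<in> corner_removals nu"
    unfolding corner_removals_def using nu1(1) co ce by blast
  ultimately show ?thesis using that by blast
qed

section \<open>Lifting from smaller Specht modules, and the converse inclusion\<close>

lemma subspace_specht: "cvec.subspace (specht_space nu)"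
  by (simp add: specht_space_def)

text \<open>The functions that can be lifted form a subspace, so polytabloids suffice, and these are
  lifted by writing n into the removed corner. Vanishing in the rows below allows a lift to be
  subtracted without disturbing rows that are already cleared.\<close>

lemma specht_lift:
  assumes p: "partition_of n nu" and nu1: "nu1 \<in> corner_removals nu" and g: "g \<in> specht_space nu1"
  shows "\<exists>f\<in>specht_space nu. del n (removed_row nu nu1) f = g \<and>
    (\<forall>r>removed_row nu nu1. del n r f = 0)"
proof -
  let ?j = "removed_row nu nu1"
  let ?Q = "\<lambda>g. \<exists>f\<in>specht_space nu. del n ?j f = g \<and> (\<forall>r>?j. del n r f = 0)"
  have "cvec.subspace {g. ?Q g}"
  proof (rule cvec.subspaceI)
    have "del n ?j 0 = 0 \<and> (\<forall>r>?j. del n r 0 = 0)" by simp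
    then show "0 \<in> {g. ?Q g}" using cvec.subspace_0 [OF subspace_specht] by blast
  next
    fix x y assume "x \<in> {g. ?Q g}" "y \<in> {g. ?Q g}"
    then obtain f h where f: "f \<in> specht_space nu" "del n ?j f = x" "\<forall>r>?j. del n r f = 0"
      and h: "h \<in> specht_space nu" "del n ?j h = y" "\<forall>r>?j. del n r h = 0" by blast
    have "f + h \<in> specht_space nu" by (rule cvec.subspace_add [OF subspace_specht f(1) h(1)])
    then show "x + y \<in> {g. ?Q g}" using f h by (auto simp: del_add intro!: bexI [of _ "f + h"])
  next
    fix a x assume "x \<in> {g. ?Q g}"
    then obtain f where f: "f \<in> specht_space nu" "del n ?j f = x" "\<forall>r>?j. del n r f = 0" by blast
    have "scaleC a f \<in> specht_space nu" by (rule cvec.subspace_scale [OF subspace_specht f(1)])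
    then show "scaleC a x \<in> {g. ?Q g}"
      using f by (auto simp: del_scaleC cvec.scale_zero_right intro!: bexI [of _ "scaleC a f"])
  qed
  moreover have "polytabloid nu1 ` {t. tableau nu1 t} \<subseteq> {g. ?Q g}"
  proof (clarify)
    fix s assume s: "tableau nu1 s"
    from corner_removalsE [OF p nu1] obtain c where j: "(?j, c) \<in> cells nu" "(Suc ?j, c) \<notin> cells nu"
      "cells nu1 = cells nu - {(?j, c)}" "partition_of (n - 1) nu1" "1 \<le> n" by blast
    note d = del_polytabloid [OF p j(4,5,1,2,3) s]
    have "polytabloid nu (s((?j, c) := n)) \<in> specht_space nu"
      unfolding specht_space_def using d(1) by (intro cvec.span_base) blast
    then show "?Q (polytabloid nu1 s)" using d(2,3) by blast
  qed
  ultimately have "cvec.span (polytabloid nu1 ` {t. tableau nu1 t}) \<subseteq> {g. ?Q g}"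
    by (intro cvec.span_minimal)
  then show ?thesis using g unfolding specht_space_def [of nu1] by blast
qed

lemma specht_subset_hw:
  assumes "partition_of n nu"
  shows "specht_space nu \<subseteq> hw n (row_len nu)"
  unfolding specht_space_def
  by (rule cvec.span_minimal) (use polytabloid_hw [OF assms] subspace_hw in auto)

text \<open>By induction, the part of \<open>f\<close> with \<open>n\<close> in the lowest occurring row lies in a smaller Specht
  module; a lift of it can be subtracted from \<open>f\<close>, which shortens the range of rows.\<close>

lemma hw_subset_specht:
  assumes "partition_of n nu"
  shows "hw n (row_len nu) \<subseteq> specht_space nu"
  using assms
proof (induction n arbitrary: nu)
  case 0
  then have nu: "nu = []" by (cases nu) (auto simp: partition_of_def)
  show ?case
  proof
    fix f assume f: "f \<in> hw 0 (row_len nu)"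
    let ?E = "\<lambda>_. {} :: nat set"
    \<comment> \<open>The empty shape has a single tabloid, and its polytabloid is the indicator
      function of that tabloid. Every map is a tableau of empty shape, so \<open>undefined\<close>
      serves as one.\<close>
    have stab: "col_stab [] undefined = {id}" by (auto simp: col_stab_def cells_def)
    have "polytabloid [] undefined T = (if T = ?E then 1 else 0)" for T
      unfolding polytabloid_apply stab by (auto simp: tabloid_act_def tabloid_of_def cells_def)
    moreover have "f T = 0" if "T \<noteq> ?E" for T
      using hw_supp [OF f, of T] that by (force simp: rows_def)
    ultimately have "f T = scaleC (f ?E) (polytabloid [] undefined) T" for T
      by (cases "T = ?E") (simp_all add: scaleC_fun_def scaleC_complex_def)
    then have "f = scaleC (f ?E) (polytabloid [] undefined)" by blast
    moreover have "tableau [] undefined" by (simp add: tableau_def cells_def bij_betw_def)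
    then have "polytabloid [] undefined \<in> specht_space []"
      unfolding specht_space_def by (intro cvec.span_base) blast
    ultimately show "f \<in> specht_space nu"
      unfolding nu by (metis cvec.subspace_scale subspace_specht)
  qed
next
  case (Suc m)
  let ?n = "Suc m"
  note p = Suc.prems
  \<comment> \<open>The inner induction runs over a bound j on the rows in which n may occur;
    \<open>length nu\<close> is such a bound for every f.\<close>
  have "f \<in> specht_space nu" if "f \<in> hw ?n (row_len nu)" "\<And>r. r \<ge> j \<Longrightarrow> del ?n r f = 0" for f j
    using that
  proof (induction j arbitrary: f)
    case 0
    then have "f = 0" by (intro hw_del_eq_0 [of f ?n]) auto
    then show ?case using cvec.subspace_0 [OF subspace_specht] by blast
  next
    case (Suc j)
    have top: "del ?n r f = 0" if "r > j" for r
      by (rule Suc.prems(2)) (use that in simp)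
    show ?case
    proof (cases "row_len nu j \<le> row_len nu (Suc j)")
      case True
      then have "del ?n j f = 0"
        using del_noncorner [OF Suc.prems(1) _ top] by simp
      then show ?thesis using top by (intro Suc.IH [OF Suc.prems(1)]) (metis le_neq_implies_less)
    next
      case False
      then obtain nu1 where nu1: "nu1 \<in> corner_removals nu" "removed_row nu nu1 = j"
        using corner_removals_exists [OF p, of j] by auto
      have nu1': "partition_of m nu1" "row_len nu1 = (row_len nu)(j := row_len nu j - 1)"
        by (rule corner_removalsE [OF p nu1(1)], simp add: nu1(2))+
      have "del ?n j f \<in> hw m (row_len nu1)"
        using del_hw [OF Suc.prems(1) _ top] by (simp add: nu1'(2))
      then have "del ?n j f \<in> specht_space nu1"
        using nu1'(1) \<open>\<And>nu. partition_of m nu \<Longrightarrow> hw m (row_len nu) \<subseteq> specht_space nu\<close> by blast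
      from specht_lift [OF p nu1(1) this] obtain g where g: "g \<in> specht_space nu"
        "del ?n j g = del ?n j f" "\<And>r. r > j \<Longrightarrow> del ?n r g = 0" unfolding nu1(2) by blast
      have "f - g \<in> specht_space nu"
      proof (rule Suc.IH)
        show "f - g \<in> hw ?n (row_len nu)"
          using specht_subset_hw [OF p] g(1)
          by (intro cvec.subspace_diff [OF subspace_hw Suc.prems(1)]) auto
        show "del ?n r (f - g) = 0" if "r \<ge> j" for r
          using that g(2,3) top by (cases "r = j") (auto simp: del_diff)
      qed
      from cvec.subspace_add [OF subspace_specht this g(1)] show ?thesis by simp
    qed
  qed
  moreover have "del ?n r f = 0" if "f \<in> hw ?n (row_len nu)" "r \<ge> length nu" for f r
    by (rule del_empty_row [OF that(1)]) (use that(2) in \<open>simp add: row_len_def\<close>)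
  ultimately show ?case by blast
qed

section \<open>The branching rule for Specht modules\<close>

interpretation cvec_pair: vector_space_pair
  "scaleC :: complex \<Rightarrow> 'a \<Rightarrow> 'a::complex_vector"
  "scaleC :: complex \<Rightarrow> 'b \<Rightarrow> 'b::complex_vector"
  by unfold_locales

abbreviation clinear :: "('a::complex_vector \<Rightarrow> 'b::complex_vector) \<Rightarrow> bool" where
  "clinear \<equiv> Vector_Spaces.linear scaleC scaleC"

lemma clinearI:
  assumes "\<And>x y. f (x + y) = f x + f y" "\<And>c x. f (scaleC c x) = scaleC c (f x)"
  shows "clinear f"
  unfolding Vector_Spaces.linear_iff using assms by (auto intro: cvec.vector_space_axioms)

lemma clinear_hom: "clinear f \<Longrightarrow> module_hom scaleC scaleC f"
  by (simp add: module_hom_iff_linear)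

lemmas clinear_add = module_hom.add [OF clinear_hom]
  and clinear_scale = module_hom.scale [OF clinear_hom]
  and clinear_0 = module_hom.zero [OF clinear_hom]
  and clinear_diff = module_hom.diff [OF clinear_hom]
  and clinear_sum = module_hom.sum [OF clinear_hom]

lemma clinear_compose: "clinear f \<Longrightarrow> clinear g \<Longrightarrow> clinear (\<lambda>x. g (f x))"
  by (rule clinearI) (simp_all add: clinear_add clinear_scale)

lemma clinear_specht_act: "clinear (specht_act g)"
  by (rule clinearI) (simp_all add: specht_act_def fun_eq_iff scaleC_fun_def)

lemma clinear_del: "clinear (del n r)"
  by (rule clinearI) (rule del_add del_scaleC)+

lemma specht_act_comp:
  assumes "bij g" "bij h"
  shows "specht_act (g \<circ> h) f = specht_act g (specht_act h f)"
  by (simp add: specht_act_def o_inv_distrib [OF assms] tabloid_act_comp)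

lemma tabloid_act_id [simp]: "tabloid_act id T = T"
  by (simp add: tabloid_act_def)

lemma specht_act_id [simp]: "specht_act id f = f"
  by (simp add: specht_act_def)

text \<open>Maschke: an arbitrary projection onto \<open>U\<close> is averaged over the group.\<close>

lemma equivariant_projection:
  fixes U :: "(tabloid \<Rightarrow> complex) set"
  assumes U: "cvec.subspace U"
    and inv: "\<And>g f. g permutes {1..m} \<Longrightarrow> f \<in> U \<Longrightarrow> specht_act g f \<in> U"
  obtains P where "clinear P" "\<And>f. P f \<in> U" "\<And>f. f \<in> U \<Longrightarrow> P f = f"
    "\<And>g f. g permutes {1..m} \<Longrightarrow> P (specht_act g f) = specht_act g (P f)"
proof -
  have "clinear (id :: (tabloid \<Rightarrow> complex) \<Rightarrow> _)" by (rule clinearI) simp_all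
  \<comment> \<open>A left inverse of the identity on \<open>U\<close> with values in
    \<open>U\<close> is a linear projection onto \<open>U\<close>, defined on all functions.\<close>
  from cvec_pair.linear_exists_left_inverse_on [OF this U]
  obtain Q :: "(tabloid \<Rightarrow> complex) \<Rightarrow> tabloid \<Rightarrow> complex"
    where Q: "range Q \<subseteq> U" "clinear Q" "\<And>f. f \<in> U \<Longrightarrow> Q f = f" by auto
  define G where "G = {g. g permutes {1..m}}"
  have finG: "finite G" and G0: "card G \<noteq> 0"
    unfolding G_def by (simp_all add: finite_permutations card_permutations)
  define A where "A h f = specht_act (inv' h) (Q (specht_act h f))" for h f
  define P where "P f = scaleC (1 / of_nat (card G)) (\<Sum>h\<in>G. A h f)" for f
  have G_bij: "bij h" if "h \<in> G" for h using that permutes_bij by (auto simp: G_def)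
  have A_lin: "clinear (A h)" for h
    unfolding A_def
    by (rule clinear_compose [OF clinear_compose [OF clinear_specht_act Q(2)] clinear_specht_act])
  have "clinear P"
    unfolding P_def
    by (rule clinearI)
      (simp_all add: clinear_add [OF A_lin] clinear_scale [OF A_lin] sum.distrib
        cvec.scale_right_distrib mult.commute flip: cvec.scale_sum_right)
  moreover have "P f \<in> U" for f
    unfolding P_def A_def
    by (intro cvec.subspace_scale [OF U] cvec.subspace_sum [OF U] inv)
      (use Q(1) in \<open>auto simp: G_def permutes_inv\<close>)
  moreover have "P f = f" if f: "f \<in> U" for f
  proof -
    have "A h f = f" if h: "h \<in> G" for h
    proof -
      have hp: "h permutes {1..m}" using h by (simp add: G_def)
      have "A h f = specht_act (inv' h) (specht_act h f)" by (simp add: A_def Q(3) inv [OF hp f])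
      also have "\<dots> = f"
        using specht_act_comp [of "inv' h" h f] permutes_bij [OF permutes_inv [OF hp]] permutes_bij [OF hp]
          permutes_inv_o(2) [OF hp] by simp
      finally show ?thesis .
    qed
    then have "(\<Sum>h\<in>G. A h f) = (\<Sum>h\<in>G. f)" by (intro sum.cong refl)
    also have "\<dots> = scaleC (of_nat (card G)) f" by (rule cvec.sum_constant_scale)
    finally have "P f = scaleC (1 / of_nat (card G)) (scaleC (of_nat (card G)) f)"
      unfolding P_def by (rule arg_cong)
    then show ?thesis using G0 by (simp add: cvec.scale_scale cvec.scale_one)
  qed
  moreover have "P (specht_act g f) = specht_act g (P f)" if g: "g permutes {1..m}" for g f
  proof -
    note gi = permutes_inv [OF g]
    have "(\<Sum>h\<in>G. A h (specht_act g f)) = (\<Sum>h\<in>G. specht_act g (A h f))"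
    proof (rule sum.reindex_bij_witness [of _ "\<lambda>h. h \<circ> inv' g" "\<lambda>h. h \<circ> g"])
      fix h assume h: "h \<in> G"
      then have hp: "h permutes {1..m}" by (simp add: G_def)
      show "h \<circ> g \<circ> inv' g = h" "h \<circ> inv' g \<circ> g = h"
        using permutes_inv_o [OF g] by (simp_all add: comp_assoc)
      show "h \<circ> g \<in> G" "h \<circ> inv' g \<in> G"
        using permutes_compose [OF g hp] permutes_compose [OF gi hp] by (simp_all add: G_def)
      have e1: "specht_act (h \<circ> g) f = specht_act h (specht_act g f)"
        by (rule specht_act_comp) (simp_all add: permutes_bij [OF g] permutes_bij [OF hp])
      have "g \<circ> inv' (h \<circ> g) = inv' h"
        using permutes_inv_o(1) [OF g]
        by (simp add: o_inv_distrib [OF permutes_bij [OF hp] permutes_bij [OF g]] flip: comp_assoc)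
      then have e2: "specht_act g (specht_act (inv' (h \<circ> g)) k) = specht_act (inv' h) k" for k
        using specht_act_comp [of g "inv' (h \<circ> g)" k] permutes_bij [OF g]
          permutes_bij [OF permutes_inv [OF permutes_compose [OF g hp]]] by simp
      show "specht_act g (A (h \<circ> g) f) = A h (specht_act g f)"
        unfolding A_def e1 e2 ..
    qed
    then show ?thesis
      unfolding P_def
      by (simp add: clinear_scale [OF clinear_specht_act] clinear_sum [OF clinear_specht_act])
  qed
  ultimately show ?thesis using that by blast
qed

text \<open>Permuting entries commutes with changing rows, as the two actions in Schur-Weyl duality
  do: the raising sum of the permuted vector at \<open>w\<close> is that of f at
  \<open>w \<circ> g\<close>.\<close>

lemma hw_specht_act:
  assumes g: "g permutes {1..n}" and f: "f \<in> hw n a"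
  shows "specht_act g f \<in> hw n a"
  unfolding hw_def
proof (intro CollectI conjI allI impI)
  note gi = permutes_inv [OF g]
  {
    fix T assume "specht_act g f T \<noteq> 0"
    then have "f (tabloid_act (inv' g) T) \<noteq> 0" by (simp add: specht_act_def)
    from hw_supp [OF f this] obtain w where w: "tabloid_act (inv' g) T = rows n w"
      and c: "\<And>i. card (tabloid_act (inv' g) T i) = a i" by metis
    have "T = tabloid_act g (tabloid_act (inv' g) T)"
      using permutes_inv_o(1) [OF g] by (simp flip: tabloid_act_comp)
    then show "\<exists>w. T = rows n w" unfolding w tabloid_act_rows [OF g] by blast
    fix i
    show "card (T i) = a i"
      using c [of i] card_image [OF permutes_inj_on [OF gi], of "T i"] by (simp add: tabloid_act_def)
  }
  fix i w
  have r: "rows n (w \<circ> g) i = inv' g ` rows n w i"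
    using fun_cong [OF tabloid_act_rows [OF gi, of w], of i]
    by (simp add: tabloid_act_def permutes_inv_inv [OF g])
  have "(\<Sum>x\<in>rows n w i. specht_act g f (rows n (w(x := Suc i)))) =
      (\<Sum>y\<in>rows n (w \<circ> g) i. f (rows n ((w \<circ> g)(y := Suc i))))"
    unfolding r
  proof (rule sum.reindex_cong [where l = g], goal_cases)
    case 1
    show ?case by (rule permutes_inj_on [OF g])
  next
    case 2
    show ?case by (simp add: image_comp permutes_inv_o(1) [OF g])
  next
    case (3 y)
    have "(w(g y := Suc i)) \<circ> g = (w \<circ> g)(y := Suc i)"
      using permutes_inj [OF g] by (auto simp: fun_eq_iff inj_eq)
    then show ?case
      by (simp add: specht_act_def tabloid_act_rows [OF gi] permutes_inv_inv [OF g])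
  qed
  then show "(\<Sum>x\<in>rows n w i. specht_act g f (rows n (w(x := Suc i)))) = 0"
    using hw_raise [OF f, of "w \<circ> g" i] by simp
qed

lemma specht_eq_hw: "partition_of n nu \<Longrightarrow> specht_space nu = hw n (row_len nu)"
  using specht_subset_hw hw_subset_specht by blast

lemma specht_space_act:
  assumes "partition_of n nu" "g permutes {1..n}" "f \<in> specht_space nu"
  shows "specht_act g f \<in> specht_space nu"
  using assms hw_specht_act by (simp add: specht_eq_hw)

text \<open>The subspaces \<open>U j\<close> of functions supported on tabloids with \<open>n\<close> in one of the rows
  \<open>0..j\<close> filter the Specht module; a corner in row \<open>j\<close> contributes the quotient
  \<open>U j / U (j - 1)\<close>.\<close>

theorem specht_branching:
  assumes p: "partition_of n nu" and n: "1 \<le> n"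
  obtains \<phi> :: "nat list \<Rightarrow> (tabloid \<Rightarrow> complex) \<Rightarrow> tabloid \<Rightarrow> complex" where
    "\<And>nu1. clinear (\<phi> nu1)"
    "\<And>nu1 f. nu1 \<in> corner_removals nu \<Longrightarrow> \<phi> nu1 f \<in> specht_space nu1"
    "\<And>nu1 g f. g permutes {1..n - 1} \<Longrightarrow> \<phi> nu1 (specht_act g f) = specht_act g (\<phi> nu1 f)"
    "\<And>f. f \<in> specht_space nu \<Longrightarrow> (\<And>nu1. nu1 \<in> corner_removals nu \<Longrightarrow> \<phi> nu1 f = 0) \<Longrightarrow> f = 0"
    "\<And>nu1 g. nu1 \<in> corner_removals nu \<Longrightarrow> g \<in> specht_space nu1 \<Longrightarrow>
      \<exists>f\<in>specht_space nu. \<phi> nu1 f = g \<and> (\<forall>nu2\<in>corner_removals nu - {nu1}. \<phi> nu2 f = 0)"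
proof -
  define U where "U j = {f \<in> specht_space nu. \<forall>r>j. del n r f = 0}" for j
  let ?CR = "corner_removals nu"
  let ?rr = "removed_row nu"
  have subU: "cvec.subspace (U j)" for j
    unfolding U_def using subspace_specht [of nu]
    by (auto simp: cvec.subspace_def del_add del_scaleC)
  have "\<forall>j. \<exists>P. clinear P \<and> (\<forall>f. P f \<in> U j) \<and> (\<forall>f\<in>U j. P f = f) \<and>
    (\<forall>g f. g permutes {1..n - 1} \<longrightarrow> P (specht_act g f) = specht_act g (P f))"
  proof
    fix j
    have "specht_act g f \<in> U j" if g: "g permutes {1..n - 1}" and f: "f \<in> U j" for g f
    proof -
      have "g permutes {1..n}" by (rule permutes_subset [OF g]) auto
      then show ?thesis
        using f specht_space_act [OF p] by (simp add: U_def del_specht_act [OF g n] clinear_0 [OF clinear_specht_act])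
    qed
    then obtain P where "clinear P" "\<And>f. P f \<in> U j" "\<And>f. f \<in> U j \<Longrightarrow> P f = f"
      "\<And>g f. g permutes {1..n - 1} \<Longrightarrow> P (specht_act g f) = specht_act g (P f)"
      by (rule equivariant_projection [OF subU]) blast+
    then show "\<exists>P. clinear P \<and> (\<forall>f. P f \<in> U j) \<and>
      (\<forall>f\<in>U j. P f = f) \<and> (\<forall>g f. g permutes {1..n - 1} \<longrightarrow> P (specht_act g f) = specht_act g (P f))"
      by blast
  qed
  from choice [OF this] obtain P where P: "\<And>j. clinear (P j)" "\<And>j f. P j f \<in> U j" "\<And>j f. f \<in> U j \<Longrightarrow> P j f = f"
    "\<And>j g f. g permutes {1..n - 1} \<Longrightarrow> P j (specht_act g f) = specht_act g (P j f)"
    by blast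
  \<comment> \<open>Deletion from row j maps into the smaller Specht module only on
    \<open>U j\<close>; composing with the projection extends it to the whole module and keeps
    equivariance.\<close>
  define \<phi> where "\<phi> nu1 f = del n (?rr nu1) (P (?rr nu1) f)" for nu1 f
  have lin: "clinear (\<phi> nu1)" for nu1
    unfolding \<phi>_def by (rule clinear_compose [OF P(1) clinear_del])
  have into: "\<phi> nu1 f \<in> specht_space nu1" if nu1: "nu1 \<in> ?CR" for nu1 f
  proof -
    have "P (?rr nu1) f \<in> U (?rr nu1)" by (rule P(2))
    then have "\<phi> nu1 f \<in> hw (n - 1) ((row_len nu)(?rr nu1 := row_len nu (?rr nu1) - 1))"
      unfolding \<phi>_def U_def specht_eq_hw [OF p] by (intro del_hw n) auto
    moreover have "partition_of (n - 1) nu1"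
      "row_len nu1 = (row_len nu)(?rr nu1 := row_len nu (?rr nu1) - 1)"
      by (rule corner_removalsE [OF p nu1], simp)+
    ultimately show ?thesis using specht_eq_hw by simp
  qed
  have U_phi: "\<phi> nu1 f = del n (?rr nu1) f" if "f \<in> U (?rr nu1)" for nu1 f
    using P(3) [OF that] by (simp add: \<phi>_def)
  have U_mono: "f \<in> U j \<Longrightarrow> j \<le> j' \<Longrightarrow> f \<in> U j'" for f j j' by (auto simp: U_def)
  have U_len: "f \<in> U (length nu)" if "f \<in> specht_space nu" for f
  proof -
    have "del n r f = 0" if "r > length nu" for r
      by (rule del_empty_row [of f n "row_len nu"])
        (use \<open>f \<in> specht_space nu\<close> that in \<open>simp_all add: specht_eq_hw [OF p] row_len_def\<close>)
    then show ?thesis using that by (simp add: U_def)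
  qed
  \<comment> \<open>Triangularity: once the rows from \<open>Suc j\<close> on are cleared, f lies in
    \<open>U j\<close>, where \<phi> for a corner in row j is plain deletion. Vanishing of all
    \<phi> therefore clears the rows from the bottom upwards.\<close>
  have inj: "f = 0" if "f \<in> specht_space nu" "\<And>r. r \<ge> j \<Longrightarrow> del n r f = 0"
    "\<And>nu1. nu1 \<in> ?CR \<Longrightarrow> \<phi> nu1 f = 0" for f j
    using that(2)
  proof (induction j)
    case 0
    show ?case
      by (rule hw_del_eq_0 [OF _ n]) (use 0 that(1) in \<open>auto simp: specht_eq_hw [OF p]\<close>)
  next
    case (Suc j)
    have top: "del n r f = 0" if "r > j" for r
      by (rule Suc.prems) (use that in simp)
    have "del n j f = 0"
    proof (cases "row_len nu j \<le> row_len nu (Suc j)")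
      case True
      then show ?thesis
        using del_noncorner [OF _ n top] that(1) by (simp add: specht_eq_hw [OF p])
    next
      case False
      then obtain nu1 where nu1: "nu1 \<in> ?CR" "?rr nu1 = j"
        using corner_removals_exists [OF p, of j] by auto
      have "f \<in> U j" using that(1) top by (simp add: U_def)
      then show ?thesis using U_phi [of f nu1] that(3) [OF nu1(1)] nu1(2) by simp
    qed
    then show ?case using top by (intro Suc.IH) (metis le_neq_implies_less)
  qed
  \<comment> \<open>Back substitution. A lift for the corner in row j has uncontrolled components at
    the corners above it, so the induction must admit arbitrary targets \<open>G\<close> and correct
    them by \<open>\<phi> nu1 h\<close>.\<close>
  have surj: "\<exists>f\<in>specht_space nu. (\<forall>r\<ge>j. del n r f = 0) \<and> (\<forall>nu1\<in>?CR. \<phi> nu1 f = G nu1)"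
    if "\<And>nu1. nu1 \<in> ?CR \<Longrightarrow> G nu1 \<in> specht_space nu1"
      "\<And>nu1. nu1 \<in> ?CR \<Longrightarrow> ?rr nu1 \<ge> j \<Longrightarrow> G nu1 = 0" for G j
    using that
  proof (induction j arbitrary: G)
    case 0
    have "\<phi> nu1 0 = G nu1" if "nu1 \<in> ?CR" for nu1
      unfolding clinear_0 [OF lin] by (rule 0(2) [OF that, symmetric]) simp
    then show ?case
      using cvec.subspace_0 [OF subspace_specht, of nu] del_zero [of n] by blast
  next
    case (Suc j)
    show ?case
    proof (cases "\<exists>nu1\<in>?CR. ?rr nu1 = j")
      case False
      have "\<exists>f\<in>specht_space nu. (\<forall>r\<ge>j. del n r f = 0) \<and> (\<forall>nu1\<in>?CR. \<phi> nu1 f = G nu1)"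
      proof (rule Suc.IH [OF Suc.prems(1)])
        fix nu1 assume "nu1 \<in> ?CR" "j \<le> ?rr nu1"
        moreover from this False have "Suc j \<le> ?rr nu1" by (auto simp: Suc_le_eq le_less)
        ultimately show "G nu1 = 0" by (intro Suc.prems(2))
      qed
      then show ?thesis by (meson Suc_leD)
    next
      case True
      then obtain nu0 where nu0: "nu0 \<in> ?CR" "?rr nu0 = j" by blast
      from specht_lift [OF p nu0(1) Suc.prems(1) [OF nu0(1)]] nu0(2)
      obtain h where h: "h \<in> specht_space nu" "del n j h = G nu0" "\<And>r. r > j \<Longrightarrow> del n r h = 0"
        by blast
      have hU: "h \<in> U j" using h by (simp add: U_def)
      let ?G = "\<lambda>nu1. G nu1 - \<phi> nu1 h"
      have "\<exists>f\<in>specht_space nu. (\<forall>r\<ge>j. del n r f = 0) \<and> (\<forall>nu1\<in>?CR. \<phi> nu1 f = ?G nu1)"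
      proof (rule Suc.IH)
        fix nu1 assume nu1: "nu1 \<in> ?CR"
        show "?G nu1 \<in> specht_space nu1"
          by (rule cvec.subspace_diff [OF subspace_specht Suc.prems(1) [OF nu1] into [OF nu1]])
        assume r: "j \<le> ?rr nu1"
        then have e: "\<phi> nu1 h = del n (?rr nu1) h" by (intro U_phi U_mono [OF hU])
        show "?G nu1 = 0"
        proof (cases "?rr nu1 = j")
          case True
          then have "nu1 = nu0" using removed_row_inj [OF p nu1 nu0(1)] nu0(2) by simp
          then show ?thesis using e h(2) nu0(2) by simp
        next
          case False
          then have "?rr nu1 > j" using r by simp
          then have "G nu1 = 0" "\<phi> nu1 h = 0"
            unfolding e by (auto intro: Suc.prems(2) [OF nu1] h(3))
          then show ?thesis by simp
        qed
      qed
      then obtain f where f: "f \<in> specht_space nu" "\<forall>r\<ge>j. del n r f = 0"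
        "\<forall>nu1\<in>?CR. \<phi> nu1 f = ?G nu1" by blast
      show ?thesis
      proof (intro bexI [of _ "f + h"] conjI allI impI ballI)
        show "f + h \<in> specht_space nu" by (rule cvec.subspace_add [OF subspace_specht f(1) h(1)])
        show "del n r (f + h) = 0" if "Suc j \<le> r" for r using f(2) h(3) that by (simp add: del_add)
        show "\<phi> nu1 (f + h) = G nu1" if "nu1 \<in> ?CR" for nu1
          using f(3) that by (simp add: clinear_add [OF lin])
      qed
    qed
  qed
  show ?thesis
  proof (rule that [of \<phi>])
    show "clinear (\<phi> nu1)" for nu1 by (rule lin)
    show "\<phi> nu1 f \<in> specht_space nu1" if "nu1 \<in> ?CR" for nu1 f by (rule into [OF that])
    show "\<phi> nu1 (specht_act g f) = specht_act g (\<phi> nu1 f)" if "g permutes {1..n - 1}" for nu1 g f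
      using del_specht_act [OF that n] by (simp add: \<phi>_def P(4) [OF that])
    show "f = 0" if "f \<in> specht_space nu" "\<And>nu1. nu1 \<in> ?CR \<Longrightarrow> \<phi> nu1 f = 0" for f
      using inj [OF that(1), of "Suc (length nu)"] U_len [OF that(1)] that(2)
      by (auto simp: U_def Suc_le_eq)
    fix nu1 g assume nu1: "nu1 \<in> ?CR" and g: "g \<in> specht_space nu1"
    let ?G = "\<lambda>nu2. if nu2 = nu1 then g else 0"
    have "\<exists>f\<in>specht_space nu. (\<forall>r\<ge>length nu. del n r f = 0) \<and> (\<forall>nu2\<in>?CR. \<phi> nu2 f = ?G nu2)"
      by (rule surj) (use g removed_row_less [OF p] cvec.subspace_0 [OF subspace_specht] in \<open>auto simp: not_le [symmetric]\<close>)
    then show "\<exists>f\<in>specht_space nu. \<phi> nu1 f = g \<and> (\<forall>nu2\<in>?CR - {nu1}. \<phi> nu2 f = 0)"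
      using nu1 by (auto intro!: bexI)
  qed
qed

section \<open>Tensor products\<close>

lemma subspace_W_space: "cvec.subspace (W_space al be)"
  by (simp add: W_space_def)

lemma W_space_tensor:
  "f \<in> specht_space al \<Longrightarrow> h \<in> specht_space be \<Longrightarrow> tensor f h \<in> W_space al be"
  unfolding W_space_def by (rule cvec.span_base) blast

lemma W_space_induct_subset:
  assumes "cvec.subspace U"
    and "\<And>f h. f \<in> specht_space al \<Longrightarrow> h \<in> specht_space be \<Longrightarrow> tensor f h \<in> U"
  shows "W_space al be \<subseteq> U"
  unfolding W_space_def by (rule cvec.span_minimal) (use assms in auto)

lemma subspace_clinear_vimage:
  assumes "clinear f" "cvec.subspace U"
  shows "cvec.subspace {x. f x \<in> U}"
  using module_hom.subspace_vimage [OF clinear_hom [OF assms(1)] assms(2)] by (simp add: vimage_def)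

lemma clinear_slice: "clinear (\<lambda>F S. F (S, T))"
  by (rule clinearI) (simp_all add: scaleC_fun_def fun_eq_iff)

text \<open>A slice of \<open>tensor f h\<close> is a multiple of f. Slices allow vanishing and
  supports to be tested factor by factor, without bases.\<close>

lemma W_space_slice:
  assumes "F \<in> W_space al be"
  shows "(\<lambda>S. F (S, T)) \<in> specht_space al"
proof -
  have "W_space al be \<subseteq> {F. (\<lambda>S. F (S, T)) \<in> specht_space al}"
  proof (rule W_space_induct_subset)
    show "cvec.subspace {F. (\<lambda>S. F (S, T)) \<in> specht_space al}"
      by (rule subspace_clinear_vimage [OF clinear_slice subspace_specht])
    fix f h assume f: "f \<in> specht_space al"
    have "(\<lambda>S. tensor f h (S, T)) = scaleC (h T) f"
      by (simp add: tensor_def fun_eq_iff scaleC_fun_def scaleC_complex_def)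
    then show "tensor f h \<in> {F. (\<lambda>S. F (S, T)) \<in> specht_space al}"
      using cvec.subspace_scale [OF subspace_specht f] by simp
  qed
  then show ?thesis using assms by blast
qed

text \<open>Transfers statements about the first tensor factor to the second.\<close>

lemma W_space_swap:
  assumes "F \<in> W_space al be"
  shows "F \<circ> prod.swap \<in> W_space be al"
proof -
  have "W_space al be \<subseteq> {F. F \<circ> prod.swap \<in> W_space be al}"
  proof (rule W_space_induct_subset)
    have "clinear (\<lambda>F. F \<circ> prod.swap)" by (rule clinearI) (simp_all add: scaleC_fun_def fun_eq_iff)
    then show "cvec.subspace {F. F \<circ> prod.swap \<in> W_space be al}"
      by (rule subspace_clinear_vimage [OF _ subspace_W_space])
    fix f h assume "f \<in> specht_space al" "h \<in> specht_space be"
    moreover have "tensor f h \<circ> prod.swap = tensor h f"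
      by (auto simp: tensor_def fun_eq_iff)
    ultimately show "tensor f h \<in> {F. F \<circ> prod.swap \<in> W_space be al}"
      by (simp add: W_space_tensor)
  qed
  then show ?thesis using assms by blast
qed

text \<open>Equivariance will compare \<open>W_act\<close> for two different block sizes; writing
  both through their component permutations makes them comparable.\<close>

definition pair_act ::
    "(nat \<Rightarrow> nat) \<Rightarrow> (nat \<Rightarrow> nat) \<Rightarrow> (tabloid \<times> tabloid \<Rightarrow> complex) \<Rightarrow> tabloid \<times> tabloid \<Rightarrow> complex" where
  "pair_act g h F = (\<lambda>(S, T). F (tabloid_act (inv' g) S, tabloid_act (inv' h) T))"

lemma W_act_pair_act: "W_act l k = pair_act (comp1 l k) (comp2 l k)"
  by (simp add: W_act_def pair_act_def fun_eq_iff)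

text \<open>This is \<phi> tensored with the identity (\<open>left_map_tensor\<close>). Applying
  \<phi> to slices defines it on all functions, so independence of a choice of decomposition into
  products is not an issue.\<close>

definition left_map ::
    "((tabloid \<Rightarrow> complex) \<Rightarrow> tabloid \<Rightarrow> complex) \<Rightarrow> (tabloid \<times> tabloid \<Rightarrow> complex) \<Rightarrow>
      tabloid \<times> tabloid \<Rightarrow> complex" where
  "left_map \<phi> F = (\<lambda>(S, T). \<phi> (\<lambda>S'. F (S', T)) S)"

lemma left_map_tensor:
  assumes "clinear \<phi>"
  shows "left_map \<phi> (tensor f h) = tensor (\<phi> f) h"
proof -
  have "(\<lambda>S'. tensor f h (S', T)) = scaleC (h T) f" for T
    by (simp add: tensor_def fun_eq_iff scaleC_fun_def scaleC_complex_def)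
  then show ?thesis
    by (simp add: left_map_def fun_eq_iff clinear_scale [OF assms])
      (simp add: tensor_def scaleC_fun_def scaleC_complex_def)
qed

lemma clinear_left_map:
  assumes "clinear \<phi>"
  shows "clinear (left_map \<phi>)"
proof (rule clinearI)
  fix F G :: "tabloid \<times> tabloid \<Rightarrow> complex"
  have "(\<lambda>S'. (F + G) (S', T)) = (\<lambda>S'. F (S', T)) + (\<lambda>S'. G (S', T))" for T
    by (simp add: fun_eq_iff)
  then have "left_map \<phi> (F + G) (S, T) = (left_map \<phi> F + left_map \<phi> G) (S, T)" for S T
    unfolding left_map_def prod.case by (simp only: clinear_add [OF assms] plus_fun_apply prod.case)
  then show "left_map \<phi> (F + G) = left_map \<phi> F + left_map \<phi> G" by auto
next
  fix c and F :: "tabloid \<times> tabloid \<Rightarrow> complex"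
  have "(\<lambda>S'. scaleC c F (S', T)) = scaleC c (\<lambda>S'. F (S', T))" for T
    by (simp add: fun_eq_iff scaleC_fun_def)
  then show "left_map \<phi> (scaleC c F) = scaleC c (left_map \<phi> F)"
    by (simp add: left_map_def fun_eq_iff clinear_scale [OF assms]) (simp add: scaleC_fun_def)
qed

lemma left_map_pair_act:
  assumes "\<And>f. \<phi> (specht_act g f) = specht_act g (\<phi> f)"
  shows "left_map \<phi> (pair_act g h F) = pair_act g h (left_map \<phi> F)"
proof -
  have "(\<lambda>S'. pair_act g h F (S', T)) = specht_act g (\<lambda>S'. F (S', tabloid_act (inv' h) T))" for T
    by (simp add: pair_act_def specht_act_def)
  then show ?thesis
    by (simp add: left_map_def fun_eq_iff assms) (simp add: pair_act_def specht_act_def)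
qed

text \<open>For finite \<open>I\<close> this says that \<open>x \<mapsto> (\<phi> i x)\<^sub>i\<close> is an isomorphism of \<open>V\<close> onto the direct sum of
  the \<open>W i\<close>.\<close>

definition joint_iso ::
    "'i set \<Rightarrow> 'v::complex_vector set \<Rightarrow> ('i \<Rightarrow> 'w::complex_vector set) \<Rightarrow> ('i \<Rightarrow> 'v \<Rightarrow> 'w) \<Rightarrow> bool" where
  "joint_iso I V W \<phi> \<longleftrightarrow>
     (\<forall>i. clinear (\<phi> i)) \<and> (\<forall>i\<in>I. \<phi> i ` V \<subseteq> W i) \<and>
     (\<forall>x\<in>V. (\<forall>i\<in>I. \<phi> i x = 0) \<longrightarrow> x = 0) \<and>
     (\<forall>i\<in>I. \<forall>w\<in>W i. \<exists>x\<in>V. \<phi> i x = w \<and> (\<forall>j\<in>I - {i}. \<phi> j x = 0))"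

text \<open>Injectivity is inherited slice by slice. For surjectivity the attained w form a
  subspace, which contains the product tensors because preimages can be taken in the first
  factor.\<close>

lemma joint_iso_left:
  assumes "joint_iso I (specht_space al) (\<lambda>i. specht_space (ai i)) \<phi>"
  shows "joint_iso I (W_space al be) (\<lambda>i. W_space (ai i) be) (\<lambda>i. left_map (\<phi> i))"
proof -
  have lin: "clinear (\<phi> i)" for i using assms by (simp add: joint_iso_def)
  have into: "\<phi> i f \<in> specht_space (ai i)" if "i \<in> I" "f \<in> specht_space al" for i f
    using assms that by (auto simp: joint_iso_def)
  have "left_map (\<phi> i) F \<in> W_space (ai i) be" if i: "i \<in> I" and F: "F \<in> W_space al be" for i F
  proof -
    have "W_space al be \<subseteq> {F. left_map (\<phi> i) F \<in> W_space (ai i) be}"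
      by (rule W_space_induct_subset
          [OF subspace_clinear_vimage [OF clinear_left_map [OF lin] subspace_W_space]])
        (use into i in \<open>simp add: left_map_tensor [OF lin] W_space_tensor\<close>)
    then show ?thesis using F by blast
  qed
  moreover have "F = 0" if F: "F \<in> W_space al be" and z: "\<forall>i\<in>I. left_map (\<phi> i) F = 0" for F
  proof -
    have "(\<lambda>S. F (S, T)) = 0" for T
    proof -
      have "\<phi> i (\<lambda>S. F (S, T)) = 0" if "i \<in> I" for i
      proof
        fix S
        show "\<phi> i (\<lambda>S. F (S, T)) S = 0 S"
          using fun_cong [OF bspec [OF z that], of "(S, T)"] by (simp add: left_map_def)
      qed
      then show ?thesis using W_space_slice [OF F, of T] assms unfolding joint_iso_def by blast
    qed
    then show "F = 0" by (auto simp: fun_eq_iff)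
  qed
  moreover have "\<exists>F\<in>W_space al be. left_map (\<phi> i) F = w \<and> (\<forall>j\<in>I - {i}. left_map (\<phi> j) F = 0)"
    if i: "i \<in> I" and w: "w \<in> W_space (ai i) be" for i w
  proof -
    let ?U = "{w. \<exists>F\<in>W_space al be. left_map (\<phi> i) F = w \<and> (\<forall>j\<in>I - {i}. left_map (\<phi> j) F = 0)}"
    note l = clinear_left_map [OF lin]
    have "W_space (ai i) be \<subseteq> ?U"
    proof (rule W_space_induct_subset)
      let ?N = "{F \<in> W_space al be. \<forall>j\<in>I - {i}. left_map (\<phi> j) F = 0}"
      have "cvec.subspace ?N"
        using subspace_W_space [of al be]
        by (auto simp: cvec.subspace_def clinear_add [OF l] clinear_scale [OF l] clinear_0 [OF l]
            simp del: zero_fun_apply)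
      then have "cvec.subspace (left_map (\<phi> i) ` ?N)"
        by (rule module_hom.subspace_image [OF clinear_hom [OF l]])
      moreover have "left_map (\<phi> i) ` ?N = ?U" by blast
      ultimately show "cvec.subspace ?U" by simp
      fix g h assume g: "g \<in> specht_space (ai i)" and h: "h \<in> specht_space be"
      then obtain f where f: "f \<in> specht_space al" "\<phi> i f = g" "\<forall>j\<in>I - {i}. \<phi> j f = 0"
        using assms i unfolding joint_iso_def by blast
      have "tensor 0 h = 0" by (simp add: tensor_def fun_eq_iff)
      then show "tensor g h \<in> ?U"
        using W_space_tensor [OF f(1) h] f(2,3)
        by (intro CollectI bexI [of _ "tensor f h"] conjI ballI) (simp_all only: left_map_tensor [OF lin])
    qed
    then show ?thesis using w by blast
  qed
  ultimately show ?thesis using clinear_left_map [OF lin] unfolding joint_iso_def by blast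
qed

lemma joint_iso_right:
  assumes "joint_iso I (specht_space be) (\<lambda>i. specht_space (bi i)) \<phi>"
  shows "joint_iso I (W_space al be) (\<lambda>i. W_space al (bi i))
    (\<lambda>i F. left_map (\<phi> i) (F \<circ> prod.swap) \<circ> prod.swap)"
proof -
  note L = joint_iso_left [OF assms, of al]
  have L3: "\<forall>x\<in>W_space be al. (\<forall>i\<in>I. left_map (\<phi> i) x = 0) \<longrightarrow> x = 0"
    using L unfolding joint_iso_def by (elim conjE)
  have L4: "\<forall>i\<in>I. \<forall>w\<in>W_space (bi i) al. \<exists>x\<in>W_space be al. left_map (\<phi> i) x = w \<and>
      (\<forall>j\<in>I - {i}. left_map (\<phi> j) x = 0)"
    using L unfolding joint_iso_def by (elim conjE)
  have sw: "clinear (\<lambda>F :: tabloid \<times> tabloid \<Rightarrow> complex. F \<circ> prod.swap)"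
    by (rule clinearI) (simp_all add: scaleC_fun_def fun_eq_iff)
  have inv: "F \<circ> prod.swap \<circ> prod.swap = F" for F :: "tabloid \<times> tabloid \<Rightarrow> complex"
    by (simp add: fun_eq_iff)
  have iff: "F \<circ> prod.swap \<in> W_space a b \<longleftrightarrow> F \<in> W_space b a" for F a b
    using W_space_swap [of F b a] W_space_swap [of "F \<circ> prod.swap" a b] by (auto simp: inv)
  have z: "F \<circ> prod.swap = 0 \<longleftrightarrow> F = 0" for F :: "tabloid \<times> tabloid \<Rightarrow> complex"
    by (auto simp: fun_eq_iff)
  have "\<exists>x\<in>W_space al be. left_map (\<phi> i) (x \<circ> prod.swap) \<circ> prod.swap = w \<and>
      (\<forall>j\<in>I - {i}. left_map (\<phi> j) (x \<circ> prod.swap) \<circ> prod.swap = 0)"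
    if "i \<in> I" "w \<in> W_space al (bi i)" for i w
  proof -
    have "w \<circ> prod.swap \<in> W_space (bi i) al" using that(2) by (simp add: iff)
    from bspec [OF bspec [OF L4 that(1)] this]
    obtain x where x: "x \<in> W_space be al" "left_map (\<phi> i) x = w \<circ> prod.swap"
      "\<forall>j\<in>I - {i}. left_map (\<phi> j) x = 0"
      by (elim bexE conjE)
    have 1: "x \<circ> prod.swap \<in> W_space al be" using x(1) by (simp only: iff)
    have 2: "left_map (\<phi> i) (x \<circ> prod.swap \<circ> prod.swap) \<circ> prod.swap = w"
      unfolding inv x(2) ..
    have 3: "\<forall>j\<in>I - {i}. left_map (\<phi> j) (x \<circ> prod.swap \<circ> prod.swap) \<circ> prod.swap = 0"
      unfolding inv z by (rule x(3))
    show ?thesis by (rule bexI [of _ "x \<circ> prod.swap"]) (rule conjI [OF 2 3], rule 1)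
  qed
  moreover have "clinear (\<lambda>F. left_map (\<phi> i) (F \<circ> prod.swap) \<circ> prod.swap)" for i
    by (intro clinear_compose [OF clinear_compose [OF sw] sw])
      (use L in \<open>simp add: joint_iso_def\<close>)
  moreover have "left_map (\<phi> i) (F \<circ> prod.swap) \<circ> prod.swap \<in> W_space al (bi i)"
    if "i \<in> I" "F \<in> W_space al be" for i F
    unfolding iff
  proof -
    have "F \<circ> prod.swap \<in> W_space be al" using that(2) by (simp only: iff)
    moreover have "left_map (\<phi> i) ` W_space be al \<subseteq> W_space (bi i) al"
      using L that(1) unfolding joint_iso_def by blast
    ultimately show "left_map (\<phi> i) (F \<circ> prod.swap) \<in> W_space (bi i) al" by blast
  qed
  moreover have "F = 0" if "F \<in> W_space al be"
    "\<forall>i\<in>I. left_map (\<phi> i) (F \<circ> prod.swap) \<circ> prod.swap = 0" for F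
  proof -
    have "F \<circ> prod.swap \<in> W_space be al" using that(1) by (simp only: iff)
    moreover have "\<forall>i\<in>I. left_map (\<phi> i) (F \<circ> prod.swap) = 0" using that(2) unfolding z .
    ultimately have "F \<circ> prod.swap = 0" by (intro mp [OF bspec [OF L3]])
    then show ?thesis unfolding z .
  qed
  ultimately show ?thesis unfolding joint_iso_def by (intro conjI allI ballI impI subsetI) auto
qed

lemma right_map_pair_act:
  assumes "\<And>f. \<phi> (specht_act h f) = specht_act h (\<phi> f)"
  shows "left_map \<phi> (pair_act g h F \<circ> prod.swap) \<circ> prod.swap =
    pair_act g h (left_map \<phi> (F \<circ> prod.swap) \<circ> prod.swap)"
proof -
  have "pair_act g h F \<circ> prod.swap = pair_act h g (F \<circ> prod.swap)" for F
    by (auto simp: pair_act_def fun_eq_iff)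
  moreover have "pair_act h g F \<circ> prod.swap = pair_act g h (F \<circ> prod.swap)" for F
    by (auto simp: pair_act_def fun_eq_iff)
  ultimately show ?thesis by (simp add: left_map_pair_act [where \<phi> = \<phi>, OF assms])
qed

section \<open>The action of K on W\<close>

lemma comp1_permutes:
  assumes "\<kappa> \<in> young_K m l"
  shows "comp1 l \<kappa> permutes {1..l}"
  using comp_bij(1) [OF assms] by (auto simp: permutes_def comp1_def bij_iff)

lemma comp2_permutes:
  assumes \<kappa>: "\<kappa> \<in> young_K m l"
  shows "comp2 l \<kappa> permutes {1..m - l}"
proof -
  have "comp2 l \<kappa> j = j" if "j \<notin> {1..m - l}" for j
  proof (cases "1 \<le> j")
    case True
    then have "\<kappa> (j + l) = j + l"
      by (intro permutes_not_in [OF young_K_permutes [OF \<kappa>]]) (use that in auto)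
    then show ?thesis by (simp add: comp2_def)
  qed (simp add: comp2_def)
  then show ?thesis using comp_bij(2) [OF \<kappa>] unfolding permutes_def bij_iff by blast
qed

lemma clinear_W_act: "clinear (W_act l \<kappa>)"
  by (rule clinearI) (auto simp: W_act_def fun_eq_iff scaleC_fun_def)

lemma W_space_act:
  assumes "partition_of l al" "partition_of (m - l) be" and \<kappa>: "\<kappa> \<in> young_K m l"
    and w: "w \<in> W_space al be"
  shows "W_act l \<kappa> w \<in> W_space al be"
proof -
  have "W_space al be \<subseteq> {w. W_act l \<kappa> w \<in> W_space al be}"
    by (rule W_space_induct_subset [OF subspace_clinear_vimage [OF clinear_W_act subspace_W_space]])
      (simp add: W_act_tensor W_space_tensor specht_space_act [OF assms(1) comp1_permutes [OF \<kappa>]]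
        specht_space_act [OF assms(2) comp2_permutes [OF \<kappa>]])
  then show ?thesis using w by blast
qed

section \<open>Restriction of the induced partial representation\<close>

text \<open>A coset t K is thus the same as the set t[k], and coset computations become computations
  with images.\<close>

lemma young_K_coset:
  assumes t: "t permutes {1..n}" and s: "s permutes {1..n}"
  shows "inv' t \<circ> s \<in> young_K n k \<longleftrightarrow> s ` {1..k} = t ` {1..k}"
proof -
  have "(inv' t \<circ> s) permutes {1..n}" by (rule permutes_compose [OF s permutes_inv [OF t]])
  moreover have "inv' t ` (s ` {1..k}) = {1..k} \<longleftrightarrow> s ` {1..k} = t ` {1..k}"
  proof
    assume "inv' t ` (s ` {1..k}) = {1..k}"
    then have "t ` (inv' t ` (s ` {1..k})) = t ` {1..k}" by simp
    then show "s ` {1..k} = t ` {1..k}"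
      by (simp only: image_comp comp_assoc [symmetric] permutes_inv_o(1) [OF t] id_comp)
  next
    assume "s ` {1..k} = t ` {1..k}"
    then show "inv' t ` (s ` {1..k}) = {1..k}"
      by (simp only: image_comp permutes_inv_o(2) [OF t] image_id id_apply)
  qed
  ultimately show ?thesis by (simp add: young_K_def sym_group_carrier image_comp)
qed

lemma scaleC_fun_apply: "scaleC a f x = scaleC a (f x)"
  by (simp add: scaleC_fun_def)

lemma clinear_ind_tensor: "clinear (ind_tensor m l s)"
  by (rule clinearI; rule ext)
    (simp_all add: ind_tensor_def clinear_add [OF clinear_W_act] clinear_scale [OF clinear_W_act]
      scaleC_fun_apply cvec.scale_zero_right)

lemma W_act_inv:
  assumes "\<kappa> \<in> young_K m l"
  shows "W_act l (inv' \<kappa>) (W_act l \<kappa> w) = w"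
proof -
  have "W_act l (inv' \<kappa> \<circ> \<kappa>) w = w"
    using permutes_inv_o(2) [OF young_K_permutes [OF assms]]
    by (simp add: W_act_def comp1_id comp2_id)
  then show ?thesis by (simp add: W_act_comp [OF young_K_inv [OF assms] assms])
qed

lemma fst_V_pair:
  assumes "sum_list al = l" "sum_list al + sum_list be = m"
  shows "fst (V_pair al be) =
    cvec.span {ind_tensor m l s w | s w. s permutes {1..m} \<and> 1 \<in> s ` {1..l} \<and> w \<in> W_space al be}"
  using assms by (simp add: V_pair_def Let_def sym_group_carrier)

lemma snd_V_pair:
  assumes "sum_list al = l"
  shows "snd (V_pair al be) g F = (\<lambda>t. if 1 \<in> t ` {1..l} then F (inv' g \<circ> t) else 0)"
  using assms by (simp add: V_pair_def Let_def)

text \<open>All three properties pass to linear combinations and hold for the generators. The last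
  one recovers F on a whole coset from its value at one representative.\<close>

lemma V_pair_props:
  assumes l: "partition_of l al" and be: "partition_of (m - l) be" and lm: "l \<le> m"
    and F: "F \<in> fst (V_pair al be)"
  shows "F t \<in> W_space al be"
    and "F t \<noteq> 0 \<Longrightarrow> t permutes {1..m} \<and> 1 \<in> t ` {1..l}"
    and "\<kappa> \<in> young_K m l \<Longrightarrow> t permutes {1..m} \<Longrightarrow> W_act l \<kappa> (F (t \<circ> \<kappa>)) = F t"
proof -
  let ?U = "{F. (\<forall>t. F t \<in> W_space al be) \<and> (\<forall>t. F t \<noteq> 0 \<longrightarrow> t permutes {1..m} \<and> 1 \<in> t ` {1..l}) \<and>
    (\<forall>\<kappa> t. \<kappa> \<in> young_K m l \<longrightarrow> t permutes {1..m} \<longrightarrow> W_act l \<kappa> (F (t \<circ> \<kappa>)) = F t)}"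
  have "fst (V_pair al be) \<subseteq> ?U"
  proof (subst fst_V_pair [of _ l _ m])
    show "sum_list al = l" "sum_list al + sum_list be = m"
      using l be lm by (simp_all add: partition_of_def)
    show "cvec.span {ind_tensor m l s w |s w. s permutes {1..m} \<and> 1 \<in> s ` {1..l} \<and> w \<in> W_space al be} \<subseteq> ?U"
    proof (rule cvec.span_minimal)
      show "cvec.subspace ?U"
        using subspace_W_space [of al be]
        by (auto simp: cvec.subspace_def clinear_add [OF clinear_W_act] clinear_scale [OF clinear_W_act]
            clinear_0 [OF clinear_W_act] scaleC_fun_def [of _ "F :: (nat \<Rightarrow> nat) \<Rightarrow> _" for F])
          (metis add_0 cvec.scale_zero_right)+
    next
      show "{ind_tensor m l s w |s w. s permutes {1..m} \<and> 1 \<in> s ` {1..l} \<and> w \<in> W_space al be} \<subseteq> ?U"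
      proof
        fix G assume "G \<in> {ind_tensor m l s w |s w. s permutes {1..m} \<and> 1 \<in> s ` {1..l} \<and> w \<in> W_space al be}"
        then obtain s w where G: "G = ind_tensor m l s w"
          and s: "s permutes {1..m}" and s1: "1 \<in> s ` {1..l}" and w: "w \<in> W_space al be" by blast
        have "ind_tensor m l s w t \<in> W_space al be" for t
          using W_space_act [OF l be _ w] cvec.subspace_0 [OF subspace_W_space]
          by (simp add: ind_tensor_def)
        moreover have "t permutes {1..m} \<and> 1 \<in> t ` {1..l}" if "ind_tensor m l s w t \<noteq> 0" for t
        proof -
          have t: "t permutes {1..m}" and k: "inv' t \<circ> s \<in> young_K m l"
            using that unfolding ind_tensor_def sym_group_carrier by (auto split: if_splits)
          from k have "s ` {1..l} = t ` {1..l}" by (simp only: young_K_coset [OF t s])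
          then show ?thesis using t s1 by simp
        qed
        moreover have "W_act l \<kappa> (ind_tensor m l s w (t \<circ> \<kappa>)) = ind_tensor m l s w t"
          if \<kappa>: "\<kappa> \<in> young_K m l" and t: "t permutes {1..m}" for \<kappa> t
        proof -
          have kp: "\<kappa> permutes {1..m}" by (rule young_K_permutes [OF \<kappa>])
          have tk: "t \<circ> \<kappa> permutes {1..m}" by (rule permutes_compose [OF kp t])
          have "\<kappa> ` {1..l} = {1..l}" using \<kappa> by (simp add: young_K_def)
          then have "(t \<circ> \<kappa>) ` {1..l} = t ` {1..l}" by (simp only: image_comp [symmetric])
          then have iff: "inv' (t \<circ> \<kappa>) \<circ> s \<in> young_K m l \<longleftrightarrow> inv' t \<circ> s \<in> young_K m l"
            unfolding young_K_coset [OF tk s] young_K_coset [OF t s] by simp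
          have e: "inv' (t \<circ> \<kappa>) \<circ> s = inv' \<kappa> \<circ> (inv' t \<circ> s)"
            by (simp add: o_inv_distrib [OF permutes_bij [OF t] permutes_bij [OF kp]] comp_assoc)
          show ?thesis
          proof (cases "inv' t \<circ> s \<in> young_K m l")
            case True
            have "W_act l \<kappa> (W_act l (inv' \<kappa> \<circ> (inv' t \<circ> s)) w) = W_act l (\<kappa> \<circ> (inv' \<kappa> \<circ> (inv' t \<circ> s))) w"
              by (rule W_act_comp [symmetric, OF \<kappa>]) (rule young_K_comp [OF young_K_inv [OF \<kappa>] True])
            also have "\<kappa> \<circ> (inv' \<kappa> \<circ> (inv' t \<circ> s)) = inv' t \<circ> s"
              using permutes_inv_o(1) [OF kp] by (simp flip: comp_assoc)
            finally show ?thesis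
              unfolding ind_tensor_def sym_group_carrier using True t tk iff unfolding e
              by (simp only: simp_thms if_True)
          next
            case False
            then have "ind_tensor m l s w (t \<circ> \<kappa>) = 0" "ind_tensor m l s w t = 0"
              using iff by (simp_all only: ind_tensor_def simp_thms if_False)
            then show ?thesis by (simp only: clinear_0 [OF clinear_W_act])
          qed
        qed
        ultimately show "G \<in> ?U" unfolding G by blast
      qed
    qed
  qed
  then have FU: "F \<in> ?U" using F by blast
  show "F t \<in> W_space al be" using FU by blast
  show "t permutes {1..m} \<and> 1 \<in> t ` {1..l}" if "F t \<noteq> 0" using FU that by blast
  show "W_act l \<kappa> (F (t \<circ> \<kappa>)) = F t" if "\<kappa> \<in> young_K m l" "t permutes {1..m}"
    using FU that by blast
qed

text \<open>The cosets \<open>s K\<close> of \<open>S\<^sub>n\<close> fall into two orbits under the stabilizer of \<open>n\<close>, according to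
  whether \<open>n \<in> s [k]\<close>; \<open>c\<close> is a representative of one of them, and \<open>W\<close> decomposes under
  the stabilizer of the coset of \<open>c\<close>.\<close>

locale branch_component =
  fixes n k l' :: nat and c :: "nat \<Rightarrow> nat" and al be :: "nat list"
    and I :: "nat list set" and ai bi :: "nat list \<Rightarrow> nat list"
    and \<Phi> :: "nat list \<Rightarrow> (tabloid \<times> tabloid \<Rightarrow> complex) \<Rightarrow> tabloid \<times> tabloid \<Rightarrow> complex"
  assumes n: "1 < n" and kn: "k \<le> n"
    and c: "c permutes {1..n}" and ck: "c ` {1..k} - {n} = {1..l'}"
    and al: "partition_of k al" and be: "partition_of (n - k) be"
    and ai: "i \<in> I \<Longrightarrow> sum_list (ai i) = l'"
    and bi: "i \<in> I \<Longrightarrow> sum_list (ai i) + sum_list (bi i) = n - 1"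
    and iso: "joint_iso I (W_space al be) (\<lambda>i. W_space (ai i) (bi i)) \<Phi>"
    and eqv: "\<rho> \<in> young_K (n - 1) l' \<Longrightarrow> \<Phi> i (W_act k (inv' c \<circ> \<rho> \<circ> c) w) = W_act l' \<rho> (\<Phi> i w)"
begin

definition same_orbit :: "(nat \<Rightarrow> nat) \<Rightarrow> bool" where
  "same_orbit s \<longleftrightarrow> (n \<in> s ` {1..k} \<longleftrightarrow> n \<in> c ` {1..k})"

text \<open>The cosets in the orbit of c K are those of \<open>t \<circ> c\<close> with t fixing n.
  Pulling F back along t \<mapsto> t c gives a function on S_{n-1}, induced from the stabilizer of c
  K, and \<Phi> projects its values to the summand i: one term of Mackey's formula.\<close>

definition component ::
    "nat list \<Rightarrow> ((nat \<Rightarrow> nat) \<Rightarrow> tabloid \<times> tabloid \<Rightarrow> complex) \<Rightarrow>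
      (nat \<Rightarrow> nat) \<Rightarrow> tabloid \<times> tabloid \<Rightarrow> complex" where
  "component i F = (\<lambda>t. if t permutes {1..n - 1} then \<Phi> i (F (t \<circ> c)) else 0)"

lemma \<Phi>_linear: "clinear (\<Phi> i)"
  using iso by (simp add: joint_iso_def)

lemma component_linear: "clinear (component i)"
  by (rule clinearI; rule ext)
    (simp_all add: component_def clinear_add [OF \<Phi>_linear] clinear_scale [OF \<Phi>_linear]
      scaleC_fun_apply cvec.scale_zero_right)

lemma small_permutes:
  assumes "t permutes {1..n - 1}"
  shows "t permutes {1..n}" "t n = n"
proof -
  show "t permutes {1..n}" by (rule permutes_subset [OF assms]) auto
  show "t n = n" by (rule permutes_not_in [OF assms]) (use n in auto)
qed

lemma small_image_mem:
  assumes "t permutes {1..n - 1}"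
  shows "n \<in> t ` A \<longleftrightarrow> n \<in> A"
  using inj_image_mem_iff [OF permutes_inj [OF assms], of n A] small_permutes(2) [OF assms] by simp

lemma same_orbit_comp:
  assumes "t permutes {1..n - 1}"
  shows "same_orbit (t \<circ> c)"
  unfolding same_orbit_def image_comp [symmetric] small_image_mem [OF assms] ..

lemma small_image_c:
  assumes "t permutes {1..n - 1}"
  shows "(t \<circ> c) ` {1..k} - {n} = t ` {1..l'}"
proof -
  have "t ` {1..l'} = t ` (c ` {1..k} - {n})" by (simp only: ck)
  also have "\<dots> = t ` c ` {1..k} - {t n}"
    using permutes_inj [OF assms] by (simp add: image_set_diff)
  finally show ?thesis by (simp add: small_permutes(2) [OF assms] image_comp)
qed

lemma image_eq_iff:
  assumes t: "t permutes {1..n - 1}" and s: "s permutes {1..n - 1}"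
  shows "(s \<circ> c) ` {1..k} = (t \<circ> c) ` {1..k} \<longleftrightarrow> s ` {1..l'} = t ` {1..l'}"
proof -
  have "n \<in> (s \<circ> c) ` {1..k} \<longleftrightarrow> n \<in> (t \<circ> c) ` {1..k}"
    using same_orbit_comp [OF t] same_orbit_comp [OF s] by (simp add: same_orbit_def)
  note o = this
  have d: "A = B \<longleftrightarrow> A - {n} = B - {n}" if "n \<in> A \<longleftrightarrow> n \<in> B" for A B
    using that by (metis Diff_insert_absorb insert_Diff Diff_empty Diff_insert0)
  show ?thesis unfolding d [OF o] by (simp only: small_image_c [OF t] small_image_c [OF s])
qed

text \<open>The two sets differ at most by n, and 1 < n. Hence the truncations in the partial
  actions for n and for n - 1 agree.\<close>

lemma one_mem_iff:
  assumes "t permutes {1..n - 1}"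
  shows "1 \<in> (t \<circ> c) ` {1..k} \<longleftrightarrow> 1 \<in> t ` {1..l'}"
  unfolding small_image_c [OF assms, symmetric] using n by simp

text \<open>The element of S_{n-1} comparing t with \<tau> appears in S_n conjugated by c;
  \<open>eqv\<close> translates its action on W into the action on the summand.\<close>

lemma component_generator:
  assumes \<tau>: "\<tau> permutes {1..n - 1}"
  shows "component i (ind_tensor n k (\<tau> \<circ> c) w) = ind_tensor (n - 1) l' \<tau> (\<Phi> i w)"
proof
  fix t
  show "component i (ind_tensor n k (\<tau> \<circ> c) w) t = ind_tensor (n - 1) l' \<tau> (\<Phi> i w) t"
  proof (cases "t permutes {1..n - 1}")
    case False
    then show ?thesis by (simp add: component_def ind_tensor_def sym_group_carrier)
  next
    case t: True
    note tc = permutes_compose [OF c small_permutes(1) [OF t]]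
    note \<tau>c = permutes_compose [OF c small_permutes(1) [OF \<tau>]]
    let ?\<rho> = "inv' t \<circ> \<tau>"
    have iff: "inv' (t \<circ> c) \<circ> (\<tau> \<circ> c) \<in> young_K n k \<longleftrightarrow> ?\<rho> \<in> young_K (n - 1) l'"
      unfolding young_K_coset [OF tc \<tau>c] young_K_coset [OF t \<tau>] by (rule image_eq_iff [OF t \<tau>])
    have e: "inv' (t \<circ> c) \<circ> (\<tau> \<circ> c) = inv' c \<circ> ?\<rho> \<circ> c"
      by (simp add: o_inv_distrib [OF permutes_bij [OF t] permutes_bij [OF c]] comp_assoc)
    show ?thesis
    proof (cases "?\<rho> \<in> young_K (n - 1) l'")
      case True
      then have "\<Phi> i (W_act k (inv' c \<circ> ?\<rho> \<circ> c) w) = W_act l' ?\<rho> (\<Phi> i w)" by (rule eqv)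
      then show ?thesis
        using t tc True iff unfolding component_def ind_tensor_def sym_group_carrier e by simp
    next
      case False
      then show ?thesis
        using t iff unfolding component_def ind_tensor_def by (simp add: clinear_0 [OF \<Phi>_linear])
    qed
  qed
qed

lemma component_other_orbit:
  assumes "\<And>t. same_orbit t \<Longrightarrow> F t = 0"
  shows "component i F = 0"
proof
  fix t
  show "component i F t = 0 t"
  proof (cases "t permutes {1..n - 1}")
    case True
    then have "F (t \<circ> c) = 0" by (intro assms same_orbit_comp)
    then show ?thesis using True by (simp add: component_def clinear_0 [OF \<Phi>_linear] del: zero_fun_apply) simp
  qed (simp add: component_def)
qed

lemma ind_tensor_orbit:
  assumes s: "s permutes {1..n}" and "ind_tensor n k s w t \<noteq> 0"
  shows "same_orbit t \<longleftrightarrow> same_orbit s"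
proof -
  have t: "t permutes {1..n}" and k: "inv' t \<circ> s \<in> young_K n k"
    using assms(2) unfolding ind_tensor_def sym_group_carrier by (auto split: if_splits)
  from k have "s ` {1..k} = t ` {1..k}" by (simp only: young_K_coset [OF t s])
  then show ?thesis by (simp add: same_orbit_def)
qed

text \<open>The factor \<kappa> transposes the positions that c and s send to n. It preserves [k]
  exactly because n lies in both of c[k], s[k] or in neither, and \<tau> then fixes n.\<close>

lemma same_orbit_factor:
  assumes s: "s permutes {1..n}" and o: "same_orbit s"
  obtains \<tau> \<kappa> where "\<tau> permutes {1..n - 1}" "\<kappa> \<in> young_K n k" "s = \<tau> \<circ> c \<circ> \<kappa>"
proof -
  define p where "p = inv' c n"
  define q where "q = inv' s n"
  have cp: "c p = n" and sq: "s q = n"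
    unfolding p_def q_def using permutes_inverses(1) [OF c] permutes_inverses(1) [OF s] by simp_all
  have pq: "p \<in> {1..n}" "q \<in> {1..n}"
    using permutes_in_image [OF permutes_inv [OF c], of n] permutes_in_image [OF permutes_inv [OF s], of n] n
    unfolding p_def q_def by auto
  have "p \<in> {1..k} \<longleftrightarrow> q \<in> {1..k}"
    using o inj_image_mem_iff [OF permutes_inj [OF c], of p "{1..k}"]
      inj_image_mem_iff [OF permutes_inj [OF s], of q "{1..k}"]
    unfolding same_orbit_def cp sq by simp
  then have "transpose p q ` {1..k} = {1..k}" by (rule transpose_image_eq)
  then have \<kappa>: "transpose p q \<in> young_K n k"
    using pq by (simp add: young_K_def sym_group_carrier permutes_swap_id)
  define \<tau> where "\<tau> = s \<circ> transpose p q \<circ> inv' c"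
  have \<tau>1: "\<tau> permutes {1..n}"
    unfolding \<tau>_def
    by (intro permutes_compose [OF permutes_inv [OF c]] permutes_compose [OF young_K_permutes [OF \<kappa>] s])
  have \<tau>n: "\<tau> n = n" by (simp add: \<tau>_def sq flip: p_def)
  have "{1..n} - {1..n - 1} = {n}" using n by auto
  then have "\<tau> permutes {1..n - 1}" by (intro permutes_superset [OF \<tau>1]) (simp add: \<tau>n)
  moreover have "\<tau> \<circ> c \<circ> transpose p q = s"
    using permutes_inv_o(2) [OF c] by (simp add: \<tau>_def comp_assoc)
  ultimately show ?thesis using that \<kappa> by metis
qed

lemma component_into:
  assumes F: "F \<in> fst (V_pair al be)" and i: "i \<in> I"
  shows "component i F \<in> fst (V_pair (ai i) (bi i))"
proof -
  let ?Vi = "fst (V_pair (ai i) (bi i))"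
  have sums: "sum_list al = k" "sum_list al + sum_list be = n"
    using al be kn by (simp_all add: partition_of_def)
  have Vi: "?Vi = cvec.span {ind_tensor (n - 1) l' s w |s w. s permutes {1..n - 1} \<and>
      1 \<in> s ` {1..l'} \<and> w \<in> W_space (ai i) (bi i)}"
    by (rule fst_V_pair [OF ai [OF i] bi [OF i]])
  have subVi: "cvec.subspace ?Vi" unfolding Vi by (rule cvec.subspace_span)
  have "fst (V_pair al be) \<subseteq> {F. component i F \<in> ?Vi}"
    unfolding fst_V_pair [OF sums]
  proof (rule cvec.span_minimal [OF _ subspace_clinear_vimage [OF component_linear subVi]], rule subsetI)
    fix G assume "G \<in> {ind_tensor n k s w |s w. s permutes {1..n} \<and> 1 \<in> s ` {1..k} \<and> w \<in> W_space al be}"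
    then obtain s w where G: "G = ind_tensor n k s w"
      and s: "s permutes {1..n}" and s1: "1 \<in> s ` {1..k}" and w: "w \<in> W_space al be" by blast
    have "component i (ind_tensor n k s w) \<in> ?Vi"
    proof (cases "same_orbit s")
      case True
      then obtain \<tau> \<kappa> where \<tau>: "\<tau> permutes {1..n - 1}" and \<kappa>: "\<kappa> \<in> young_K n k" and e: "s = \<tau> \<circ> c \<circ> \<kappa>"
        by (rule same_orbit_factor [OF s])
      have "\<tau> \<circ> c permutes {1..n}" by (rule permutes_compose [OF c small_permutes(1) [OF \<tau>]])
      then have "ind_tensor n k s w = ind_tensor n k (\<tau> \<circ> c) (W_act k \<kappa> w)"
        unfolding e by (intro ind_tensor_balanced \<kappa>) (simp add: sym_group_carrier)
      then have c1: "component i (ind_tensor n k s w) = ind_tensor (n - 1) l' \<tau> (\<Phi> i (W_act k \<kappa> w))"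
        using component_generator [OF \<tau>] by simp
      have "\<kappa> ` {1..k} = {1..k}" using \<kappa> by (simp add: young_K_def)
      then have "s ` {1..k} = (\<tau> \<circ> c) ` {1..k}" by (simp only: e image_comp [symmetric])
      then have "1 \<in> \<tau> ` {1..l'}" using s1 one_mem_iff [OF \<tau>] by simp
      moreover have "\<Phi> i (W_act k \<kappa> w) \<in> W_space (ai i) (bi i)"
        using W_space_act [OF al be \<kappa> w] iso i unfolding joint_iso_def by blast
      ultimately show ?thesis unfolding c1 Vi using \<tau> by (intro cvec.span_base) blast
    next
      case False
      then have "component i (ind_tensor n k s w) = 0"
        using ind_tensor_orbit [OF s] by (intro component_other_orbit) blast
      then show ?thesis using cvec.subspace_0 [OF subVi] by simp
    qed
    then show "G \<in> {F. component i F \<in> ?Vi}" unfolding G mem_Collect_eq .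
  qed
  then show ?thesis using F by blast
qed

text \<open>Joint injectivity of \<Phi> gives vanishing at the representatives \<tau> c;
  equivariance under K carries it to the rest of the orbit.\<close>

lemma component_inj:
  assumes F: "F \<in> fst (V_pair al be)" and z: "\<And>i. i \<in> I \<Longrightarrow> component i F = 0"
    and t: "same_orbit t"
  shows "F t = 0"
proof (cases "t permutes {1..n}")
  case False
  then show ?thesis using V_pair_props(2) [OF al be kn F] by blast
next
  case True
  then obtain \<tau> \<kappa> where \<tau>: "\<tau> permutes {1..n - 1}" and \<kappa>: "\<kappa> \<in> young_K n k" and e: "t = \<tau> \<circ> c \<circ> \<kappa>"
    by (rule same_orbit_factor [OF _ t])
  have \<tau>c: "\<tau> \<circ> c permutes {1..n}" by (rule permutes_compose [OF c small_permutes(1) [OF \<tau>]])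
  have "\<Phi> i (F (\<tau> \<circ> c)) = 0" if "i \<in> I" for i
    using fun_cong [OF z [OF that], of \<tau>] \<tau> by (simp add: component_def)
  moreover have "F (\<tau> \<circ> c) \<in> W_space al be" by (rule V_pair_props(1) [OF al be kn F])
  ultimately have "F (\<tau> \<circ> c) = 0" using iso unfolding joint_iso_def by blast
  then have "W_act k \<kappa> (F t) = 0" using V_pair_props(3) [OF al be kn F \<kappa> \<tau>c] by (simp add: e)
  then have "W_act k (inv' \<kappa>) 0 = F t" using W_act_inv [OF \<kappa>, of "F t"] by simp
  then show ?thesis by (simp add: clinear_0 [OF clinear_W_act])
qed

text \<open>The lift is supported on this orbit and has no other components, so that lifts for all
  summands of both orbits can simply be added.\<close>

lemma component_surj:
  assumes i: "i \<in> I" and v: "v \<in> fst (V_pair (ai i) (bi i))"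
  shows "\<exists>F\<in>fst (V_pair al be). component i F = v \<and> (\<forall>j\<in>I - {i}. component j F = 0) \<and>
    (\<forall>t. \<not> same_orbit t \<longrightarrow> F t = 0)"
proof -
  have sums: "sum_list al = k" "sum_list al + sum_list be = n"
    using al be kn by (simp_all add: partition_of_def)
  have subV: "cvec.subspace (fst (V_pair al be))"
    unfolding fst_V_pair [OF sums] by (rule cvec.subspace_span)
  let ?N = "{F \<in> fst (V_pair al be). (\<forall>j\<in>I - {i}. component j F = 0) \<and>
    (\<forall>t. \<not> same_orbit t \<longrightarrow> F t = 0)}"
  have "cvec.subspace ?N"
  proof (rule cvec.subspaceI)
    show "0 \<in> ?N" using cvec.subspace_0 [OF subV] clinear_0 [OF component_linear] by auto
    show "x + y \<in> ?N" if "x \<in> ?N" "y \<in> ?N" for x y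
      using that cvec.subspace_add [OF subV] by (auto simp: clinear_add [OF component_linear])
    show "scaleC a x \<in> ?N" if "x \<in> ?N" for a x
      using that cvec.subspace_scale [OF subV]
      by (auto simp: clinear_scale [OF component_linear] scaleC_fun_apply)
  qed
  then have "cvec.subspace (component i ` ?N)"
    by (rule module_hom.subspace_image [OF clinear_hom [OF component_linear]])
  moreover have "{ind_tensor (n - 1) l' s w |s w. s permutes {1..n - 1} \<and>
      1 \<in> s ` {1..l'} \<and> w \<in> W_space (ai i) (bi i)} \<subseteq> component i ` ?N"
  proof
    fix G assume "G \<in> {ind_tensor (n - 1) l' s w |s w. s permutes {1..n - 1} \<and>
      1 \<in> s ` {1..l'} \<and> w \<in> W_space (ai i) (bi i)}"
    then obtain s w where G: "G = ind_tensor (n - 1) l' s w" and s: "s permutes {1..n - 1}"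
      and s1: "1 \<in> s ` {1..l'}" and w: "w \<in> W_space (ai i) (bi i)" by blast
    obtain w' where w': "w' \<in> W_space al be" "\<Phi> i w' = w" "\<forall>j\<in>I - {i}. \<Phi> j w' = 0"
      using iso i w unfolding joint_iso_def by blast
    let ?F = "ind_tensor n k (s \<circ> c) w'"
    have sc: "s \<circ> c permutes {1..n}" by (rule permutes_compose [OF c small_permutes(1) [OF s]])
    have "?F \<in> fst (V_pair al be)"
      unfolding fst_V_pair [OF sums]
      using sc one_mem_iff [OF s] s1 w'(1) by (intro cvec.span_base) blast
    moreover have "component j ?F = 0" if "j \<in> I - {i}" for j
    proof -
      have "\<Phi> j w' = 0" using w'(3) that by blast
      then show ?thesis
        unfolding component_generator [OF s] by (simp only: clinear_0 [OF clinear_ind_tensor])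
    qed
    moreover have "?F t = 0" if "\<not> same_orbit t" for t
      using ind_tensor_orbit [OF sc] same_orbit_comp [OF s] that by blast
    ultimately have "?F \<in> ?N" by blast
    then have "component i ?F \<in> component i ` ?N" by (rule imageI)
    then show "G \<in> component i ` ?N" unfolding G component_generator [OF s] w'(2) .
  qed
  ultimately have "fst (V_pair (ai i) (bi i)) \<subseteq> component i ` ?N"
    unfolding fst_V_pair [OF ai [OF i] bi [OF i]] by (intro cvec.span_minimal)
  then show ?thesis using v by blast
qed

text \<open>Left translation by g commutes with right translation by c, and
  \<open>one_mem_iff\<close> matches the truncations.\<close>

lemma component_equivariant:
  assumes g: "g permutes {1..n - 1}" and i: "i \<in> I"
  shows "component i (snd (V_pair al be) g F) = snd (V_pair (ai i) (bi i)) g (component i F)"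
proof
  fix t
  have sum: "sum_list al = k" using al by (simp add: partition_of_def)
  have iff: "inv' g \<circ> t permutes {1..n - 1} \<longleftrightarrow> t permutes {1..n - 1}"
    using permutes_compose [OF _ permutes_inv [OF g], of t]
      permutes_compose [OF _ g, of "inv' g \<circ> t"] permutes_inv_o(1) [OF g]
    by (auto simp: comp_assoc [symmetric])
  show "component i (snd (V_pair al be) g F) t = snd (V_pair (ai i) (bi i)) g (component i F) t"
  proof (cases "t permutes {1..n - 1}")
    case True
    then show ?thesis
      unfolding component_def snd_V_pair [OF sum] snd_V_pair [OF ai [OF i]] iff
      using one_mem_iff [OF True] by (simp add: comp_assoc clinear_0 [OF \<Phi>_linear])
  next
    case False
    then show ?thesis
      unfolding component_def snd_V_pair [OF ai [OF i]] iff by simp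
  qed
qed

end

section \<open>Finite dimension and the axioms of a partial representation\<close>

lemma fin_dim_space_finite_support:
  fixes V :: "('a \<Rightarrow> 'b \<Rightarrow> complex) set"
  assumes V: "cvec.subspace V" and D: "finite D"
    and supp: "\<And>F t p. F \<in> V \<Longrightarrow> F t p \<noteq> 0 \<Longrightarrow> (t, p) \<in> D"
  shows "fin_dim_space V"
proof -
  define \<delta> :: "'a \<times> 'b \<Rightarrow> 'a \<Rightarrow> 'b \<Rightarrow> complex" where
    "\<delta> d = (\<lambda>t p. if d = (t, p) then 1 else 0)" for d
  have "F \<in> cvec.span (\<delta> ` D)" if F: "F \<in> V" for F
  proof -
    have "(\<Sum>d\<in>D. scaleC (F (fst d) (snd d)) (\<delta> d)) t p = F t p" for t p
    proof -
      have app: "(\<Sum>d\<in>D. h d) t p = (\<Sum>d\<in>D. h d t p)" for h :: "'a \<times> 'b \<Rightarrow> 'a \<Rightarrow> 'b \<Rightarrow> complex"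
        by (induction D rule: infinite_finite_induct) auto
      have "(\<Sum>d\<in>D. scaleC (F (fst d) (snd d)) (\<delta> d)) t p =
          (\<Sum>d\<in>D. if d = (t, p) then F t p else 0)"
        unfolding app by (intro sum.cong) (auto simp: \<delta>_def scaleC_fun_def scaleC_complex_def)
      also have "\<dots> = F t p" using supp [OF F, of t p] D by (auto simp: sum.delta)
      finally show ?thesis .
    qed
    then have "F = (\<Sum>d\<in>D. scaleC (F (fst d) (snd d)) (\<delta> d))" by (intro ext) simp
    moreover have "(\<Sum>d\<in>D. scaleC (F (fst d) (snd d)) (\<delta> d)) \<in> cvec.span (\<delta> ` D)"
      by (intro cvec.span_sum cvec.span_scale cvec.span_base) simp
    ultimately show ?thesis by metis
  qed
  then have VD: "V \<subseteq> cvec.span (\<delta> ` D)" by blast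
  \<comment> \<open>The functions \<delta> need not lie in V, so a spanning set inside V is taken
    and bounded by their number.\<close>
  obtain B where B: "B \<subseteq> V" "cvec.independent B" "V \<subseteq> cvec.span B"
    by (rule cvec.maximal_independent_subset)
  have "finite B"
    using cvec.independent_span_bound [of "\<delta> ` D" B] D B VD by blast
  moreover have "V = cvec.span B" using B cvec.span_minimal [OF B(1) V] by blast
  ultimately show ?thesis unfolding fin_dim_space_def by blast
qed

definition tabloid_box :: "nat \<Rightarrow> nat \<Rightarrow> tabloid set" where
  "tabloid_box n r = {T. \<forall>i. (i \<in> {..<r} \<longrightarrow> T i \<in> Pow {1..n}) \<and> (i \<notin> {..<r} \<longrightarrow> T i = {})}"

lemma finite_tabloid_box: "finite (tabloid_box n r)"
  unfolding tabloid_box_def by (rule finite_set_of_finite_funs) simp_all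

lemma specht_support:
  assumes p: "partition_of n nu" and f: "f \<in> specht_space nu" and T: "f T \<noteq> 0"
  shows "T \<in> tabloid_box n (length nu)"
proof -
  have "f \<in> hw n (row_len nu)" using f by (simp add: specht_eq_hw [OF p])
  from hw_supp [OF this T] obtain w where w: "T = rows n w" and c: "\<And>i. card (T i) = row_len nu i"
    by metis
  have "T i = {}" if "i \<ge> length nu" for i
    using c [of i] that by (simp add: row_len_def w)
  moreover have "T i \<subseteq> {1..n}" for i by (auto simp: w rows_def)
  ultimately show ?thesis by (simp add: tabloid_box_def)
qed

text \<open>The group of degree q may be smaller than the one of degree m: the main proof needs the
  restriction from S_n to S_{n-1}.\<close>

lemma partial_rep_V_pair:
  assumes al: "partition_of l al" and be: "partition_of (m - l) be" and lm: "l \<le> m" and qm: "q \<le> m"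
  shows "partial_rep (sym_group q) (prep_res (carrier (sym_group q)) (V_pair al be))"
proof -
  let ?V = "fst (V_pair al be)" and ?a = "snd (V_pair al be)"
  have sums: "sum_list al = l" "sum_list al + sum_list be = m"
    using al be lm by (simp_all add: partition_of_def)
  have subV: "cvec.subspace ?V"
    unfolding fst_V_pair [OF sums] by (rule cvec.subspace_span)
  have act: "?a g F = (\<lambda>t. if 1 \<in> t ` {1..l} then F (inv' g \<circ> t) else 0)" for g F
    by (rule snd_V_pair [OF sums(1)])
  have lin: "clinear (?a g)" for g
    unfolding act by (rule clinearI; rule ext) (simp_all add: scaleC_fun_apply cvec.scale_zero_right)
  have supp: "F t = 0" if "F \<in> ?V" "1 \<notin> t ` {1..l}" for F t
    using V_pair_props(2) [OF al be lm that(1), of t] that(2) by blast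
  have qp: "g permutes {1..m}" if "g \<in> carrier (sym_group q)" for g
    using that qm by (auto simp: sym_group_carrier intro: permutes_subset)
  have into: "?a g F \<in> ?V" if g: "g \<in> carrier (sym_group q)" and F: "F \<in> ?V" for g F
  proof -
    have "?V \<subseteq> {F. ?a g F \<in> ?V}"
    proof (subst (1) fst_V_pair [OF sums], rule cvec.span_minimal, rule subsetI)
      show "cvec.subspace {F. ?a g F \<in> ?V}" by (rule subspace_clinear_vimage [OF lin subV])
      fix G assume "G \<in> {ind_tensor m l s w |s w. s permutes {1..m} \<and> 1 \<in> s ` {1..l} \<and> w \<in> W_space al be}"
      then obtain s w where G: "G = ind_tensor m l s w" and s: "s permutes {1..m}"
        and w: "w \<in> W_space al be" by blast
      have e: "?a g G = (if 1 \<in> (g \<circ> s) ` {1..l} then ind_tensor m l (g \<circ> s) w else 0)"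
        unfolding G by (rule V_pair_act)
          (use sums s qp [OF g] in \<open>simp_all add: sym_group_carrier\<close>)
      have "?a g G \<in> ?V"
      proof (cases "1 \<in> (g \<circ> s) ` {1..l}")
        case True
        then show ?thesis
          unfolding e if_P [OF True] fst_V_pair [OF sums]
          using permutes_compose [OF s qp [OF g]] w by (intro cvec.span_base) blast
      next
        case False
        show ?thesis unfolding e if_not_P [OF False] by (rule cvec.subspace_0 [OF subV])
      qed
      then show "G \<in> {F. ?a g F \<in> ?V}" unfolding mem_Collect_eq .
    qed
    then show ?thesis using F by blast
  qed
  have grp: "group (sym_group q)" by (rule sym_group_is_group)
  have fin: "fin_dim_space ?V"
  proof (rule fin_dim_space_finite_support [OF subV])
    show "finite ({t. t permutes {1..m}} \<times> (tabloid_box l (length al) \<times> tabloid_box (m - l) (length be)))"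
      by (intro finite_cartesian_product finite_tabloid_box finite_permutations) simp
    fix F t p assume F: "F \<in> ?V" and nz: "F t p \<noteq> 0"
    obtain S T where ST: "p = (S, T)" by (cases p)
    have W: "F t \<in> W_space al be" by (rule V_pair_props(1) [OF al be lm F])
    have "F t \<noteq> 0" using nz by auto
    then have "t permutes {1..m}" using V_pair_props(2) [OF al be lm F] by blast
    moreover have "S \<in> tabloid_box l (length al)"
      by (rule specht_support [OF al W_space_slice [OF W, of T]]) (use nz ST in simp)
    moreover have "T \<in> tabloid_box (m - l) (length be)"
      by (rule specht_support [OF be W_space_slice [OF W_space_swap [OF W], of S]]) (use nz ST in simp)
    ultimately show "(t, p) \<in> {t. t permutes {1..m}} \<times>
        (tabloid_box l (length al) \<times> tabloid_box (m - l) (length be))"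
      by (simp add: ST)
  qed
  have inv_q: "inv\<^bsub>sym_group q\<^esub> g = inv' g" if "g \<in> carrier (sym_group q)" for g
    by (rule sym_group_inv_equality [OF that])
  have cl: "inv' g \<in> carrier (sym_group q)" "g \<circ> h \<in> carrier (sym_group q)"
    if "g \<in> carrier (sym_group q)" "h \<in> carrier (sym_group q)" for g h
    using that by (simp_all add: sym_group_carrier permutes_inv permutes_compose)
  have inv_inv: "inv' (inv' g) = g" "inv' (g \<circ> h) = inv' h \<circ> inv' g"
    if "g \<in> carrier (sym_group q)" "h \<in> carrier (sym_group q)" for g h
    using that by (simp_all add: sym_group_carrier permutes_inv_inv o_inv_distrib permutes_bij)
  have canc: "inv' g \<circ> (g \<circ> t) = t" "g \<circ> (inv' g \<circ> t) = t" if "g \<in> carrier (sym_group q)"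
    for g and t :: "nat \<Rightarrow> nat"
    using that permutes_inv_o [of g "{1..q}"] by (simp_all add: sym_group_carrier flip: comp_assoc)
  have one: "?a id F = F" if "F \<in> ?V" for F
    using supp [OF that] by (auto simp: act)
  \<comment> \<open>The action is translation followed by truncation to 1 \<in> t[l]. In
    \<open>ax1\<close> the right side only repeats a truncation already made; in \<open>ax2\<close>
    its additional truncation has no effect because F itself vanishes where 1 \<notin> t[l].\<close>
  have ax1: "?a (inv' g) (?a (g \<circ> h) F) = ?a (inv' g) (?a g (?a h F))"
    if "g \<in> carrier (sym_group q)" "h \<in> carrier (sym_group q)" for g h F
    using that by (auto simp: act inv_inv canc comp_assoc fun_eq_iff)
  have ax2: "?a (g \<circ> h) (?a (inv' h) F) = ?a g (?a h (?a (inv' h) F))"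
    if "g \<in> carrier (sym_group q)" "h \<in> carrier (sym_group q)" "F \<in> ?V" for g h F
    using that supp [OF that(3)] by (auto simp: act inv_inv canc comp_assoc fun_eq_iff)
  show ?thesis
    unfolding partial_rep_def prep_res_def prod.case
  proof (intro conjI ballI grp fin)
    fix g assume g: "g \<in> carrier (sym_group q)"
    show "linear_between ?V ?V (restrict ?a (carrier (sym_group q)) g)"
      unfolding linear_between_def restrict_apply' [OF g]
      using into [OF g] by (auto simp: clinear_add [OF lin] clinear_scale [OF lin])
  next
    fix F assume "F \<in> ?V"
    then show "restrict ?a (carrier (sym_group q)) \<one>\<^bsub>sym_group q\<^esub> F = F"
      using one monoid.one_closed [OF group.is_monoid [OF grp]] by (simp add: sym_group_one)
  next
    fix g h F assume "g \<in> carrier (sym_group q)" "h \<in> carrier (sym_group q)" "F \<in> ?V"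
    then show
      "restrict ?a (carrier (sym_group q)) (inv\<^bsub>sym_group q\<^esub> g)
          (restrict ?a (carrier (sym_group q)) (g \<otimes>\<^bsub>sym_group q\<^esub> h) F) =
        restrict ?a (carrier (sym_group q)) (inv\<^bsub>sym_group q\<^esub> g)
          (restrict ?a (carrier (sym_group q)) g (restrict ?a (carrier (sym_group q)) h F))"
      "restrict ?a (carrier (sym_group q)) (g \<otimes>\<^bsub>sym_group q\<^esub> h)
          (restrict ?a (carrier (sym_group q)) (inv\<^bsub>sym_group q\<^esub> h) F) =
        restrict ?a (carrier (sym_group q)) g (restrict ?a (carrier (sym_group q)) h
          (restrict ?a (carrier (sym_group q)) (inv\<^bsub>sym_group q\<^esub> h) F))"
      using cl ax1 ax2 by (simp_all only: inv_q sym_group_mult restrict_apply')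
  qed
qed

text \<open>The partial representation axioms of the target are transported along the isomorphism.\<close>

lemma prep_isoI:
  assumes R: "partial_rep G R" and f: "clinear f"
    and img: "f ` fst R = fst S" and inj: "inj_on f (fst R)"
    and eq: "\<And>g v. g \<in> carrier G \<Longrightarrow> v \<in> fst R \<Longrightarrow> f (snd R g v) = snd S g (f v)"
  shows "prep_iso G R S"
proof -
  obtain V a where Ra: "R = (V, a)" by (cases R)
  obtain W b where Sb: "S = (W, b)" by (cases S)
  have W: "W = f ` V" using img by (simp add: Ra Sb)
  have e: "b g (f v) = f (a g v)" if "g \<in> carrier G" "v \<in> V" for g v
    using eq [of g v] that by (simp add: Ra Sb)
  have grp: "group G" and fin: "fin_dim_space V"
    and lin: "\<And>g. g \<in> carrier G \<Longrightarrow> linear_between V V (a g)"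
    and ax: "\<And>v. v \<in> V \<Longrightarrow> a \<one>\<^bsub>G\<^esub> v = v"
      "\<And>g h v. g \<in> carrier G \<Longrightarrow> h \<in> carrier G \<Longrightarrow> v \<in> V \<Longrightarrow>
        a (inv\<^bsub>G\<^esub> g) (a (g \<otimes>\<^bsub>G\<^esub> h) v) = a (inv\<^bsub>G\<^esub> g) (a g (a h v))"
      "\<And>g h v. g \<in> carrier G \<Longrightarrow> h \<in> carrier G \<Longrightarrow> v \<in> V \<Longrightarrow>
        a (g \<otimes>\<^bsub>G\<^esub> h) (a (inv\<^bsub>G\<^esub> h) v) = a g (a h (a (inv\<^bsub>G\<^esub> h) v))"
    using R unfolding partial_rep_def Ra prod.case by blast+
  have aV: "a g v \<in> V" if "g \<in> carrier G" "v \<in> V" for g v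
    using lin [OF that(1)] that(2) unfolding linear_between_def by blast
  have subV: "cvec.subspace V" using fin unfolding fin_dim_space_def by auto
  have cl: "g \<otimes>\<^bsub>G\<^esub> h \<in> carrier G" "inv\<^bsub>G\<^esub> g \<in> carrier G" "inv\<^bsub>G\<^esub> h \<in> carrier G"
    if "g \<in> carrier G" "h \<in> carrier G" for g h
    using that grp by (simp_all add: group.inv_closed group.is_monoid monoid.m_closed)
  have finW: "fin_dim_space W"
  proof -
    obtain B where B: "finite B" "V = cvec.span B" using fin unfolding fin_dim_space_def by blast
    have "W = cvec.span (f ` B)"
      unfolding W B(2) by (rule module_hom.span_image [OF clinear_hom [OF f], symmetric])
    then show ?thesis using B(1) unfolding fin_dim_space_def by blast
  qed
  have linW: "linear_between W W (b g)" if g: "g \<in> carrier G" for g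
    unfolding linear_between_def W
  proof (intro conjI ballI allI)
    show "b g ` f ` V \<subseteq> f ` V" using e [OF g] aV [OF g] by auto
    fix x y assume "x \<in> f ` V" "y \<in> f ` V"
    then obtain u v where uv: "u \<in> V" "v \<in> V" "x = f u" "y = f v" by blast
    have "b g (x + y) = f (a g (u + v))"
      using e [OF g cvec.subspace_add [OF subV uv(1,2)]] by (simp add: uv clinear_add [OF f])
    also have "a g (u + v) = a g u + a g v"
      using lin [OF g] uv(1,2) unfolding linear_between_def by blast
    finally show "b g (x + y) = b g x + b g y"
      using e [OF g] uv by (simp add: clinear_add [OF f])
  next
    fix c x assume "x \<in> f ` V"
    then obtain u where u: "u \<in> V" "x = f u" by blast
    have "b g (scaleC c x) = f (a g (scaleC c u))"
      using e [OF g cvec.subspace_scale [OF subV u(1)]] by (simp add: u clinear_scale [OF f])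
    also have "a g (scaleC c u) = scaleC c (a g u)"
      using lin [OF g] u(1) unfolding linear_between_def by blast
    finally show "b g (scaleC c x) = scaleC c (b g x)"
      using e [OF g] u by (simp add: clinear_scale [OF f])
  qed
  have "partial_rep G S"
    unfolding partial_rep_def Sb prod.case
  proof (intro conjI ballI grp finW linW)
    show "b \<one>\<^bsub>G\<^esub> w = w" if "w \<in> W" for w
      using that e ax(1) monoid.one_closed [OF group.is_monoid [OF grp]] unfolding W by auto
  next
    fix g h w assume g: "g \<in> carrier G" and h: "h \<in> carrier G" and "w \<in> W"
    then obtain v where v: "v \<in> V" "w = f v" unfolding W by blast
    show "b (inv\<^bsub>G\<^esub> g) (b (g \<otimes>\<^bsub>G\<^esub> h) w) = b (inv\<^bsub>G\<^esub> g) (b g (b h w))"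
      using ax(2) [OF g h v(1)] by (simp add: v e aV g h cl [OF g h])
    show "b (g \<otimes>\<^bsub>G\<^esub> h) (b (inv\<^bsub>G\<^esub> h) w) = b g (b h (b (inv\<^bsub>G\<^esub> h) w))"
      using ax(3) [OF g h v(1)] by (simp add: v e aV g h cl [OF g h])
  qed assumption
  moreover have "linear_between (fst R) (fst S) f"
    unfolding linear_between_def using img by (auto simp: clinear_add [OF f] clinear_scale [OF f])
  moreover have "bij_betw f (fst R) (fst S)" using inj img by (simp add: bij_betw_def)
  ultimately show ?thesis unfolding prep_iso_def using R eq by blast
qed

lemma specht_joint_iso:
  assumes "partition_of n nu" "1 \<le> n"
  obtains \<phi> where "joint_iso (corner_removals nu) (specht_space nu) specht_space \<phi>"
    "\<And>nu1 g f. g permutes {1..n - 1} \<Longrightarrow> \<phi> nu1 (specht_act g f) = specht_act g (\<phi> nu1 f)"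
proof -
  from specht_branching [OF assms] obtain \<phi> where \<phi>: "\<And>nu1. clinear (\<phi> nu1)"
    "\<And>nu1 f. nu1 \<in> corner_removals nu \<Longrightarrow> \<phi> nu1 f \<in> specht_space nu1"
    "\<And>nu1 g f. g permutes {1..n - 1} \<Longrightarrow> \<phi> nu1 (specht_act g f) = specht_act g (\<phi> nu1 f)"
    "\<And>f. f \<in> specht_space nu \<Longrightarrow> (\<And>nu1. nu1 \<in> corner_removals nu \<Longrightarrow> \<phi> nu1 f = 0) \<Longrightarrow> f = 0"
    "\<And>nu1 g. nu1 \<in> corner_removals nu \<Longrightarrow> g \<in> specht_space nu1 \<Longrightarrow>
      \<exists>f\<in>specht_space nu. \<phi> nu1 f = g \<and> (\<forall>nu2\<in>corner_removals nu - {nu1}. \<phi> nu2 f = 0)"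
    by blast
  have "joint_iso (corner_removals nu) (specht_space nu) specht_space \<phi>"
    unfolding joint_iso_def using \<phi>(1,2,4,5) by blast
  then show ?thesis using that \<phi>(3) by blast
qed

section \<open>The two orbits\<close>

text \<open>Represents the orbit with n \<in> s[k]: the cycle sending k to n and shifting k+1, ...,
  n down by one. Being monotone on {k+1..n}, it leaves the labelling of the second block intact, as
  the transposition of k and n would not.\<close>

definition cyc :: "nat \<Rightarrow> nat \<Rightarrow> nat \<Rightarrow> nat" where
  "cyc n k i = (if i < k \<or> n < i then i else if i = k then n else i - 1)"

definition cyc_inv :: "nat \<Rightarrow> nat \<Rightarrow> nat \<Rightarrow> nat" where
  "cyc_inv n k i = (if i < k \<or> n < i then i else if i = n then k else i + 1)"

lemma cyc_inverses:
  assumes "k \<le> n"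
  shows "cyc n k (cyc_inv n k i) = i" "cyc_inv n k (cyc n k i) = i"
  using assms by (auto simp: cyc_def cyc_inv_def)

lemma cyc_permutes:
  assumes "1 \<le> k" "k \<le> n"
  shows "cyc n k permutes {1..n}"
proof -
  have "bij (cyc n k)"
    by (rule o_bij [of "cyc_inv n k"]) (simp_all add: fun_eq_iff cyc_inverses [OF assms(2)])
  moreover have "cyc n k i = i" if "i \<notin> {1..n}" for i
    using that assms by (auto simp: cyc_def)
  ultimately show ?thesis unfolding permutes_def bij_iff by blast
qed

lemma inv_cyc:
  assumes "k \<le> n"
  shows "inv' (cyc n k) = cyc_inv n k"
  by (rule inv_unique_comp) (simp_all add: fun_eq_iff cyc_inverses [OF assms])

lemma cyc_image:
  assumes "1 \<le> k" "k \<le> n"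
  shows "cyc n k ` {1..k} = insert n {1..k - 1}"
proof -
  have "{1..k} = insert k {1..k - 1}" using assms(1) by auto
  moreover have "cyc n k ` {1..k - 1} = (\<lambda>i. i) ` {1..k - 1}"
    using assms by (intro image_cong) (auto simp: cyc_def)
  moreover have "cyc n k k = n" using assms by (simp add: cyc_def)
  ultimately show ?thesis by simp
qed

text \<open>The conjugate fixes k, since \<rho> fixes n, and acts on {k+1..n} as \<rho> does on
  {k..n-1}. The different shifts in \<open>comp2 k\<close> and \<open>comp2 (k - 1)\<close>
  compensate this displacement.\<close>

lemma comp_cyc_conj:
  assumes k: "1 \<le> k" "k \<le> n" and \<rho>: "\<rho> \<in> young_K (n - 1) (k - 1)"
  shows "comp1 k (inv' (cyc n k) \<circ> \<rho> \<circ> cyc n k) = comp1 (k - 1) \<rho>"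
    and "comp2 k (inv' (cyc n k) \<circ> \<rho> \<circ> cyc n k) = comp2 (k - 1) \<rho>"
proof -
  have \<rho>p: "\<rho> permutes {1..n - 1}" by (rule young_K_permutes [OF \<rho>])
  have \<rho>n: "\<rho> i = i" if "i \<ge> n" for i
    by (rule permutes_not_in [OF \<rho>p]) (use that k in auto)
  have \<rho>0: "\<rho> 0 = 0" by (rule permutes_not_in [OF \<rho>p]) auto
  show "comp1 k (inv' (cyc n k) \<circ> \<rho> \<circ> cyc n k) = comp1 (k - 1) \<rho>"
  proof
    fix i
    consider "i = 0 \<or> k < i" | "1 \<le> i" "i \<le> k - 1" | "i = k" using k by linarith
    then show "comp1 k (inv' (cyc n k) \<circ> \<rho> \<circ> cyc n k) i = comp1 (k - 1) \<rho> i"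
    proof cases
      case 1
      then show ?thesis by (auto simp: comp1_def)
    next
      case 2
      then have "\<rho> i \<in> {1..k - 1}" using young_K_low [OF \<rho>, of i] by simp
      then have "\<rho> i < k" using k by auto
      moreover have "i < k" using 2 k by auto
      ultimately show ?thesis using 2 k by (simp add: comp1_def inv_cyc cyc_def cyc_inv_def)
    next
      case 3
      then show ?thesis using k by (simp add: comp1_def inv_cyc cyc_def cyc_inv_def \<rho>n)
    qed
  qed
  show "comp2 k (inv' (cyc n k) \<circ> \<rho> \<circ> cyc n k) = comp2 (k - 1) \<rho>"
  proof
    fix j
    show "comp2 k (inv' (cyc n k) \<circ> \<rho> \<circ> cyc n k) j = comp2 (k - 1) \<rho> j"
    proof (cases "1 \<le> j")
      case False
      then show ?thesis by (simp add: comp2_def)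
    next
      case j: True
      have jk: "j + (k - 1) = j + k - 1" using k by simp
      show ?thesis
      proof (cases "j + k \<le> n")
        case True
        have hi: "k - 1 < \<rho> (j + k - 1)" using young_K_high [OF \<rho> j] by (simp only: jk)
        have "\<rho> (j + k - 1) \<in> {1..n - 1}"
          using permutes_in_image [OF \<rho>p, of "j + k - 1"] j k True by auto
        then have "\<not> \<rho> (j + k - 1) < k" "\<rho> (j + k - 1) < n" using hi k by auto
        moreover have "cyc n k (j + k) = j + k - 1" using True j by (simp add: cyc_def)
        ultimately show ?thesis using j k hi by (simp add: comp2_def inv_cyc cyc_inv_def jk)
      next
        case False
        then have "\<rho> (j + k - 1) = j + k - 1" "\<rho> (j + k) = j + k" by (simp_all add: \<rho>n)
        then show ?thesis using j k False by (simp add: comp2_def inv_cyc cyc_def cyc_inv_def jk)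
      qed
    qed
  qed
qed

theorem mainTheorem13:
  fixes n k :: nat and lam mu :: "nat list"
  assumes "1 < k" and "k < n"
    and "partition_of k lam" and "partition_of (n - k) mu"
  shows "prep_iso (sym_group n\<lparr>carrier := fix_last n\<rparr>)
           (prep_res (fix_last n) (V_pair lam mu))
           (prep_sum
              (prep_dsum (corner_removals lam) (\<lambda>lam1. V_pair lam1 mu))
              (prep_dsum (corner_removals mu) (\<lambda>mu1. V_pair lam mu1)))"
proof -
  let ?I = "corner_removals lam" and ?J = "corner_removals mu"
  let ?V = "fst (V_pair lam mu)"
  note lam = assms(3) and mu = assms(4)
  have sums: "sum_list lam = k" "sum_list mu = n - k" using lam mu by (simp_all add: partition_of_def)
  have k: "1 \<le> k" "k \<le> n" and n: "1 < n" using assms(1,2) by auto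
  have fixl: "fix_last n = carrier (sym_group (n - 1))" using n by (simp add: fix_last_eq)
  \<comment> \<open>The symmetric groups of all degrees share multiplication and unit, so only the
    carrier distinguishes them.\<close>
  then have G: "sym_group n\<lparr>carrier := fix_last n\<rparr> = sym_group (n - 1)" by (simp add: sym_group_def)

  from specht_joint_iso [OF lam k(1)] obtain \<phi> where
    \<phi>: "joint_iso ?I (specht_space lam) specht_space \<phi>"
    and \<phi>_eqv: "\<And>i g f. g permutes {1..k - 1} \<Longrightarrow> \<phi> i (specht_act g f) = specht_act g (\<phi> i f)"
    by blast
  have "1 \<le> n - k" using assms(2) by simp
  from specht_joint_iso [OF mu this] obtain \<psi> where
    \<psi>: "joint_iso ?J (specht_space mu) specht_space \<psi>"
    and \<psi>_eqv: "\<And>i g f. g permutes {1..n - k - 1} \<Longrightarrow> \<psi> i (specht_act g f) = specht_act g (\<psi> i f)"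
    by blast

  have sumI: "sum_list i = k - 1" if "i \<in> ?I" for i
    by (rule corner_removalsE [OF lam that]) (simp add: partition_of_def)
  have sumJ: "sum_list j = n - k - 1" if "j \<in> ?J" for j
    by (rule corner_removalsE [OF mu that]) (simp add: partition_of_def)

  \<comment> \<open>Sets s[k] containing n: deleting n from \<open>cyc n k\<close> applied to [k]
    leaves [k - 1].\<close>
  interpret A: branch_component n k "k - 1" "cyc n k" lam mu ?I "\<lambda>i. i" "\<lambda>_. mu" "\<lambda>i. left_map (\<phi> i)"
  proof
    show "cyc n k ` {1..k} - {n} = {1..k - 1}" using cyc_image [OF k] assms(2) by auto
    show "joint_iso ?I (W_space lam mu) (\<lambda>i. W_space i mu) (\<lambda>i. left_map (\<phi> i))"
      by (rule joint_iso_left [OF \<phi>])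
    fix \<rho> i w assume \<rho>: "\<rho> \<in> young_K (n - 1) (k - 1)"
    show "left_map (\<phi> i) (W_act k (inv' (cyc n k) \<circ> \<rho> \<circ> cyc n k) w) = W_act (k - 1) \<rho> (left_map (\<phi> i) w)"
      unfolding W_act_pair_act comp_cyc_conj [OF k \<rho>]
      by (rule left_map_pair_act) (rule \<phi>_eqv [OF comp1_permutes [OF \<rho>]])
  qed (use n k lam mu sumI sums assms in \<open>simp_all add: cyc_permutes [OF k, simplified]\<close>)

  \<comment> \<open>Sets s[k] avoiding n: [k] itself is one of them as k < n, so the representative
    is the identity and the first block keeps its size.\<close>
  interpret B: branch_component n k k id lam mu ?J "\<lambda>_. lam" "\<lambda>j. j"
    "\<lambda>j F. left_map (\<psi> j) (F \<circ> prod.swap) \<circ> prod.swap"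
  proof
    show "joint_iso ?J (W_space lam mu) (\<lambda>j. W_space lam j)
        (\<lambda>j F. left_map (\<psi> j) (F \<circ> prod.swap) \<circ> prod.swap)"
      by (rule joint_iso_right [OF \<psi>])
    fix \<rho> i w assume \<rho>: "\<rho> \<in> young_K (n - 1) k"
    have "comp2 k \<rho> permutes {1..n - k - 1}" using comp2_permutes [OF \<rho>] by (simp add: diff_commute)
    then show "left_map (\<psi> i) (W_act k (inv' id \<circ> \<rho> \<circ> id) w \<circ> prod.swap) \<circ> prod.swap =
        W_act k \<rho> (left_map (\<psi> i) (w \<circ> prod.swap) \<circ> prod.swap)"
      unfolding W_act_pair_act inv_id id_comp comp_id
      by (intro right_map_pair_act \<psi>_eqv)
  qed (use n k lam mu sumJ sums assms in \<open>simp_all add: permutes_id\<close>)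

  have orbits: "A.same_orbit t \<longleftrightarrow> \<not> B.same_orbit t" for t
    unfolding A.same_orbit_def B.same_orbit_def cyc_image [OF k] using assms(2) by simp

  \<comment> \<open>Elements of \<open>prep_dsum\<close> vanish off the index set, whereas
    \<open>component\<close> is defined for every list; hence the default 0.\<close>
  define \<Psi> where "\<Psi> F = ((\<lambda>i. if i \<in> ?I then A.component i F else 0),
    (\<lambda>j. if j \<in> ?J then B.component j F else 0))" for F
  have lin: "clinear \<Psi>"
    by (rule clinearI; rule prod_eqI; rule ext)
      (simp_all add: \<Psi>_def scaleC_prod_def scaleC_fun_apply cvec.scale_zero_right
        clinear_add [OF A.component_linear] clinear_add [OF B.component_linear]
        clinear_scale [OF A.component_linear] clinear_scale [OF B.component_linear])
  let ?S = "prep_sum (prep_dsum ?I (\<lambda>lam1. V_pair lam1 mu)) (prep_dsum ?J (\<lambda>mu1. V_pair lam mu1))"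
  have subV: "cvec.subspace ?V"
    by (subst fst_V_pair [OF refl refl]) (rule cvec.subspace_span)

  have "F = 0" if F: "F \<in> ?V" and z: "\<Psi> F = 0" for F
  proof
    fix t
    have "A.component i F = 0" if "i \<in> ?I" for i
      using fun_cong [OF arg_cong [OF z, of fst], of i] that by (simp add: \<Psi>_def)
    moreover have "B.component j F = 0" if "j \<in> ?J" for j
      using fun_cong [OF arg_cong [OF z, of snd], of j] that by (simp add: \<Psi>_def)
    ultimately show "F t = 0 t"
      using A.component_inj [OF F, of t] B.component_inj [OF F, of t] orbits [of t] by auto
  qed
  then have inj: "inj_on \<Psi> ?V"
    by (intro inj_onI) (metis clinear_diff [OF lin] cvec.subspace_diff [OF subV] right_minus_eq)

  have img: "\<Psi> ` ?V = fst ?S"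
  proof
    show "\<Psi> ` ?V \<subseteq> fst ?S"
      using A.component_into B.component_into by (auto simp: \<Psi>_def prep_sum_def prep_dsum_def)
    show "fst ?S \<subseteq> \<Psi> ` ?V"
    proof
      fix z assume "z \<in> fst ?S"
      then obtain x y where z: "z = (x, y)"
        and x: "\<And>i. i \<in> ?I \<Longrightarrow> x i \<in> fst (V_pair i mu)" "\<And>i. i \<notin> ?I \<Longrightarrow> x i = 0"
        and y: "\<And>j. j \<in> ?J \<Longrightarrow> y j \<in> fst (V_pair lam j)" "\<And>j. j \<notin> ?J \<Longrightarrow> y j = 0"
        by (auto simp: prep_sum_def prep_dsum_def)
      have "\<forall>i\<in>?I. \<exists>F. F \<in> ?V \<and> A.component i F = x i \<and> (\<forall>j\<in>?I - {i}. A.component j F = 0) \<and>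
          (\<forall>t. \<not> A.same_orbit t \<longrightarrow> F t = 0)"
        using A.component_surj x(1) by blast
      from bchoice [OF this] obtain P where P0: "\<forall>i\<in>?I. P i \<in> ?V \<and> A.component i (P i) = x i \<and>
          (\<forall>j\<in>?I - {i}. A.component j (P i) = 0) \<and> (\<forall>t. \<not> A.same_orbit t \<longrightarrow> P i t = 0)"
        by (rule exE)
      have P: "P i \<in> ?V" "\<And>t. \<not> A.same_orbit t \<Longrightarrow> P i t = 0"
        "\<And>j. j \<in> ?I \<Longrightarrow> A.component j (P i) = (if j = i then x j else 0)" if "i \<in> ?I" for i
        using bspec [OF P0 that] by auto
      have "\<forall>j\<in>?J. \<exists>F. F \<in> ?V \<and> B.component j F = y j \<and> (\<forall>i\<in>?J - {j}. B.component i F = 0) \<and>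
          (\<forall>t. \<not> B.same_orbit t \<longrightarrow> F t = 0)"
        using B.component_surj y(1) by blast
      from bchoice [OF this] obtain Q where Q0: "\<forall>j\<in>?J. Q j \<in> ?V \<and> B.component j (Q j) = y j \<and>
          (\<forall>i\<in>?J - {j}. B.component i (Q j) = 0) \<and> (\<forall>t. \<not> B.same_orbit t \<longrightarrow> Q j t = 0)"
        by (rule exE)
      have Q: "Q j \<in> ?V" "\<And>t. \<not> B.same_orbit t \<Longrightarrow> Q j t = 0"
        "\<And>i. i \<in> ?J \<Longrightarrow> B.component i (Q j) = (if i = j then y i else 0)" if "j \<in> ?J" for j
        using bspec [OF Q0 that] by auto
      \<comment> \<open>Each component of \<open>?F\<close> receives a contribution from its own
        lift only: lifts of the other orbit are invisible to it, and those of the same orbit were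
        chosen with disjoint components.\<close>
      let ?F = "(\<Sum>i\<in>?I. P i) + (\<Sum>j\<in>?J. Q j)"
      have "?F \<in> ?V"
        by (intro cvec.subspace_add [OF subV] cvec.subspace_sum [OF subV] P(1) Q(1))
      moreover have "A.component i ?F = x i" if i: "i \<in> ?I" for i
      proof -
        have "A.component i (Q j) = 0" if "j \<in> ?J" for j
          by (rule A.component_other_orbit) (use Q(2) [OF that] orbits in blast)
        then have "(\<Sum>j\<in>?J. A.component i (Q j)) = 0" by (intro sum.neutral) blast
        moreover have "(\<Sum>i'\<in>?I. A.component i (P i')) = (\<Sum>i'\<in>?I. if i = i' then x i else 0)"
          by (rule sum.cong) (simp_all only: P(3) [OF _ i])
        ultimately show ?thesis
          unfolding clinear_add [OF A.component_linear] clinear_sum [OF A.component_linear]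
          using i finite_corner_removals [OF lam] by (simp add: sum.delta')
      qed
      moreover have "B.component j ?F = y j" if j: "j \<in> ?J" for j
      proof -
        have "B.component j (P i) = 0" if "i \<in> ?I" for i
          by (rule B.component_other_orbit) (use P(2) [OF that] orbits in blast)
        then have "(\<Sum>i\<in>?I. B.component j (P i)) = 0" by (intro sum.neutral) blast
        moreover have "(\<Sum>j'\<in>?J. B.component j (Q j')) = (\<Sum>j'\<in>?J. if j = j' then y j else 0)"
          by (rule sum.cong) (simp_all only: Q(3) [OF _ j])
        ultimately show ?thesis
          unfolding clinear_add [OF B.component_linear] clinear_sum [OF B.component_linear]
          using j finite_corner_removals [OF mu] by (simp add: sum.delta')
      qed
      ultimately have "?F \<in> ?V" "\<Psi> ?F = z"
        using x(2) y(2) by (auto simp: \<Psi>_def z fun_eq_iff)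
      then show "z \<in> \<Psi> ` ?V" by blast
    qed
  qed

  show ?thesis
    unfolding G unfolding fixl
  proof (rule prep_isoI [OF _ lin])
    show "partial_rep (sym_group (n - 1)) (prep_res (carrier (sym_group (n - 1))) (V_pair lam mu))"
      by (rule partial_rep_V_pair [OF lam mu k(2)]) simp
    show "\<Psi> ` fst (prep_res (carrier (sym_group (n - 1))) (V_pair lam mu)) = fst ?S"
      using img by (simp add: prep_res_def)
    show "inj_on \<Psi> (fst (prep_res (carrier (sym_group (n - 1))) (V_pair lam mu)))"
      using inj by (simp add: prep_res_def)
    fix g F assume g: "g \<in> carrier (sym_group (n - 1))"
    then have "g permutes {1..n - 1}" by (simp only: sym_group_carrier)
    then show "\<Psi> (snd (prep_res (carrier (sym_group (n - 1))) (V_pair lam mu)) g F) = snd ?S g (\<Psi> F)"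
      using g A.component_equivariant B.component_equivariant
      by (simp add: prep_res_def \<Psi>_def prep_sum_def prep_dsum_def fun_eq_iff)
  qed
qed

end
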